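(* Let $\Gamma\subset\mathbb{R}$ be a separated set, let $a<b$ be real numbers, and let $\mathcal{G}\in L^2(\mathbb{R})$ be a generator such that $\hat{\mathcal{G}}$ is a continuous function whose zero set is $\mathrm{Zer}(\hat{\mathcal{G}})=\mathbb{R}\setminus(a,b)$. Then the $\Gamma$-shifts of $\mathcal{G}$ are $l^2$-stable if and only if $D^+(\Gamma)<b-a$.
   Context: Fourier transform: $\hat f(x)=\int_{\mathbb{R}} e^{-2\pi i xt}f(t)\,dt$, extended to $L^2(\mathbb{R})$ as usual; $\mathrm{Zer}(\hat{\mathcal{G}}):=\{t\in\mathbb{R}:\hat{\mathcal{G}}(t)=0\}$. A set $\Gamma\subset\mathbb{R}$ is separated if $\inf_{\gamma,\gamma'\in\Gamma,\gamma\ne\gamma'}|\gamma-\gamma'|>0$. Its upper uniform density is $D^+(\Gamma):=\lim_{r\to\infty}\sup_{x\in\mathbb{R}}\frac{\#(\Gamma\cap(x,x+r))}{r}$. The $\Gamma$-shifts of $\mathcal{G}$ are $l^2$-stable if there exist positive constants $C_1,C_2$ with $C_1\|\mathbf{c}\|_2\le\|\sum_{\gamma\in\Gamma}c_\gamma\mathcal{G}(\cdot-\gamma)\|_{2}\le C_2\|\mathbf{c}\|_2$ for every $\mathbf{c}=\{c_\gamma\}\in l^2(\Gamma)$ (the series being understood as converging in $L^2(\mathbb{R})$). *)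

theory Defs
  imports "HOL-Analysis.Analysis"
begin

(* Elements of L^2(R) are handled through representatives; every class of Lebesgue
   measurable functions modulo null sets has a Borel one, so lborel loses nothing. *)
definition L2 :: "(real \<Rightarrow> complex) set" where
  "L2 = {f. f \<in> borel_measurable lborel \<and> integrable lborel (\<lambda>x. (cmod (f x))\<^sup>2)}"

definition L2_norm :: "(real \<Rightarrow> complex) \<Rightarrow> real" where
  "L2_norm f = sqrt (LINT x|lborel. (cmod (f x))\<^sup>2)"

definition L2_tendsto :: "('i \<Rightarrow> real \<Rightarrow> complex) \<Rightarrow> (real \<Rightarrow> complex) \<Rightarrow> 'i filter \<Rightarrow> bool" where
  "L2_tendsto f F net \<longleftrightarrow>
     F \<in> L2 \<and> (\<forall>\<^sub>F i in net. f i \<in> L2) \<and> ((\<lambda>i. L2_norm (\<lambda>x. f i x - F x)) \<longlongrightarrow> 0) net"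

definition fourier :: "(real \<Rightarrow> complex) \<Rightarrow> real \<Rightarrow> complex" where
  "fourier f x = (LINT t|lborel. exp (- (2 * of_real pi * \<i> * of_real x * of_real t)) * f t)"

(* H represents the L^2 Fourier transform of G, i.e. the value at G of the continuous
   extension to L^2 of the transform on L^1 \<inter> L^2.  By Plancherel such an H exists, is
   unique up to null sets, and does not depend on the approximating sequence. *)
definition has_fourier_L2 :: "(real \<Rightarrow> complex) \<Rightarrow> (real \<Rightarrow> complex) \<Rightarrow> bool" where
  "has_fourier_L2 G H \<longleftrightarrow>
     (\<exists>f :: nat \<Rightarrow> real \<Rightarrow> complex.
        (\<forall>n. f n \<in> L2 \<and> integrable lborel (f n)) \<and>
        L2_tendsto f G sequentially \<and>
        L2_tendsto (\<lambda>n. fourier (f n)) H sequentially)"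

definition zero_set :: "(real \<Rightarrow> complex) \<Rightarrow> real set" where
  "zero_set H = {t. H t = 0}"

(* The infimum is taken in ereal, so that it is \<infinity> when \<Gamma> has at most one point. *)
definition separated_set :: "real set \<Rightarrow> bool" where
  "separated_set \<Gamma> \<longleftrightarrow>
     0 < (INF (\<gamma>, \<gamma>') \<in> {(\<gamma>, \<gamma>'). \<gamma> \<in> \<Gamma> \<and> \<gamma>' \<in> \<Gamma> \<and> \<gamma> \<noteq> \<gamma>'}. ereal \<bar>\<gamma> - \<gamma>'\<bar>)"

(* Points are counted by the counting measure rather than card, which is 0 on infinite sets. *)
definition upper_uniform_density :: "real set \<Rightarrow> ennreal" where
  "upper_uniform_density \<Gamma> =
     Lim at_top (\<lambda>r::real. SUP x::real.
       emeasure (count_space UNIV) (\<Gamma> \<inter> {x<..<x + r}) / ennreal r)"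

definition ell2 :: "real set \<Rightarrow> (real \<Rightarrow> complex) set" where
  "ell2 \<Gamma> = {c. (\<lambda>\<gamma>. (cmod (c \<gamma>))\<^sup>2) summable_on \<Gamma>}"

definition ell2_norm :: "real set \<Rightarrow> (real \<Rightarrow> complex) \<Rightarrow> real" where
  "ell2_norm \<Gamma> c = sqrt (\<Sum>\<^sub>\<infinity>\<gamma>\<in>\<Gamma>. (cmod (c \<gamma>))\<^sup>2)"

(* The series over the unordered index set \<Gamma> converges along the net of finite partial sums. *)
definition has_shift_sum ::
    "real set \<Rightarrow> (real \<Rightarrow> complex) \<Rightarrow> (real \<Rightarrow> complex) \<Rightarrow> (real \<Rightarrow> complex) \<Rightarrow> bool" where
  "has_shift_sum \<Gamma> G c F \<longleftrightarrow>
     L2_tendsto (\<lambda>X x. \<Sum>\<gamma>\<in>X. c \<gamma> * G (x - \<gamma>)) F (finite_subsets_at_top \<Gamma>)"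

definition l2_stable_shifts :: "real set \<Rightarrow> (real \<Rightarrow> complex) \<Rightarrow> bool" where
  "l2_stable_shifts \<Gamma> G \<longleftrightarrow>
     (\<exists>C1>0. \<exists>C2>0. \<forall>c\<in>ell2 \<Gamma>. \<exists>F. has_shift_sum \<Gamma> G c F \<and>
        C1 * ell2_norm \<Gamma> c \<le> L2_norm F \<and> L2_norm F \<le> C2 * ell2_norm \<Gamma> c)"

end

theory Submission imports Defs "HOL-Probability.Probability" begin

text \<open>
  The transform of a finite sum \<open>\<Sum>c\<^sub>\<gamma> G(x - \<gamma>)\<close> is \<open>H\<close> times an exponential sum with
  frequencies in \<open>\<Gamma>\<close>, and \<open>H\<close> lives on \<open>(a,b)\<close>.  By Plancherel, stability says that
  \<open>\<Sum>|c\<^sub>\<gamma>|\<^sup>2\<close> is comparable to the integral over \<open>(a,b)\<close> of \<open>|H|\<^sup>2\<close> times the squared exponential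
  sum (\<open>shift_sum_norm_interval\<close>); passing from finite to infinite sums is completeness of \<open>L\<^sup>2\<close>
  (\<open>finite_bounds_imp_stable\<close>).  The upper bound always holds, because \<open>H\<close> is bounded and \<open>\<Gamma>\<close> is
  separated (\<open>energy_upper\<close>).  What remains is a statement on exponential sums.

  Density below \<open>b - a\<close> suffices.  On a compact subinterval longer than the density \<open>|H|\<close> is
  bounded below, so \<open>riesz_lower_bound\<close> applies: exponentials with frequencies in \<open>\<Gamma>\<close> are a Riesz
  sequence on every interval longer than the density.  If each window of length \<open>s\<close> contains at
  most \<open>K\<close> frequencies, all of them except a given \<open>g\<close> can be wiped out by averaging operators.
  The boundedly many frequencies near \<open>g\<close> are removed one at a time by a difference operator of
  arbitrarily small step; the others split, by their rank modulo \<open>K\<close>, into \<open>K\<close> classes with gaps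
  at least \<open>s\<close>, and Ingham's inequality (\<open>ingham_lower\<close>) supplies for each class an operator that
  consumes an interval of length just above \<open>1/s\<close>.  The total cost is about \<open>K/s\<close>, and one
  coefficient is controlled.  Applying this to a short localised average of the sum around each
  frequency, and adding up with Bessel's inequality, controls all coefficients at once.

  Density below \<open>b - a\<close> is necessary.  Since \<open>H\<close> vanishes at both ends of \<open>(a,b)\<close>, the parts near
  the ends contribute a small fraction of \<open>\<Sum>|c\<^sub>\<gamma>|\<^sup>2\<close>, so the lower bound survives on a shorter
  interval of length \<open>L < b - a\<close>, even with a weight vanishing at its ends.  That weight makes
  the Fourier coefficients on this interval decay quadratically.  If a window of length \<open>r\<close>
  held clearly more than \<open>L r\<close> frequencies, linear algebra would give nonzero coefficients that
  annihilate all Fourier coefficients in a slightly larger window, and the remaining ones are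
  too small to satisfy the lower bound (\<open>frequency_count\<close>, \<open>weighted_lower_bound_count\<close>).

  The limit in the definition of the density exists by subadditivity (\<open>upper_density_limit\<close>).
\<close>

section \<open>Exponential sums and the sine kernel\<close>

definition ee :: "real \<Rightarrow> complex" where
  "ee x = cis (2 * pi * x)"

definition expsum :: "(real \<Rightarrow> complex) \<Rightarrow> real set \<Rightarrow> real \<Rightarrow> complex" where
  "expsum c X t = (\<Sum>x\<in>X. c x * ee (x * t))"

lemma ee_0 [simp]: "ee 0 = 1"
  by (simp add: ee_def)

lemma ee_add: "ee (x + y) = ee x * ee y"
  by (simp add: ee_def cis_mult algebra_simps)

lemma norm_ee [simp]: "cmod (ee x) = 1"
  by (simp add: ee_def)

lemma ee_neq_0 [simp]: "ee x \<noteq> 0"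
  by (simp add: ee_def)

lemma cnj_ee: "cnj (ee x) = ee (- x)"
  by (simp add: ee_def cis_cnj)

lemma ee_mult_cnj: "ee x * cnj (ee y) = ee (x - y)"
  using ee_add[of x "- y"] by (simp add: cnj_ee)

lemma continuous_on_ee [continuous_intros]:
  "continuous_on A f \<Longrightarrow> continuous_on A (\<lambda>t. ee (f t))"
  unfolding ee_def cis_conv_exp by (intro continuous_intros)

lemma continuous_on_expsum [continuous_intros]:
  "continuous_on A f \<Longrightarrow> continuous_on A (\<lambda>t. expsum c X (f t))"
  unfolding expsum_def by (intro continuous_intros)

lemma has_integral_ee:
  assumes "w \<noteq> 0" "p \<le> q"
  shows "((\<lambda>t. ee (w * t)) has_integral (ee (w * q) - ee (w * p)) / (2 * pi * \<i> * w)) {p..q}"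
proof -
  have "((\<lambda>t. ee (w * t) / (2 * pi * \<i> * w)) has_vector_derivative ee (w * t)) (at t within {p..q})" for t
    unfolding ee_def cis_conv_exp using assms
    by (auto intro!: derivative_eq_intros has_vector_derivative_real_field simp: field_simps)
  from fundamental_theorem_of_calculus[OF assms(2), OF this]
  show ?thesis by (simp add: diff_divide_distrib)
qed

lemma sin_as_ee:
  assumes "l > 0"
  shows "complex_of_real (sin (pi * t / l)) = (ee (t / (2 * l)) - ee (- (t / (2 * l)))) / (2 * \<i>)"
  using assms by (simp add: ee_def complex_eq_iff)

definition sine_hat :: "real \<Rightarrow> real \<Rightarrow> complex" where
  "sine_hat l w = integral {0..l} (\<lambda>t. of_real (sin (pi * t / l)) * ee (w * t))"

lemma sine_hat_0:
  assumes "l > 0"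
  shows "sine_hat l 0 = of_real (2 * l / pi)"
proof -
  have "((\<lambda>t. - cos (pi * t / l) * l / pi) has_vector_derivative sin (pi * t / l)) (at t within {0..l})" for t
    using assms
    by (auto intro!: derivative_eq_intros simp flip: has_real_derivative_iff_has_vector_derivative simp: field_simps)
  from fundamental_theorem_of_calculus[of 0 l, OF _ this] assms
  have "((\<lambda>t. sin (pi * t / l)) has_integral 2 * l / pi) {0..l}"
    by simp
  from has_integral_of_real[OF this, where 'b=complex] show ?thesis
    unfolding sine_hat_def by (simp add: integral_unique)
qed

text \<open>
  The sine arch is a combination of two exponentials whose frequencies differ by \<open>1/l\<close>, so its
  transform is a difference of two reciprocals and decays quadratically.  The constant is sharp:
  \<open>2l/\<pi>\<close> is the value at \<open>0\<close>, and this is what makes Ingham's inequality valid down to the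
  critical length.
\<close>

lemma norm_sine_hat_le:
  assumes l: "l > 0" and w: "\<bar>w\<bar> * l \<ge> 1"
  shows "cmod (sine_hat l w) \<le> 2 * l / pi * (1 / (4 * (l * w)\<^sup>2 - 1))"
proof -
  define u where "u = w + 1 / (2 * l)"
  define v where "v = w - 1 / (2 * l)"
  have w1: "(l * w)\<^sup>2 \<ge> 1"
    using w l abs_le_square_iff[of 1 "l * w"] by (simp add: abs_mult mult.commute)
  have uv: "u * v = (4 * (l * w)\<^sup>2 - 1) / (4 * l\<^sup>2)"
    using l by (simp add: u_def v_def field_simps power2_eq_square)
  have "u * v > 0" unfolding uv using l w1 by (intro divide_pos_pos) auto
  then have nz: "u \<noteq> 0" "v \<noteq> 0" by auto
  have half: "ee (1 / 2) = -1" "ee (- (1/2)) = -1"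
    by (simp_all add: ee_def cis_mult[symmetric] complex_eq_iff)
  have "u * l = w * l + 1/2" "v * l = w * l + (- (1/2))"
    using l by (simp_all add: u_def v_def field_simps)
  then have eu: "ee (u * l) = - ee (w * l)" and ev: "ee (v * l) = - ee (w * l)"
    by (simp_all only: ee_add half) auto
  have "((\<lambda>t. (ee (u * t) - ee (v * t)) / (2 * \<i>)) has_integral
        ((ee (u * l) - ee (u * 0)) / (2 * pi * \<i> * u) - (ee (v * l) - ee (v * 0)) / (2 * pi * \<i> * v)) / (2 * \<i>)) {0..l}"
    using l by (intro has_integral_divide has_integral_diff has_integral_ee nz) auto
  moreover have "(ee (u * t) - ee (v * t)) / (2 * \<i>) = of_real (sin (pi * t / l)) * ee (w * t)" for t
  proof -
    have "u * t = t / (2 * l) + w * t" "v * t = - (t / (2 * l)) + w * t"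
      using l by (simp_all add: u_def v_def field_simps)
    then have "ee (u * t) = ee (t / (2 * l)) * ee (w * t)" "ee (v * t) = ee (- (t / (2 * l))) * ee (w * t)"
      by (simp_all only: ee_add)
    then show ?thesis unfolding sin_as_ee[OF l] by (simp add: algebra_simps diff_divide_distrib)
  qed
  ultimately have "sine_hat l w =
      ((ee (u * l) - ee (u * 0)) / (2 * pi * \<i> * u) - (ee (v * l) - ee (v * 0)) / (2 * pi * \<i> * v)) / (2 * \<i>)"
    unfolding sine_hat_def by (simp add: integral_unique)
  also have "\<dots> = (ee (w * l) + 1) * of_real ((v - u) / (4 * pi * (u * v)))"
    unfolding eu ev using nz by (simp add: field_simps)
  finally have "cmod (sine_hat l w) = cmod (ee (w * l) + 1) * \<bar>(v - u) / (4 * pi * (u * v))\<bar>"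
    by (simp only: norm_mult norm_of_real)
  also have "\<dots> \<le> 2 * \<bar>(v - u) / (4 * pi * (u * v))\<bar>"
    using norm_triangle_ineq[of "ee (w * l)" 1] by (intro mult_right_mono) auto
  also have "(v - u) / (4 * pi * (u * v)) = - (l / pi * (1 / (4 * (l * w)\<^sup>2 - 1)))"
    unfolding uv using l w1 by (simp add: u_def v_def divide_simps) (simp add: power2_eq_square algebra_simps)?
  finally show ?thesis using l w1 by (simp add: abs_mult)
qed

definition gaps_ge :: "real \<Rightarrow> real set \<Rightarrow> bool" where
  "gaps_ge d X \<longleftrightarrow> (\<forall>x\<in>X. \<forall>y\<in>X. x \<noteq> y \<longrightarrow> d \<le> \<bar>x - y\<bar>)"

lemma gaps_ge_subset: "gaps_ge d X \<Longrightarrow> Y \<subseteq> X \<Longrightarrow> gaps_ge d Y"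
  by (auto simp: gaps_ge_def)

lemma sum_inverse_odd_product:
  "(\<Sum>m=1..M. 1 / (4 * (real m)\<^sup>2 - 1)) \<le> 1 / 2"
proof -
  have "(\<Sum>m=1..M. 1 / (4 * (real m)\<^sup>2 - 1)) = M / (2 * real M + 1)"
  proof (induction M)
    case (Suc M)
    have e: "4 * (real (Suc M))\<^sup>2 - 1 = (2 * real M + 1) * (2 * real M + 3)"
      by (simp add: power2_eq_square algebra_simps)
    have "(\<Sum>m=1..Suc M. 1 / (4 * (real m)\<^sup>2 - 1)) = M / (2 * real M + 1) + 1 / ((2 * real M + 1) * (2 * real M + 3))"
      using Suc by (simp only: sum.cl_ivl_Suc e) simp
    also have "\<dots> = Suc M / (2 * real (Suc M) + 1)"
      by (simp add: divide_simps) (simp add: algebra_simps)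
    finally show ?case .
  qed simp
  also have "\<dots> \<le> 1 / 2" by (simp add: field_simps)
  finally show ?thesis .
qed

text \<open>
  Rounding \<open>y/d\<close> down is injective on a set with gaps at least \<open>d\<close>, so the sum is dominated by
  the telescoping sum over the integers.  The factor \<open>1/(ld)\<^sup>2\<close> is below \<open>1\<close> as soon as \<open>l d > 1\<close>.
\<close>

lemma one_sided_kernel_sum:
  assumes fin: "finite Y" and gap: "gaps_ge d Y" and pos: "\<And>y. y \<in> Y \<Longrightarrow> d \<le> y"
    and d: "d > 0" and ld: "l * d \<ge> 1"
  shows "(\<Sum>y\<in>Y. 1 / (4 * (l * y)\<^sup>2 - 1)) \<le> 1 / (l * d)\<^sup>2 / 2"
proof -
  define f where "f y = nat \<lfloor>y / d\<rfloor>" for y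
  have f1: "f y \<ge> 1" and fle: "real (f y) * d \<le> y" if "y \<in> Y" for y
  proof -
    have "y / d \<ge> 1" using pos[OF that] d by simp
    then have "\<lfloor>y / d\<rfloor> \<ge> 1" by linarith
    then show "f y \<ge> 1" unfolding f_def by linarith
    have "real (f y) = of_int \<lfloor>y / d\<rfloor>" using \<open>\<lfloor>y / d\<rfloor> \<ge> 1\<close> unfolding f_def by simp
    also have "\<dots> \<le> y / d" by simp
    finally show "real (f y) * d \<le> y" using d by (simp add: field_simps)
  qed
  have inj: "inj_on f Y"
  proof (rule inj_onI, rule ccontr)
    fix x y assume xy: "x \<in> Y" "y \<in> Y" "f x = f y" "x \<noteq> y"
    have "\<lfloor>x / d\<rfloor> = \<lfloor>y / d\<rfloor>" using xy(3) f1[OF xy(1)] f1[OF xy(2)] unfolding f_def by linarith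
    then have "\<bar>x / d - y / d\<bar> < 1" by linarith
    then have "\<bar>x - y\<bar> < d" using d by (simp flip: diff_divide_distrib)
    moreover have "d \<le> \<bar>x - y\<bar>" using gap xy unfolding gaps_ge_def by blast
    ultimately show False by linarith
  qed
  have l: "l > 0" using ld d by (metis less_le_trans zero_less_mult_pos2 zero_less_one)
  have "(\<Sum>y\<in>Y. 1 / (4 * (l * y)\<^sup>2 - 1)) \<le> (\<Sum>y\<in>Y. 1 / (l * d)\<^sup>2 * (1 / (4 * (real (f y))\<^sup>2 - 1)))"
  proof (rule sum_mono)
    fix y assume y: "y \<in> Y"
    have f2: "(real (f y))\<^sup>2 \<ge> 1" using f1[OF y] by simp
    have "l * d * real (f y) \<le> l * y"
      using mult_left_mono[OF fle[OF y], of l] l by (simp add: mult_ac)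
    then have "(l * d * real (f y))\<^sup>2 \<le> (l * y)\<^sup>2"
      using l d by (intro power_mono) auto
    moreover have "(l * d)\<^sup>2 \<ge> 1" using ld by simp
    ultimately have "(l * d)\<^sup>2 * (4 * (real (f y))\<^sup>2 - 1) \<le> 4 * (l * y)\<^sup>2 - 1"
      by (simp add: power_mult_distrib algebra_simps)
    moreover have "(l * d)\<^sup>2 * (4 * (real (f y))\<^sup>2 - 1) > 0"
      using l d f2 by (intro mult_pos_pos) auto
    ultimately have "1 / (4 * (l * y)\<^sup>2 - 1) \<le> 1 / ((l * d)\<^sup>2 * (4 * (real (f y))\<^sup>2 - 1))"
      by (intro frac_le) auto
    then show "1 / (4 * (l * y)\<^sup>2 - 1) \<le> 1 / (l * d)\<^sup>2 * (1 / (4 * (real (f y))\<^sup>2 - 1))" by simp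
  qed
  also have "\<dots> = 1 / (l * d)\<^sup>2 * (\<Sum>m\<in>f ` Y. 1 / (4 * (real m)\<^sup>2 - 1))"
    by (simp add: sum.reindex[OF inj] sum_distrib_left)
  also have "\<dots> \<le> 1 / (l * d)\<^sup>2 * (\<Sum>m=1..Max (f ` Y). 1 / (4 * (real m)\<^sup>2 - 1))"
  proof (intro mult_left_mono sum_mono2)
    show "f ` Y \<subseteq> {1..Max (f ` Y)}" using fin f1 by auto
    fix m assume "m \<in> {1..Max (f ` Y)} - f ` Y"
    then have "(real m)\<^sup>2 \<ge> 1" by auto
    then show "0 \<le> 1 / (4 * (real m)\<^sup>2 - 1)" by simp
  qed auto
  also have "\<dots> \<le> 1 / (l * d)\<^sup>2 * (1 / 2)"
    by (intro mult_left_mono sum_inverse_odd_product) auto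
  finally show ?thesis by simp
qed

lemma kernel_row_sum:
  assumes fin: "finite X" and gap: "gaps_ge d X" and d: "d > 0" and ld: "l * d \<ge> 1" and x: "x \<in> X"
  shows "(\<Sum>y\<in>X - {x}. 1 / (4 * (l * (x - y))\<^sup>2 - 1)) \<le> 1 / (l * d)\<^sup>2"
proof -
  let ?k = "\<lambda>z. 1 / (4 * (l * z)\<^sup>2 - 1)"
  let ?U = "{y \<in> X. y > x}" and ?D = "{y \<in> X. y < x}"
  have "(\<Sum>y\<in>?U. ?k (x - y)) = (\<Sum>z\<in>(\<lambda>y. y - x) ` ?U. ?k z)"
    by (subst sum.reindex) (auto simp: inj_on_def power_mult_distrib power2_commute)
  also have "\<dots> \<le> 1 / (l * d)\<^sup>2 / 2"
    using fin gap x by (intro one_sided_kernel_sum d ld) (auto simp: gaps_ge_def, force)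
  finally have 1: "(\<Sum>y\<in>?U. ?k (x - y)) \<le> 1 / (l * d)\<^sup>2 / 2" .
  have "(\<Sum>y\<in>?D. ?k (x - y)) = (\<Sum>z\<in>(\<lambda>y. x - y) ` ?D. ?k z)"
    by (subst sum.reindex) (auto simp: inj_on_def)
  also have "\<dots> \<le> 1 / (l * d)\<^sup>2 / 2"
    using fin gap x by (intro one_sided_kernel_sum d ld) (auto simp: gaps_ge_def, force+)
  finally have 2: "(\<Sum>y\<in>?D. ?k (x - y)) \<le> 1 / (l * d)\<^sup>2 / 2" .
  have "X - {x} = ?U \<union> ?D" by auto
  moreover have "sum (\<lambda>y. ?k (x - y)) (?U \<union> ?D) = sum (\<lambda>y. ?k (x - y)) ?U + sum (\<lambda>y. ?k (x - y)) ?D"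
    by (rule sum.union_disjoint) (use fin in auto)
  ultimately have "(\<Sum>y\<in>X - {x}. ?k (x - y)) = (\<Sum>y\<in>?U. ?k (x - y)) + (\<Sum>y\<in>?D. ?k (x - y))"
    by (simp only:) 
  with 1 2 show ?thesis by simp
qed

lemma cmod_expsum_sq:
  "complex_of_real ((cmod (expsum c X t))\<^sup>2) = (\<Sum>x\<in>X. \<Sum>y\<in>X. c x * cnj (c y) * ee ((x - y) * t))"
proof -
  have "ee (x * t) * cnj (ee (y * t)) = ee ((x - y) * t)" for x y
    by (simp add: ee_mult_cnj algebra_simps)
  then have "expsum c X t * cnj (expsum c X t) = (\<Sum>x\<in>X. \<Sum>y\<in>X. c x * cnj (c y) * ee ((x - y) * t))"
    unfolding expsum_def cnj_sum sum_product complex_cnj_mult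
    by (intro sum.cong refl) (metis (no_types, opaque_lifting) mult.assoc mult.left_commute)
  then show ?thesis by (simp only: complex_norm_square)
qed

lemma sine_weighted_energy:
  "complex_of_real (integral {0..l} (\<lambda>t. sin (pi * t / l) * (cmod (expsum c X t))\<^sup>2))
    = (\<Sum>x\<in>X. \<Sum>y\<in>X. c x * cnj (c y) * sine_hat l (x - y))"
proof (cases "finite X")
  case True
  let ?s = "\<lambda>t. sin (pi * t / l)"
  have cont: "continuous_on {0..l} (\<lambda>t. sin (pi * t / l))"
    by (cases "l = 0") (auto intro!: continuous_intros)
  have I: "(\<lambda>t. c x * cnj (c y) * (of_real (?s t) * ee ((x - y) * t))) integrable_on {0..l}" for x y
    by (intro integrable_continuous_interval continuous_intros cont)
  have "(\<lambda>t. ?s t * (cmod (expsum c X t))\<^sup>2) integrable_on {0..l}"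
    by (intro integrable_continuous_interval continuous_intros cont)
  from has_integral_of_real[OF integrable_integral[OF this], where 'b=complex]
  have "complex_of_real (integral {0..l} (\<lambda>t. ?s t * (cmod (expsum c X t))\<^sup>2))
      = integral {0..l} (\<lambda>t. of_real (?s t * (cmod (expsum c X t))\<^sup>2))"
    by (simp add: integral_unique)
  also have "\<dots> = integral {0..l} (\<lambda>t. \<Sum>x\<in>X. \<Sum>y\<in>X. c x * cnj (c y) * (of_real (?s t) * ee ((x - y) * t)))"
    unfolding of_real_mult cmod_expsum_sq
    by (simp add: sum_distrib_left mult_ac)
  also have "\<dots> = (\<Sum>x\<in>X. \<Sum>y\<in>X. c x * cnj (c y) * sine_hat l (x - y))"
    unfolding sine_hat_def using I True
    by (subst integral_sum; (intro integrable_sum)?; simp?)+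
  finally show ?thesis .
qed (simp add: expsum_def)

text \<open>
  Schur's test for a symmetric kernel, by the inequality between arithmetic and geometric mean.
\<close>

lemma sum_off_diagonal_le:
  fixes K :: "real \<Rightarrow> real \<Rightarrow> real"
  assumes fin: "finite X" and sym: "\<And>x y. K x y = K y x" and nn: "\<And>x y. x \<in> X \<Longrightarrow> y \<in> X \<Longrightarrow> x \<noteq> y \<Longrightarrow> 0 \<le> K x y"
    and row: "\<And>x. x \<in> X \<Longrightarrow> (\<Sum>y\<in>X - {x}. K x y) \<le> R"
  shows "(\<Sum>x\<in>X. \<Sum>y\<in>X - {x}. cmod (c x) * cmod (c y) * K x y) \<le> R * (\<Sum>x\<in>X. (cmod (c x))\<^sup>2)"
proof -
  let ?K = "\<lambda>x y. if x = y then 0 else K x y"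
  have off: "(\<Sum>y\<in>X - {x}. g y * K x y) = (\<Sum>y\<in>X. g y * ?K x y)" if "x \<in> X" for g x
    using that fin by (subst sum.remove[of X x]) (auto intro!: sum.cong)
  have "(\<Sum>x\<in>X. \<Sum>y\<in>X - {x}. cmod (c x) * cmod (c y) * K x y) = (\<Sum>x\<in>X. \<Sum>y\<in>X. cmod (c x) * cmod (c y) * ?K x y)"
    by (intro sum.cong refl off)
  also have "\<dots> \<le> (\<Sum>x\<in>X. \<Sum>y\<in>X. ((cmod (c x))\<^sup>2 / 2 + (cmod (c y))\<^sup>2 / 2) * ?K x y)"
  proof (intro sum_mono mult_right_mono)
    fix x y
    show "cmod (c x) * cmod (c y) \<le> (cmod (c x))\<^sup>2 / 2 + (cmod (c y))\<^sup>2 / 2"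
      using sum_squares_bound[of "cmod (c x)" "cmod (c y)"] by simp
  qed (use nn in auto)
  also have "\<dots> = (\<Sum>x\<in>X. \<Sum>y\<in>X. (cmod (c x))\<^sup>2 / 2 * ?K x y) + (\<Sum>x\<in>X. \<Sum>y\<in>X. (cmod (c y))\<^sup>2 / 2 * ?K x y)"
    by (simp only: distrib_right sum.distrib)
  also have "(\<Sum>x\<in>X. \<Sum>y\<in>X. (cmod (c y))\<^sup>2 / 2 * ?K x y) = (\<Sum>x\<in>X. \<Sum>y\<in>X. (cmod (c x))\<^sup>2 / 2 * ?K x y)"
    by (subst sum.swap) (intro sum.cong refl, simp add: sym)
  also have "(\<Sum>x\<in>X. \<Sum>y\<in>X. (cmod (c x))\<^sup>2 / 2 * ?K x y) + (\<Sum>x\<in>X. \<Sum>y\<in>X. (cmod (c x))\<^sup>2 / 2 * ?K x y)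
      = (\<Sum>x\<in>X. (cmod (c x))\<^sup>2 * (\<Sum>y\<in>X - {x}. K x y))"
  proof -
    have "(\<Sum>y\<in>X - {x}. K x y) = (\<Sum>y\<in>X. ?K x y)" if "x \<in> X" for x
      using off[OF that, of "\<lambda>_. 1"] by simp
    then show ?thesis
      by (simp add: sum.distrib[symmetric] sum_distrib_left[symmetric])
  qed
  also have "\<dots> \<le> (\<Sum>x\<in>X. (cmod (c x))\<^sup>2 * R)"
    by (intro sum_mono mult_left_mono row) auto
  also have "\<dots> = R * (\<Sum>x\<in>X. (cmod (c x))\<^sup>2)"
    by (simp add: sum_distrib_left mult.commute)
  finally show ?thesis .
qed

text \<open>
  The diagonal of the quadratic form is \<open>2l/\<pi>\<close> and the off-diagonal part is dominated by Schur's
  test.  The lower bound gives Ingham's inequality, the upper bound the Bessel type inequality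
  \<open>energy_upper\<close>.
\<close>

lemma sine_weighted_energy_bounds:
  assumes fin: "finite X" and gap: "gaps_ge d X" and d: "d > 0" and ld: "l * d \<ge> 1"
  shows "\<bar>integral {0..l} (\<lambda>t. sin (pi * t / l) * (cmod (expsum c X t))\<^sup>2) - 2 * l / pi * (\<Sum>x\<in>X. (cmod (c x))\<^sup>2)\<bar>
     \<le> 2 * l / pi * (1 / (l * d)\<^sup>2) * (\<Sum>x\<in>X. (cmod (c x))\<^sup>2)"
proof -
  have l: "l > 0" using ld d by (metis less_le_trans zero_less_mult_pos2 zero_less_one)
  let ?I = "integral {0..l} (\<lambda>t. sin (pi * t / l) * (cmod (expsum c X t))\<^sup>2)"
  let ?S = "\<Sum>x\<in>X. (cmod (c x))\<^sup>2"
  have "complex_of_real ?I = (\<Sum>x\<in>X. c x * cnj (c x) * sine_hat l 0 + (\<Sum>y\<in>X - {x}. c x * cnj (c y) * sine_hat l (x - y)))"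
    unfolding sine_weighted_energy using fin
    by (intro sum.cong refl) (subst sum.remove, auto)
  also have "\<dots> = of_real (2 * l / pi * ?S) + (\<Sum>x\<in>X. \<Sum>y\<in>X - {x}. c x * cnj (c y) * sine_hat l (x - y))"
    by (simp add: sum.distrib sine_hat_0[OF l] sum_distrib_left complex_norm_square[symmetric] mult_ac del: of_real_power)
  finally have "complex_of_real (?I - 2 * l / pi * ?S) = (\<Sum>x\<in>X. \<Sum>y\<in>X - {x}. c x * cnj (c y) * sine_hat l (x - y))"
    by simp
  from arg_cong[OF this, of cmod]
  have "\<bar>?I - 2 * l / pi * ?S\<bar> = cmod (\<Sum>x\<in>X. \<Sum>y\<in>X - {x}. c x * cnj (c y) * sine_hat l (x - y))"
    by (simp only: norm_of_real)
  also have "\<dots> \<le> (\<Sum>x\<in>X. \<Sum>y\<in>X - {x}. cmod (c x * cnj (c y) * sine_hat l (x - y)))"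
    by (intro order_trans[OF norm_sum] sum_mono norm_sum)
  also have "\<dots> \<le> (\<Sum>x\<in>X. \<Sum>y\<in>X - {x}. cmod (c x) * cmod (c y) * (2 * l / pi * (1 / (4 * (l * (x - y))\<^sup>2 - 1))))"
  proof (intro sum_mono)
    fix x y assume "x \<in> X" "y \<in> X - {x}"
    then have "\<bar>x - y\<bar> \<ge> d" using gap by (auto simp: gaps_ge_def)
    then have "\<bar>x - y\<bar> * l \<ge> 1" using ld l by (metis mult.commute mult_left_mono order_trans less_imp_le)
    from norm_sine_hat_le[OF l this]
    show "cmod (c x * cnj (c y) * sine_hat l (x - y)) \<le> cmod (c x) * cmod (c y) * (2 * l / pi * (1 / (4 * (l * (x - y))\<^sup>2 - 1)))"
      by (simp add: norm_mult mult_left_mono del: times_divide_eq_right times_divide_eq_left)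
  qed
  also have "\<dots> \<le> 2 * l / pi * (1 / (l * d)\<^sup>2) * ?S"
  proof (rule sum_off_diagonal_le[OF fin])
    fix x y
    show "2 * l / pi * (1 / (4 * (l * (x - y))\<^sup>2 - 1)) = 2 * l / pi * (1 / (4 * (l * (y - x))\<^sup>2 - 1))"
      by (simp add: power_mult_distrib power2_commute)
    assume "x \<in> X" "y \<in> X" "x \<noteq> y"
    then have "\<bar>x - y\<bar> \<ge> d" using gap by (auto simp: gaps_ge_def)
    then have "\<bar>x - y\<bar> * l \<ge> 1" using ld l by (metis mult.commute mult_left_mono order_trans less_imp_le)
    then have "(l * (x - y))\<^sup>2 \<ge> 1"
      using l abs_le_square_iff[of 1 "l * (x - y)"] by (simp add: abs_mult mult.commute)
    then show "0 \<le> 2 * l / pi * (1 / (4 * (l * (x - y))\<^sup>2 - 1))" using l by simp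
  next
    fix x assume "x \<in> X"
    from kernel_row_sum[OF fin gap d ld this]
    show "(\<Sum>y\<in>X - {x}. 2 * l / pi * (1 / (4 * (l * (x - y))\<^sup>2 - 1))) \<le> 2 * l / pi * (1 / (l * d)\<^sup>2)"
      unfolding sum_distrib_left[symmetric] using l by (intro mult_left_mono) auto
  qed
  finally show ?thesis .
qed

definition energy :: "(real \<Rightarrow> complex) \<Rightarrow> real set \<Rightarrow> real \<Rightarrow> real \<Rightarrow> real" where
  "energy c X p q = integral {p..q} (\<lambda>t. (cmod (expsum c X t))\<^sup>2)"

lemma energy_integrable: "(\<lambda>t. (cmod (expsum c X t))\<^sup>2) integrable_on {p..q}"
  by (intro integrable_continuous_interval continuous_intros)

lemma energy_nonneg: "0 \<le> energy c X p q"
  unfolding energy_def by (rule integral_nonneg[OF energy_integrable]) auto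

lemma energy_mono:
  assumes "p' \<le> p" "q \<le> q'"
  shows "energy c X p q \<le> energy c X p' q'"
  unfolding energy_def
  by (rule integral_subset_le) (use assms in \<open>auto intro!: energy_integrable\<close>)

lemma expsum_shift: "expsum c X (t + s) = expsum (\<lambda>x. c x * ee (x * s)) X t"
  by (simp add: expsum_def ee_add distrib_left mult_ac)

lemma energy_shift:
  "energy c X (p + s) (q + s) = energy (\<lambda>x. c x * ee (x * s)) X p q"
proof -
  have "energy c X (p + s) (q + s) = integral {p..q} ((\<lambda>t. (cmod (expsum c X t))\<^sup>2) \<circ> (+) s)"
    unfolding energy_def by (simp only: integral_shift_Icc_real)
  also have "\<dots> = energy (\<lambda>x. c x * ee (x * s)) X p q"
    unfolding energy_def by (intro integral_cong) (simp add: add.commute[of s] expsum_shift)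
  finally show ?thesis .
qed

text \<open>
  Ingham's inequality.  The arch is at most \<open>1\<close>, so the unweighted energy dominates the weighted
  one, and \<open>1 - 1/(ld)\<^sup>2\<close> is positive exactly above the critical length \<open>1/d\<close>.
\<close>

lemma ingham_lower:
  assumes d: "d > 0" and ld: "l * d > 1"
  obtains A where "A > 0" "\<And>c X. finite X \<Longrightarrow> gaps_ge d X \<Longrightarrow> A * (\<Sum>x\<in>X. (cmod (c x))\<^sup>2) \<le> energy c X 0 l"
proof
  have l: "l > 0" using ld d by (metis less_trans zero_less_mult_pos2 zero_less_one)
  have "(l * d)\<^sup>2 > 1" using ld by (simp add: one_less_power)
  then show "2 * l / pi * (1 - 1 / (l * d)\<^sup>2) > 0" using l by (intro mult_pos_pos) (auto simp: divide_less_eq_1)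
  fix c :: "real \<Rightarrow> complex" and X assume X: "finite X" "gaps_ge d X"
  let ?I = "integral {0..l} (\<lambda>t. sin (pi * t / l) * (cmod (expsum c X t))\<^sup>2)"
  have "2 * l / pi * (1 - 1 / (l * d)\<^sup>2) * (\<Sum>x\<in>X. (cmod (c x))\<^sup>2) \<le> ?I"
    using sine_weighted_energy_bounds[OF X d less_imp_le[OF ld], of c] by (simp add: algebra_simps abs_le_iff)
  also have "?I \<le> energy c X 0 l"
    unfolding energy_def
  proof (rule integral_le)
    show "(\<lambda>t. sin (pi * t / l) * (cmod (expsum c X t))\<^sup>2) integrable_on {0..l}"
      using l by (intro integrable_continuous_interval continuous_intros) auto
    fix t
    show "sin (pi * t / l) * (cmod (expsum c X t))\<^sup>2 \<le> (cmod (expsum c X t))\<^sup>2"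
      using mult_right_mono[of "sin (pi * t / l)" 1 "(cmod (expsum c X t))\<^sup>2"] by simp
  qed (rule energy_integrable)
  finally show "2 * l / pi * (1 - 1 / (l * d)\<^sup>2) * (\<Sum>x\<in>X. (cmod (c x))\<^sup>2) \<le> energy c X 0 l" .
qed

lemma sin_ge_half_middle:
  assumes "T > 0" "T / 4 \<le> t" "t \<le> 3 * T / 4"
  shows "1 / 2 \<le> sin (pi * t / T)"
proof -
  define u where "u = pi * t / T - pi / 2"
  have "t / T \<ge> 1/4" "t / T \<le> 3/4" using assms by (simp_all add: field_simps)
  then have "pi * (1/4) \<le> pi * (t / T)" "pi * (t / T) \<le> pi * (3/4)" by (simp_all only: mult_left_mono pi_ge_zero)
  moreover have "u = pi * (t / T) - pi / 2" by (simp add: u_def)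
  ultimately have u: "\<bar>u\<bar> \<le> pi / 3" using pi_gt_zero by linarith
  have "cos (pi / 3) \<le> cos \<bar>u\<bar>"
    by (rule cos_monotone_0_pi_le) (use u pi_gt_zero in auto)
  moreover have "cos u = sin (pi * t / T)" by (simp add: u_def cos_diff)
  ultimately show ?thesis by (simp add: cos_60)
qed

text \<open>
  On the middle half of its support the sine arch is at least \<open>1/2\<close>.  A long enough arch
  therefore dominates half the indicator of the given interval, and its length also meets the
  condition \<open>T d \<ge> 1\<close> of \<open>sine_weighted_energy_bounds\<close>.
\<close>

lemma energy_upper:
  assumes d: "d > 0" and h: "h \<ge> 0"
  obtains B where "B > 0"
    "\<And>c X p. finite X \<Longrightarrow> gaps_ge d X \<Longrightarrow> energy c X p (p + h) \<le> B * (\<Sum>x\<in>X. (cmod (c x))\<^sup>2)"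
proof
  \<comment> \<open>The arch on \<open>[0, T]\<close> is at least \<open>1/2\<close> on \<open>[T/4, 3T/4]\<close>, of length \<open>T/2 \<ge> h\<close>.\<close>
  define T where "T = max (1 / d) (2 * h)"
  have "1 / d > 0" using d by simp
  then have T: "T > 0" "h \<le> T / 2" unfolding T_def by (auto simp: less_max_iff_disj)
  have "1 / d \<le> T" by (simp add: T_def)
  then have Td: "T * d \<ge> 1" using d by (simp add: field_simps)
  show "8 * T / pi > 0" using T by simp
  fix c :: "real \<Rightarrow> complex" and X p assume X: "finite X" "gaps_ge d X"
  define b where "b x = c x * ee (x * (p - T / 4))" for x
  let ?S = "(\<Sum>x\<in>X. (cmod (c x))\<^sup>2)"
  have S: "(\<Sum>x\<in>X. (cmod (b x))\<^sup>2) = ?S" by (simp add: b_def norm_mult)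
  let ?g = "\<lambda>t. 2 * (sin (pi * t / T) * (cmod (expsum b X t))\<^sup>2)"
  have gI: "?g integrable_on {u..v}" for u v
      using T by (intro integrable_continuous_interval continuous_intros) auto
  have sinnn: "0 \<le> sin (pi * t / T)" if "t \<in> {0..T}" for t
    by (rule sin_ge_zero) (use that T in \<open>auto simp: field_simps\<close>)
  have "energy c X p (p + h) = energy b X (T / 4) (T / 4 + h)"
    using energy_shift[of c X "T / 4" "p - T / 4" "T / 4 + h"]
    unfolding b_def[abs_def] by (simp add: add.commute)
  also have "\<dots> \<le> integral {T / 4..T / 4 + h} ?g"
    unfolding energy_def
  proof (rule integral_le[OF energy_integrable gI])
    fix t assume t: "t \<in> {T / 4..T / 4 + h}"
    have "1 / 2 \<le> sin (pi * t / T)" by (rule sin_ge_half_middle) (use t T in auto)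
    then have "1 * (cmod (expsum b X t))\<^sup>2 \<le> (2 * sin (pi * t / T)) * (cmod (expsum b X t))\<^sup>2"
      by (intro mult_right_mono) auto
    then show "(cmod (expsum b X t))\<^sup>2 \<le> ?g t" by simp
  qed
  also have "\<dots> \<le> integral {0..T} ?g"
    by (rule integral_subset_le[OF _ gI gI]) (use T sinnn in auto)
  also have "\<dots> = 2 * integral {0..T} (\<lambda>t. sin (pi * t / T) * (cmod (expsum b X t))\<^sup>2)"
    by simp
  also have "\<dots> \<le> 2 * (2 * T / pi * ?S + 2 * T / pi * (1 / (T * d)\<^sup>2) * ?S)"
    using sine_weighted_energy_bounds[OF X d Td, of b] unfolding S by (simp add: abs_le_iff)
  also have "\<dots> \<le> 2 * (2 * T / pi * ?S + 2 * T / pi * 1 * ?S)"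
    using T Td by (intro mult_left_mono add_left_mono mult_right_mono sum_nonneg) (auto simp: divide_le_eq_1)
  finally show "energy c X p (p + h) \<le> 8 * T / pi * ?S" by simp
qed

section \<open>Annihilating frequencies by averaging\<close>

text \<open>
  The discriminant argument, isolated because it is used for continuous functions on an
  interval and for square-integrable functions on the line.
\<close>

lemma cauchy_schwarz_from_quadratic:
  fixes F G :: real and I :: complex
  assumes nn: "\<And>z. 0 \<le> F - 2 * Re (cnj z * I) + (cmod z)\<^sup>2 * G" and G: "G \<ge> 0"
  shows "(cmod I)\<^sup>2 \<le> F * G"
proof (cases "G = 0")
  case True
  have "I = 0"
  proof (rule ccontr)
    assume "I \<noteq> 0"
    have *: "F - 2 * (s * (cmod I)\<^sup>2) \<ge> 0" for s :: real
    proof -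
      have "Re (cnj (of_real s * I) * I) = s * (cmod I)\<^sup>2"
        by (simp only: cmod_power2) (simp add: algebra_simps power2_eq_square)
      then show ?thesis using nn[of "of_real s * I"] True by simp
    qed
    have "F \<ge> 0" using *[of 0] by simp
    have "(cmod I)\<^sup>2 > 0" using \<open>I \<noteq> 0\<close> by simp
    with *[of "(F + 1) / (cmod I)\<^sup>2"] \<open>F \<ge> 0\<close> show False by simp
  qed
  then show ?thesis using True by simp
next
  case False
  then have Gp: "G > 0" using G by simp
  have "cnj (I / of_real G) * I = of_real ((cmod I)\<^sup>2 / G)"
    by (simp only: of_real_divide complex_norm_square complex_cnj_divide complex_cnj_complex_of_real) simp
  then have "Re (cnj (I / of_real G) * I) = (cmod I)\<^sup>2 / G" by (metis Re_complex_of_real)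
  moreover have "(cmod (I / of_real G))\<^sup>2 * G = (cmod I)\<^sup>2 / G"
    using Gp by (simp add: norm_divide power_divide power2_eq_square)
  ultimately have "F - 2 * ((cmod I)\<^sup>2 / G) + (cmod I)\<^sup>2 / G \<ge> 0"
    using nn[of "I / of_real G"] by (simp only:)
  then have "F - (cmod I)\<^sup>2 / G \<ge> 0" by linarith
  then show ?thesis using Gp by (simp add: field_simps)
qed

lemma cmod_diff_mult_sq:
  "(cmod (u - z * v))\<^sup>2 = (cmod u)\<^sup>2 - 2 * Re (cnj z * (u * cnj v)) + (cmod z)\<^sup>2 * (cmod v)\<^sup>2"
  by (simp only: cmod_power2) (simp add: algebra_simps power2_eq_square)

lemma cauchy_schwarz_interval:
  fixes f g :: "real \<Rightarrow> complex"
  assumes f: "continuous_on {p..q} f" and g: "continuous_on {p..q} g"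
  shows "(cmod (integral {p..q} (\<lambda>t. f t * cnj (g t))))\<^sup>2
    \<le> integral {p..q} (\<lambda>t. (cmod (f t))\<^sup>2) * integral {p..q} (\<lambda>t. (cmod (g t))\<^sup>2)"
proof (rule cauchy_schwarz_from_quadratic)
  show "0 \<le> integral {p..q} (\<lambda>t. (cmod (g t))\<^sup>2)"
    by (intro integral_nonneg integrable_continuous_interval continuous_intros g) auto
  fix z
  let ?I = "integral {p..q} (\<lambda>t. f t * cnj (g t))"
  have i1: "((\<lambda>t. (cmod (f t))\<^sup>2) has_integral integral {p..q} (\<lambda>t. (cmod (f t))\<^sup>2)) {p..q}"
    by (intro integrable_integral integrable_continuous_interval continuous_intros f)
  have i2: "((\<lambda>t. (cmod (g t))\<^sup>2) has_integral integral {p..q} (\<lambda>t. (cmod (g t))\<^sup>2)) {p..q}"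
    by (intro integrable_integral integrable_continuous_interval continuous_intros g)
  have "((\<lambda>t. cnj z * (f t * cnj (g t))) has_integral cnj z * ?I) {p..q}"
    by (intro has_integral_mult_right integrable_integral integrable_continuous_interval continuous_intros f g)
  then have i3: "((\<lambda>t. Re (cnj z * (f t * cnj (g t)))) has_integral Re (cnj z * ?I)) {p..q}"
    by (rule has_integral_Re)
  have "((\<lambda>t. (cmod (f t))\<^sup>2 - 2 * Re (cnj z * (f t * cnj (g t))) + (cmod z)\<^sup>2 * (cmod (g t))\<^sup>2) has_integral
      (integral {p..q} (\<lambda>t. (cmod (f t))\<^sup>2) - 2 * Re (cnj z * ?I) + (cmod z)\<^sup>2 * integral {p..q} (\<lambda>t. (cmod (g t))\<^sup>2))) {p..q}"
    by (intro has_integral_add has_integral_diff has_integral_mult_right i1 i2 i3)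
  then have "((\<lambda>t. (cmod (f t - z * g t))\<^sup>2) has_integral
      (integral {p..q} (\<lambda>t. (cmod (f t))\<^sup>2) - 2 * Re (cnj z * ?I) + (cmod z)\<^sup>2 * integral {p..q} (\<lambda>t. (cmod (g t))\<^sup>2))) {p..q}"
    by (simp only: cmod_diff_mult_sq)
  then show "0 \<le> integral {p..q} (\<lambda>t. (cmod (f t))\<^sup>2) - 2 * Re (cnj z * ?I) + (cmod z)\<^sup>2 * integral {p..q} (\<lambda>t. (cmod (g t))\<^sup>2)"
    by (rule has_integral_nonneg) auto
qed

definition interval_inner :: "real \<Rightarrow> (real \<Rightarrow> complex) \<Rightarrow> (real \<Rightarrow> complex) \<Rightarrow> complex" where
  "interval_inner l f g = integral {0..l} (\<lambda>t. f t * cnj (g t))"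

text \<open>
  Orthogonal projection onto the span of finitely many exponentials.  The induction is a
  Gram--Schmidt step: project \<open>f0\<close> and the new exponential onto the old span, then remove from
  the residual of \<open>f0\<close> its component along the residual \<open>w\<close> of the new exponential.
\<close>

lemma expsum_residual_exists:
  assumes "finite S"
    and "continuous_on {0..l} f0"
  shows "\<exists>b. \<forall>x\<in>S. interval_inner l (\<lambda>t. f0 t - expsum b S t) (\<lambda>t. ee (x * t)) = 0"
  using assms
proof (induction S arbitrary: f0)
  case (insert y S)
  have cI: "(\<lambda>t. f t * cnj (g t)) integrable_on {0..l}" if "continuous_on {0..l} f" "continuous_on {0..l} g" for f g :: "real \<Rightarrow> complex"
    by (intro integrable_continuous_interval continuous_intros that)
  from insert.IH[OF insert.prems] obtain b where b: "\<forall>x\<in>S. interval_inner l (\<lambda>t. f0 t - expsum b S t) (\<lambda>t. ee (x * t)) = 0" by blast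
  have ce: "continuous_on {0..l} (\<lambda>t. ee (y * t))" by (intro continuous_intros)
  from insert.IH[OF ce] obtain a where a: "\<forall>x\<in>S. interval_inner l (\<lambda>t. ee (y * t) - expsum a S t) (\<lambda>t. ee (x * t)) = 0" by blast
  define u where "u t = f0 t - expsum b S t" for t
  define w where "w t = ee (y * t) - expsum a S t" for t
  have cu: "continuous_on {0..l} u" unfolding u_def by (intro continuous_intros insert.prems)
  have cw: "continuous_on {0..l} w" unfolding w_def by (intro continuous_intros)
  define z where "z = (if interval_inner l w w = 0 then 0 else interval_inner l u w / interval_inner l w w)"
  define b' where "b' x = (if x = y then z else b x - z * a x)" for x
  have ES: "f0 t - expsum b' (insert y S) t = u t - z * w t" for t
  proof -
    have "expsum b' (insert y S) t = z * ee (y * t) + (\<Sum>x\<in>S. (b x - z * a x) * ee (x * t))"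
      unfolding expsum_def using insert.hyps by (auto simp: b'_def intro!: sum.cong)
    then show ?thesis
      by (simp add: u_def w_def expsum_def algebra_simps sum_subtractf sum_distrib_left)
  qed
  have lin: "interval_inner l (\<lambda>t. u t - z * w t) g = interval_inner l u g - z * interval_inner l w g" if "continuous_on {0..l} g" for g
  proof -
    have "((\<lambda>t. u t * cnj (g t) - z * (w t * cnj (g t))) has_integral (interval_inner l u g - z * interval_inner l w g)) {0..l}"
      unfolding interval_inner_def by (intro has_integral_diff has_integral_mult_right integrable_integral cI cu cw that)
    then show ?thesis unfolding interval_inner_def
      by (intro integral_unique) (simp add: algebra_simps)
  qed
  have uw: "interval_inner l u w = z * interval_inner l w w"
  proof (cases "interval_inner l w w = 0")
    case True
    have "complex_of_real (integral {0..l} (\<lambda>t. (cmod (w t))\<^sup>2)) = interval_inner l w w"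
      unfolding interval_inner_def complex_norm_square[symmetric]
      by (intro integral_unique[symmetric] has_integral_of_real integrable_integral integrable_continuous_interval continuous_intros cw)
    then have "integral {0..l} (\<lambda>t. (cmod (w t))\<^sup>2) = 0" using True by simp
    with cauchy_schwarz_interval[OF cu cw] have "interval_inner l u w = 0" by (simp add: interval_inner_def)
    then show ?thesis using True by simp
  qed (simp add: z_def)
  have eS: "interval_inner l (\<lambda>t. u t - z * w t) (\<lambda>t. ee (x * t)) = 0" if "x \<in> S" for x
    using a b that by (subst lin) (auto intro!: continuous_intros simp: u_def[abs_def] w_def[abs_def])
  have aS: "interval_inner l (\<lambda>t. u t - z * w t) (expsum a S) = 0"
  proof -
    have "interval_inner l (\<lambda>t. u t - z * w t) (expsum a S) = integral {0..l} (\<lambda>t. \<Sum>x\<in>S. cnj (a x) * ((u t - z * w t) * cnj (ee (x * t))))"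
      unfolding interval_inner_def expsum_def by (simp add: sum_distrib_left mult_ac)
    also have "\<dots> = (\<Sum>x\<in>S. integral {0..l} (\<lambda>t. cnj (a x) * ((u t - z * w t) * cnj (ee (x * t)))))"
      by (intro integral_sum insert.hyps integrable_continuous_interval continuous_intros cu cw)
    also have "\<dots> = (\<Sum>x\<in>S. cnj (a x) * interval_inner l (\<lambda>t. u t - z * w t) (\<lambda>t. ee (x * t)))"
      by (simp add: interval_inner_def)
    also have "\<dots> = 0" using eS by simp
    finally show ?thesis .
  qed
  have "interval_inner l (\<lambda>t. u t - z * w t) (\<lambda>t. ee (y * t)) = 0"
  proof -
    have "((\<lambda>t. (u t - z * w t) * cnj (w t) + (u t - z * w t) * cnj (expsum a S t)) has_integral
        (interval_inner l (\<lambda>t. u t - z * w t) w + interval_inner l (\<lambda>t. u t - z * w t) (expsum a S))) {0..l}"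
      unfolding interval_inner_def by (intro has_integral_add integrable_integral cI continuous_intros cu cw)
    then have "interval_inner l (\<lambda>t. u t - z * w t) (\<lambda>t. ee (y * t)) = interval_inner l (\<lambda>t. u t - z * w t) w + interval_inner l (\<lambda>t. u t - z * w t) (expsum a S)"
      unfolding interval_inner_def by (intro integral_unique) (simp add: w_def algebra_simps)
    also have "interval_inner l (\<lambda>t. u t - z * w t) w = 0" using lin[OF cw] uw by simp
    finally show ?thesis using aS by simp
  qed
  with eS show ?case by (intro exI[of _ b']) (auto simp: ES)
qed auto


text \<open>
  An averaging operator acts on an exponential sum as a multiplier \<open>\<mu>\<close> on its coefficients.  The
  value \<open>\<mu> g = 1\<close> keeps the frequency \<open>g\<close>, the zeros on \<open>S\<close> wipe out \<open>S\<close>, and \<open>l\<close> is the length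
  by which the interval shrinks.  The multiplier does not depend on the sum, so that such
  operators compose, and the interval is arbitrary, since translations only change the phases
  of the coefficients.
\<close>

definition annihilable :: "real \<Rightarrow> real set \<Rightarrow> real \<Rightarrow> real \<Rightarrow> bool" where
  "annihilable g S l M \<longleftrightarrow> 0 \<le> l \<and> 0 \<le> M \<and> (\<exists>\<mu>. \<mu> g = 1 \<and> (\<forall>x\<in>S. \<mu> x = 0) \<and>
     (\<forall>c X p q. finite X \<longrightarrow> energy (\<lambda>x. \<mu> x * c x) X p q \<le> M * energy c X p (q + l)))"

lemma annihilable_empty: "annihilable g {} 0 1"
  unfolding annihilable_def by (auto intro!: exI[of _ "\<lambda>_. 1"])

lemma annihilable_mono:
  assumes "annihilable g S l M" "S' \<subseteq> S" "l \<le> l'" "M \<le> M'"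
  shows "annihilable g S' l' M'"
proof -
  from assms(1) obtain \<mu> where M: "0 \<le> M" "0 \<le> l" and \<mu>: "\<mu> g = 1" "\<forall>x\<in>S. \<mu> x = 0"
    "\<And>c X p q. finite X \<Longrightarrow> energy (\<lambda>x. \<mu> x * c x) X p q \<le> M * energy c X p (q + l)"
    unfolding annihilable_def by blast
  have "energy (\<lambda>x. \<mu> x * c x) X p q \<le> M' * energy c X p (q + l')" if "finite X" for c X p q
  proof -
    have "energy (\<lambda>x. \<mu> x * c x) X p q \<le> M * energy c X p (q + l)" by (rule \<mu>(3)[OF that])
    also have "\<dots> \<le> M * energy c X p (q + l')" using assms M by (intro mult_left_mono energy_mono) auto
    also have "\<dots> \<le> M' * energy c X p (q + l')" using assms by (intro mult_right_mono energy_nonneg)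
    finally show ?thesis .
  qed
  then show ?thesis unfolding annihilable_def using \<mu>(1,2) assms M
    by (intro conjI exI[of _ \<mu>]) auto
qed

lemma annihilable_Un:
  assumes "annihilable g S l M" "annihilable g S' l' M'"
  shows "annihilable g (S \<union> S') (l + l') (M * M')"
proof -
  from assms(1) obtain \<mu> where M: "0 \<le> M" "0 \<le> l" and \<mu>: "\<mu> g = 1" "\<forall>x\<in>S. \<mu> x = 0"
    "\<And>c X p q. finite X \<Longrightarrow> energy (\<lambda>x. \<mu> x * c x) X p q \<le> M * energy c X p (q + l)"
    unfolding annihilable_def by blast
  from assms(2) obtain \<nu> where M': "0 \<le> M'" "0 \<le> l'" and \<nu>: "\<nu> g = 1" "\<forall>x\<in>S'. \<nu> x = 0"
    "\<And>c X p q. finite X \<Longrightarrow> energy (\<lambda>x. \<nu> x * c x) X p q \<le> M' * energy c X p (q + l')"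
    unfolding annihilable_def by blast
  have "energy (\<lambda>x. (\<mu> x * \<nu> x) * c x) X p q \<le> (M * M') * energy c X p (q + (l + l'))"
    if X: "finite X" for c X p q
  proof -
    have "energy (\<lambda>x. \<mu> x * (\<nu> x * c x)) X p q \<le> M * energy (\<lambda>x. \<nu> x * c x) X p (q + l)"
      by (rule \<mu>(3)[OF X])
    also have "\<dots> \<le> M * (M' * energy c X p (q + l + l'))"
      using X M by (intro mult_left_mono \<nu>(3)) auto
    finally show ?thesis by (simp add: mult_ac add_ac)
  qed
  then show ?thesis unfolding annihilable_def using \<mu>(1,2) \<nu>(1,2) M M'
    by (intro conjI exI[of _ "\<lambda>x. \<mu> x * \<nu> x"]) auto
qed

text \<open>
  The difference operator \<open>f(t + \<eta>) - e(\<eta>y) f(t)\<close> kills the frequency \<open>y\<close>, and it multiplies the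
  coefficient at \<open>g\<close> by a quantity bounded away from \<open>0\<close>.  The step \<open>\<eta>\<close> may be as small as wished;
  only the constant suffers.
\<close>

lemma annihilable_singleton:
  assumes eta: "\<eta> \<ge> 0" and m: "m > 0" and D: "m \<le> cmod (ee (g * \<eta>) - ee (y * \<eta>))"
  shows "annihilable g {y} \<eta> (4 / m\<^sup>2)"
proof -
  define D where "D = ee (g * \<eta>) - ee (y * \<eta>)"
  have D0: "D \<noteq> 0" "m \<le> cmod D" using assms by (auto simp: D_def)
  define \<mu> where "\<mu> x = (ee (x * \<eta>) - ee (y * \<eta>)) / D" for x
  have "energy (\<lambda>x. \<mu> x * c x) X p q \<le> 4 / m\<^sup>2 * energy c X p (q + \<eta>)" if X: "finite X" for c X p q
  proof -
    let ?e = "\<lambda>t. (cmod (expsum c X t))\<^sup>2"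
    have eq: "expsum (\<lambda>x. \<mu> x * c x) X t = (expsum c X (t + \<eta>) - ee (y * \<eta>) * expsum c X t) / D" for t
      unfolding expsum_shift expsum_def \<mu>_def sum_distrib_left sum_subtractf[symmetric] sum_divide_distrib
      by (intro sum.cong refl) (simp add: algebra_simps ee_add)
    have le: "(cmod (expsum (\<lambda>x. \<mu> x * c x) X t))\<^sup>2 \<le> 2 / m\<^sup>2 * (?e (t + \<eta>) + ?e t)" for t
    proof -
      have "cmod (expsum (\<lambda>x. \<mu> x * c x) X t) \<le> (cmod (expsum c X (t + \<eta>)) + cmod (expsum c X t)) / m"
        unfolding eq norm_divide using D0 m norm_triangle_ineq4[of "expsum c X (t + \<eta>)" "ee (y * \<eta>) * expsum c X t"]
        by (intro frac_le) (auto simp: norm_mult)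
      then have "(cmod (expsum (\<lambda>x. \<mu> x * c x) X t))\<^sup>2 \<le> ((cmod (expsum c X (t + \<eta>)) + cmod (expsum c X t)) / m)\<^sup>2"
        by (intro power_mono) auto
      also have "\<dots> \<le> (2 * (?e (t + \<eta>) + ?e t)) / m\<^sup>2"
        unfolding power_divide using sum_squares_bound[of "cmod (expsum c X (t + \<eta>))" "cmod (expsum c X t)"]
        by (intro divide_right_mono) (auto simp: power2_sum)
      finally show ?thesis by simp
    qed
    have i1: "(?e has_integral energy c X p q) {p..q}"
      unfolding energy_def by (intro integrable_integral energy_integrable)
    have i2: "((\<lambda>t. ?e (t + \<eta>)) has_integral energy c X (p + \<eta>) (q + \<eta>)) {p..q}"
      unfolding energy_shift expsum_shift unfolding energy_def by (intro integrable_integral energy_integrable)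
    have "energy (\<lambda>x. \<mu> x * c x) X p q \<le> 2 / m\<^sup>2 * (energy c X (p + \<eta>) (q + \<eta>) + energy c X p q)"
      unfolding energy_def[of "\<lambda>x. \<mu> x * c x"]
      using integrable_integral[OF energy_integrable] has_integral_mult_right[OF has_integral_add[OF i2 i1], of "2 / m\<^sup>2"]
      by (rule has_integral_le) (rule le)
    also have "\<dots> \<le> 2 / m\<^sup>2 * (energy c X p (q + \<eta>) + energy c X p (q + \<eta>))"
      using eta by (intro mult_left_mono add_mono energy_mono) auto
    finally show ?thesis by simp
  qed
  then show ?thesis unfolding annihilable_def using eta D0
    by (intro conjI exI[of _ \<mu>]) (auto simp: \<mu>_def D_def)
qed

lemma window_average:
  fixes f :: "real \<Rightarrow> real"
  assumes f: "continuous_on UNIV f" and nn: "\<And>t. 0 \<le> f t" and l: "0 \<le> l"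
  shows "continuous_on A (\<lambda>t. integral {0..l} (\<lambda>s. f (t + s)))"
    and "integral {p..q} (\<lambda>t. integral {0..l} (\<lambda>s. f (t + s))) \<le> l * integral {p..q + l} f"
proof -
  have fc: "continuous_on B (\<lambda>z. f (u z))" if "continuous_on B u" for B and u :: "'z::topological_space \<Rightarrow> real"
    using continuous_on_compose2[OF f that] by simp
  show "continuous_on A (\<lambda>t. integral {0..l} (\<lambda>s. f (t + s)))"
  proof -
    have "continuous_on (A \<times> cbox 0 l) (\<lambda>(t, s). f (t + s))"
      unfolding case_prod_unfold by (intro fc continuous_intros)
    from integral_continuous_on_param[OF this] show ?thesis by simp
  qed
  have "integral {p..q} (\<lambda>t. integral {0..l} (\<lambda>s. f (t + s))) = integral {0..l} (\<lambda>s. integral {p..q} (\<lambda>t. f (t + s)))"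
    using integral_swap_continuous[of p 0 q l "\<lambda>t s. f (t + s)"]
    by (simp add: case_prod_unfold fc continuous_intros)
  also have "\<dots> \<le> integral {0..l} (\<lambda>s. integral {p..q + l} f)"
  proof (rule integral_le)
    have "continuous_on ({0..l} \<times> cbox p q) (\<lambda>(s, t). f (t + s))"
      unfolding case_prod_unfold by (intro fc continuous_intros)
    from integral_continuous_on_param[OF this]
    show "(\<lambda>s. integral {p..q} (\<lambda>t. f (t + s))) integrable_on {0..l}"
      by (simp add: integrable_continuous_interval)
    fix s assume s: "s \<in> {0..l}"
    have "integral {p..q} (\<lambda>t. f (t + s)) = integral {p..q} (f \<circ> (+) s)"
      by (simp add: o_def add.commute)
    also have "\<dots> = integral {p + s..q + s} f"
      by (simp only: integral_shift_Icc_real)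
    also have "\<dots> \<le> integral {p..q + l} f"
      by (rule integral_subset_le) (use s nn in \<open>auto intro!: integrable_continuous_interval continuous_on_subset[OF f]\<close>)
    finally show "integral {p..q} (\<lambda>t. f (t + s)) \<le> integral {p..q + l} f" .
  qed auto
  also have "\<dots> = l * integral {p..q + l} f" using l by simp
  finally show "integral {p..q} (\<lambda>t. integral {0..l} (\<lambda>s. f (t + s))) \<le> l * integral {p..q + l} f" .
qed

lemma expsum_smooth:
  assumes "finite X" "continuous_on {0..l} u"
  shows "expsum (\<lambda>x. integral {0..l} (\<lambda>s. ee (x * s) * u s) * c x) X t = integral {0..l} (\<lambda>s. expsum c X (t + s) * u s)"
proof -
  have "integral {0..l} (\<lambda>s. expsum c X (t + s) * u s)
      = integral {0..l} (\<lambda>s. \<Sum>x\<in>X. (c x * ee (x * t)) * (ee (x * s) * u s))"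
    unfolding expsum_def sum_distrib_right
    by (intro integral_cong sum.cong refl) (simp add: distrib_left ee_add)
  also have "\<dots> = (\<Sum>x\<in>X. integral {0..l} (\<lambda>s. (c x * ee (x * t)) * (ee (x * s) * u s)))"
    using assms by (intro integral_sum integrable_continuous_interval continuous_intros)
  also have "\<dots> = expsum (\<lambda>x. integral {0..l} (\<lambda>s. ee (x * s) * u s) * c x) X t"
    unfolding integral_mult_right expsum_def by (intro sum.cong refl) (simp only: mult_ac)
  finally show ?thesis ..
qed

text \<open>
  Averaging against \<open>u / \<parallel>u\<parallel>\<^sup>2\<close>, where \<open>u\<close> is the part of the exponential with frequency \<open>g\<close>
  orthogonal to the other exponentials on \<open>{0..l}\<close>, is biorthogonal to the whole family.  The
  lower bound assumed for exponential sums is exactly a lower bound for \<open>\<parallel>u\<parallel>\<^sup>2\<close>.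
\<close>

lemma annihilable_sparse:
  assumes S: "finite S" "g \<notin> S" and l: "0 \<le> l" and A: "A > 0"
    and low: "\<And>c. A * (\<Sum>x\<in>insert g S. (cmod (c x))\<^sup>2) \<le> energy c (insert g S) 0 l"
  shows "annihilable g S l (l / A)"
proof -
  have "continuous_on {0..l} (\<lambda>t. ee (g * t))" by (intro continuous_intros)
  from expsum_residual_exists[OF S(1) this] obtain b where
    b: "\<forall>x\<in>S. interval_inner l (\<lambda>t. ee (g * t) - expsum b S t) (\<lambda>t. ee (x * t)) = 0" by blast
  define u where "u t = ee (g * t) - expsum b S t" for t
  define c0 where "c0 x = (if x = g then 1 else - b x)" for x
  have cu: "continuous_on B u" for B unfolding u_def by (intro continuous_intros)
  have u_expsum: "u t = expsum c0 (insert g S) t" for t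
  proof -
    have "expsum c0 (insert g S) t = ee (g * t) + (\<Sum>x\<in>S. - b x * ee (x * t))"
      unfolding expsum_def using S by (auto simp: c0_def intro!: sum.cong)
    then show ?thesis by (simp add: u_def expsum_def sum_negf)
  qed
  define U where "U = integral {0..l} (\<lambda>t. (cmod (u t))\<^sup>2)"
  have "A * 1 \<le> A * (\<Sum>x\<in>insert g S. (cmod (c0 x))\<^sup>2)"
    using S A by (intro mult_left_mono) (auto simp: c0_def sum_nonneg)
  also have "\<dots> \<le> U" using low[of c0] by (simp add: U_def u_expsum energy_def)
  finally have UA: "A \<le> U" by simp
  have "integral {0..l} (\<lambda>t. ee (x * t) * cnj (u t)) = 0" if "x \<in> S" for x
  proof -
    have "integral {0..l} (\<lambda>t. ee (x * t) * cnj (u t)) = integral {0..l} (\<lambda>t. cnj (u t * cnj (ee (x * t))))"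
      by (simp add: mult.commute)
    also have "\<dots> = cnj (interval_inner l u (\<lambda>t. ee (x * t)))"
      unfolding interval_inner_def by (simp only: integral_cnj)
    finally show ?thesis using b that unfolding u_def[abs_def] by simp
  qed
  note zero = this
  have gU: "integral {0..l} (\<lambda>t. ee (g * t) * cnj (u t)) = of_real U"
  proof -
    have "(\<lambda>t. (cmod (u t))\<^sup>2) integrable_on {0..l}"
      by (intro integrable_continuous_interval continuous_intros cu)
    from has_integral_of_real[OF integrable_integral[OF this], where 'b=complex]
    have "complex_of_real U = integral {0..l} (\<lambda>t. u t * cnj (u t))"
      unfolding U_def complex_norm_square by (simp add: integral_unique)
    also have "\<dots> = integral {0..l} (\<lambda>t. ee (g * t) * cnj (u t) - (\<Sum>x\<in>S. b x * (ee (x * t) * cnj (u t))))"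
      by (intro integral_cong) (simp add: u_def expsum_def left_diff_distrib sum_distrib_right mult_ac)
    also have "\<dots> = integral {0..l} (\<lambda>t. ee (g * t) * cnj (u t)) - integral {0..l} (\<lambda>t. \<Sum>x\<in>S. b x * (ee (x * t) * cnj (u t)))"
      by (intro integral_diff integrable_continuous_interval continuous_intros cu)
    also have "integral {0..l} (\<lambda>t. \<Sum>x\<in>S. b x * (ee (x * t) * cnj (u t))) = (\<Sum>x\<in>S. integral {0..l} (\<lambda>t. b x * (ee (x * t) * cnj (u t))))"
      using S by (intro integral_sum integrable_continuous_interval continuous_intros cu)
    also have "\<dots> = 0" using zero by simp
    finally show ?thesis by simp
  qed
  define \<mu> where "\<mu> x = integral {0..l} (\<lambda>s. ee (x * s) * (cnj (u s) / of_real U))" for x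
  have \<mu>_eq: "\<mu> x = integral {0..l} (\<lambda>s. ee (x * s) * cnj (u s)) / of_real U" for x
    unfolding \<mu>_def by simp
  have "energy (\<lambda>x. \<mu> x * c x) X p q \<le> l / A * energy c X p (q + l)" if X: "finite X" for c X p q
  proof -
    let ?e = "\<lambda>t. (cmod (expsum c X t))\<^sup>2"
    have cont: "continuous_on {0..l} (\<lambda>s. cnj (u s) / of_real U)"
      using UA A by (intro continuous_intros cu) auto
    have le: "(cmod (expsum (\<lambda>x. \<mu> x * c x) X t))\<^sup>2 \<le> 1 / U * integral {0..l} (\<lambda>s. ?e (t + s))" for t
    proof -
      have "expsum (\<lambda>x. \<mu> x * c x) X t = integral {0..l} (\<lambda>s. expsum c X (t + s) * (cnj (u s) / of_real U))"
        unfolding \<mu>_def by (rule expsum_smooth[OF X cont])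
      also have "\<dots> = integral {0..l} (\<lambda>s. expsum c X (t + s) * cnj (u s)) / of_real U"
        by simp
      finally have "(cmod (expsum (\<lambda>x. \<mu> x * c x) X t))\<^sup>2 = (cmod (integral {0..l} (\<lambda>s. expsum c X (t + s) * cnj (u s))))\<^sup>2 / U\<^sup>2"
        by (simp add: norm_divide power_divide)
      also have "\<dots> \<le> (integral {0..l} (\<lambda>s. ?e (t + s)) * U) / U\<^sup>2"
        unfolding U_def by (intro divide_right_mono cauchy_schwarz_interval continuous_intros cu) auto
      finally show ?thesis using UA A by (simp add: power2_eq_square)
    qed
    have ce: "continuous_on UNIV ?e" by (intro continuous_intros)
    have "energy (\<lambda>x. \<mu> x * c x) X p q \<le> integral {p..q} (\<lambda>t. 1 / U * integral {0..l} (\<lambda>s. ?e (t + s)))"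
      unfolding energy_def[of "\<lambda>x. \<mu> x * c x"]
      by (intro integral_le energy_integrable integrable_continuous_interval continuous_intros window_average(1)[OF ce _ l] le) auto
    also have "\<dots> = 1 / U * integral {p..q} (\<lambda>t. integral {0..l} (\<lambda>s. ?e (t + s)))"
      by (rule integral_mult_right)
    also have "\<dots> \<le> 1 / U * (l * energy c X p (q + l))"
      unfolding energy_def using UA A by (intro mult_left_mono window_average(2)[OF ce _ l]) auto
    also have "\<dots> = l / U * energy c X p (q + l)" by simp
    also have "\<dots> \<le> l / A * energy c X p (q + l)"
      using UA A l by (intro mult_right_mono energy_nonneg divide_left_mono) auto
    finally show ?thesis .
  qed
  then show ?thesis unfolding annihilable_def using l A UA zero gU
    by (intro conjI exI[of _ \<mu>]) (auto simp: \<mu>_eq)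
qed

text \<open>
  Bessel's inequality is dual to the upper bound for exponential sums: take the integrals
  themselves as coefficients.
\<close>

lemma bessel_dual:
  assumes X: "finite X" and h: "continuous_on {0..l} h"
    and up: "\<And>c. energy c X 0 l \<le> B * (\<Sum>x\<in>X. (cmod (c x))\<^sup>2)" and B: "B \<ge> 0"
  shows "(\<Sum>x\<in>X. (cmod (integral {0..l} (\<lambda>s. h s * ee (- (x * s)))))\<^sup>2) \<le> B * integral {0..l} (\<lambda>s. (cmod (h s))\<^sup>2)"
proof -
  define a where "a x = integral {0..l} (\<lambda>s. h s * ee (- (x * s)))" for x
  define S where "S = (\<Sum>x\<in>X. (cmod (a x))\<^sup>2)"
  let ?h = "integral {0..l} (\<lambda>s. (cmod (h s))\<^sup>2)"
  have hn: "?h \<ge> 0" by (intro integral_nonneg integrable_continuous_interval continuous_intros h) auto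
  have S0: "S \<ge> 0" by (simp add: S_def sum_nonneg)
  have "complex_of_real S = (\<Sum>x\<in>X. cnj (a x) * a x)"
    by (simp only: S_def of_real_sum complex_norm_square mult.commute)
  also have "\<dots> = (\<Sum>x\<in>X. integral {0..l} (\<lambda>s. cnj (a x) * (h s * ee (- (x * s)))))"
    by (simp add: a_def)
  also have "\<dots> = integral {0..l} (\<lambda>s. \<Sum>x\<in>X. cnj (a x) * (h s * ee (- (x * s))))"
    by (intro integral_sum[symmetric] X integrable_continuous_interval continuous_intros h)
  also have "\<dots> = integral {0..l} (\<lambda>s. h s * cnj (expsum a X s))"
    by (simp add: expsum_def sum_distrib_left cnj_ee mult_ac)
  finally have "S\<^sup>2 = (cmod (integral {0..l} (\<lambda>s. h s * cnj (expsum a X s))))\<^sup>2"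
    by (metis norm_of_real power2_abs)
  also have "\<dots> \<le> ?h * energy a X 0 l"
    unfolding energy_def by (intro cauchy_schwarz_interval h continuous_intros)
  also have "\<dots> \<le> ?h * (B * S)"
    unfolding S_def by (intro mult_left_mono up hn)
  finally have "S * S \<le> B * ?h * S" by (simp add: power2_eq_square mult_ac)
  then have "S \<le> B * ?h" using S0 B hn by (cases "S = 0") (auto simp: mult_le_cancel_right)
  then show ?thesis by (simp add: S_def a_def)
qed

section \<open>Exponential sums with low local counts are Riesz sequences\<close>

lemma annihilable_finite:
  assumes "finite Y" and eta: "\<eta> \<ge> 0" and m: "m > 0" and B: "4 / m\<^sup>2 \<le> B"
    and D: "\<And>y. y \<in> Y \<Longrightarrow> m \<le> cmod (ee (g * \<eta>) - ee (y * \<eta>))"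
  shows "annihilable g Y (real (card Y) * \<eta>) (B ^ card Y)"
  using assms(1) D
proof (induction Y)
  case (insert y Y)
  have "annihilable g {y} \<eta> B"
    by (rule annihilable_mono[OF annihilable_singleton[OF eta m]]) (use insert.prems B in auto)
  from annihilable_Un[OF this insert.IH] insert show ?case
    by (simp add: algebra_simps)
qed (simp add: annihilable_empty)

lemma annihilable_classes:
  assumes "\<And>j. j < n \<Longrightarrow> annihilable g (S j) l M"
  shows "annihilable g (\<Union>j<n. S j) (real n * l) (M ^ n)"
  using assms
proof (induction n)
  case (Suc n)
  have "annihilable g (S n \<union> (\<Union>j<n. S j)) (l + real n * l) (M * M ^ n)"
    by (intro annihilable_Un Suc) auto
  then show ?case by (simp add: lessThan_Suc algebra_simps)
qed (simp add: annihilable_empty)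

text \<open>
  Half-open windows tile the line, which makes counts additive; finiteness is included because
  \<open>card\<close> is \<open>0\<close> on infinite sets.
\<close>

definition local_count_le :: "real \<Rightarrow> nat \<Rightarrow> real set \<Rightarrow> bool" where
  "local_count_le s K X \<longleftrightarrow> (\<forall>y. finite (X \<inter> {y..<y+s}) \<and> card (X \<inter> {y..<y+s}) \<le> K)"

lemma local_count_le_subset:
  assumes "local_count_le s K X" "Y \<subseteq> X"
  shows "local_count_le s K Y"
  unfolding local_count_le_def
proof
  fix y
  have *: "finite (X \<inter> {y..<y+s})" "card (X \<inter> {y..<y+s}) \<le> K"
    using assms(1) by (auto simp: local_count_le_def)
  have "Y \<inter> {y..<y+s} \<subseteq> X \<inter> {y..<y+s}" using assms(2) by auto
  then show "finite (Y \<inter> {y..<y+s}) \<and> card (Y \<inter> {y..<y+s}) \<le> K"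
    using * by (meson card_mono finite_subset order_trans)
qed

text \<open>
  Between two elements whose ranks agree modulo \<open>K\<close> lie at least \<open>K\<close> elements, counting the left
  one; together with the right one they are too many for a window of length \<open>s\<close>.
\<close>

lemma rank_classes_gap:
  assumes fin: "finite X" and cnt: "local_count_le s K X" and K: "K > 0"
    and x: "x \<in> X" and y: "y \<in> X" and xy: "x < y"
    and cls: "card {z \<in> X. z < x} mod K = card {z \<in> X. z < y} mod K"
  shows "s \<le> y - x"
proof (rule ccontr)
  assume "\<not> ?thesis"
  then have ys: "y < x + s" by simp
  let ?r = "\<lambda>x. card {z \<in> X. z < x}"
  have split: "{z \<in> X. z < y} = {z \<in> X. z < x} \<union> (X \<inter> {x..<y})" using xy by auto
  have ry: "?r y = ?r x + card (X \<inter> {x..<y})"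
    unfolding split using fin by (intro card_Un_disjoint) auto
  have "x \<in> X \<inter> {x..<y}" using x xy by auto
  then have pos: "card (X \<inter> {x..<y}) > 0" using fin by (auto simp: card_gt_0_iff)
  have "K dvd card (X \<inter> {x..<y})"
    using mod_eq_dvd_iff_nat[of "?r x" "?r y" K] cls ry by simp
  then have "K \<le> card (X \<inter> {x..<y})" using pos by (auto dest: dvd_imp_le)
  moreover have "insert y (X \<inter> {x..<y}) \<subseteq> X \<inter> {x..<x+s}" using y xy ys by auto
  then have "card (insert y (X \<inter> {x..<y})) \<le> card (X \<inter> {x..<x+s})"
    using fin by (intro card_mono) auto
  then have "Suc (card (X \<inter> {x..<y})) \<le> K"
    using fin cnt unfolding local_count_le_def by (auto intro: order_trans)
  ultimately show False by simp
qed

lemma cmod_ee_diff: "cmod (ee u - ee v) = 2 * \<bar>sin (pi * (u - v))\<bar>"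
proof -
  have "ee u - ee v = ee ((u + v) / 2) * (ee ((u - v) / 2) - ee (- ((u - v) / 2)))"
    unfolding right_diff_distrib ee_add[symmetric] by (simp add: field_simps)
  also have "ee ((u - v) / 2) - ee (- ((u - v) / 2)) = 2 * \<i> * of_real (sin (pi * (u - v)))"
    by (simp add: ee_def complex_eq_iff)
  finally show ?thesis by (simp add: norm_mult)
qed

text \<open>
  A rank class may contain points closer than \<open>s\<close> to \<open>g\<close>, and then the class together with \<open>g\<close>
  does not have gaps \<open>s\<close>.  There are at most \<open>2K\<close> such points; they are removed by difference
  operators.  The constant \<open>M\<close> depends only on the separation and the counting data, not on \<open>X\<close>
  or \<open>g\<close>.
\<close>

lemma annihilable_all:
  assumes gap: "0 < \<delta>" and s: "s > 0" and l: "l * s > 1" and eta: "0 < \<eta>" "\<eta> * s \<le> 1 / 2"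
  obtains M where "M > 0"
    "\<And>X g. finite X \<Longrightarrow> gaps_ge \<delta> X \<Longrightarrow> local_count_le s K X \<Longrightarrow> g \<in> X \<Longrightarrow>
       annihilable g (X - {g}) (real K * l + real (2 * K) * \<eta>) M"
proof -
  have l0: "l > 0" using l s by (metis less_trans zero_less_mult_pos2 zero_less_one)
  \<comment> \<open>Only distances between \<open>\<delta>\<close> and \<open>s\<close> occur below; the minimum guards against \<open>\<delta> > s\<close>, when
    there are no near points.\<close>
  define \<delta>' where "\<delta>' = min \<delta> s"
  have d': "0 < \<delta>'" "\<delta>' \<le> \<delta>" "\<delta>' \<le> s" using gap s by (auto simp: \<delta>'_def)
  define m where "m = 2 * sin (pi * (\<eta> * \<delta>'))"
  have "\<eta> * \<delta>' \<le> \<eta> * s" using d' eta by (intro mult_left_mono) auto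
  then have ed: "0 < \<eta> * \<delta>'" "\<eta> * \<delta>' \<le> 1 / 2" using eta d' \<open>\<eta> * \<delta>' \<le> \<eta> * s\<close> by (simp, linarith)
  have m: "m > 0" unfolding m_def using ed by (auto intro!: sin_gt_zero)
  define B where "B = max 1 (4 / m\<^sup>2)"
  obtain A where A: "A > 0" "\<And>c X. finite X \<Longrightarrow> gaps_ge s X \<Longrightarrow> A * (\<Sum>x\<in>X. (cmod (c x))\<^sup>2) \<le> energy c X 0 l"
    using ingham_lower[OF s l] by blast
  show ?thesis
  proof
    show "B ^ (2 * K) * (l / A) ^ K > 0" using A l0 by (intro mult_pos_pos zero_less_power) (auto simp: B_def)
    fix X g assume X: "finite X" "gaps_ge \<delta> X" and cnt: "local_count_le s K X" and g: "g \<in> X"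
    have cntD: "card (X \<inter> {y..<y+s}) \<le> K" for y using cnt by (auto simp: local_count_le_def)
    have "g \<in> X \<inter> {g..<g+s}" using g s by auto
    then have "card (X \<inter> {g..<g+s}) > 0" using X by (auto simp: card_gt_0_iff)
    then have K: "K > 0" using cntD[of g] by simp
    define Y where "Y = {x \<in> X. x \<noteq> g \<and> \<bar>x - g\<bar> < s}"
    have "Y \<subseteq> (X \<inter> {g - s..<g - s + s}) \<union> (X \<inter> {g..<g + s})" by (auto simp: Y_def)
    then have "card Y \<le> card ((X \<inter> {g - s..<g - s + s}) \<union> (X \<inter> {g..<g + s}))"
      using X by (intro card_mono) auto
    also have "\<dots> \<le> card (X \<inter> {g - s..<g - s + s}) + card (X \<inter> {g..<g + s})" by (rule card_Un_le)
    finally have cY: "card Y \<le> 2 * K" using cntD[of g] cntD[of "g - s"] by linarith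
    have "annihilable g Y (real (card Y) * \<eta>) (B ^ card Y)"
    proof (rule annihilable_finite[OF _ _ m])
      fix y assume y: "y \<in> Y"
      then have "\<delta> \<le> \<bar>y - g\<bar>" using X(2) g by (auto simp: Y_def gaps_ge_def)
      moreover have "\<bar>g - y\<bar> < s" using y by (auto simp: Y_def)
      ultimately have gy: "\<delta>' \<le> \<bar>g - y\<bar>" "\<bar>g - y\<bar> \<le> s" using d' by auto
      have "\<eta> * \<delta>' \<le> \<eta> * \<bar>g - y\<bar>" "\<eta> * \<bar>g - y\<bar> \<le> \<eta> * s" using gy eta by (auto intro!: mult_left_mono)
      then have "sin (pi * (\<eta> * \<delta>')) \<le> sin (pi * (\<eta> * \<bar>g - y\<bar>))"
      proof (intro sin_monotone_2pi_le mult_left_mono)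
        have "0 \<le> pi * (\<eta> * \<delta>')" using ed by simp
        then show "- (pi / 2) \<le> pi * (\<eta> * \<delta>')" using pi_gt_zero by linarith
        have "pi * (\<eta> * \<bar>g - y\<bar>) \<le> pi * (1 / 2)"
          by (intro mult_left_mono order_trans[OF \<open>\<eta> * \<bar>g - y\<bar> \<le> \<eta> * s\<close> eta(2)]) simp
        then show "pi * (\<eta> * \<bar>g - y\<bar>) \<le> pi / 2" by simp
      qed (use eta gy in auto)
      also have "\<dots> = sin \<bar>pi * (g * \<eta> - y * \<eta>)\<bar>"
      proof -
        have "pi * (g * \<eta> - y * \<eta>) = pi * (\<eta> * (g - y))" by (simp add: algebra_simps)
        then show ?thesis using eta by (simp only: abs_mult) simp
      qed
      also have "\<dots> \<le> \<bar>sin (pi * (g * \<eta> - y * \<eta>))\<bar>" by (cases "0 \<le> pi * (g * \<eta> - y * \<eta>)") auto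
      finally show "m \<le> cmod (ee (g * \<eta>) - ee (y * \<eta>))" unfolding m_def cmod_ee_diff by simp
    qed (use X eta in \<open>auto simp: Y_def B_def\<close>)
    then have near: "annihilable g Y (real (2 * K) * \<eta>) (B ^ (2 * K))"
      by (rule annihilable_mono) (use cY eta in \<open>auto simp: B_def intro!: power_increasing mult_right_mono\<close>)
    define rk where "rk x = card {z \<in> X. z < x} mod K" for x
    define S where "S j = {x \<in> X. s \<le> \<bar>x - g\<bar> \<and> rk x = j}" for j
    have "annihilable g (S j) l (l / A)" for j
    proof (rule annihilable_sparse)
      have "gaps_ge s (insert g (S j))"
        unfolding gaps_ge_def
      proof (intro ballI impI)
        fix x y assume xy: "x \<in> insert g (S j)" "y \<in> insert g (S j)" "x \<noteq> y"
        show "s \<le> \<bar>x - y\<bar>"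
        proof (cases "x = g \<or> y = g")
          case True
          then show ?thesis using xy by (auto simp: S_def)
        next
          case False
          then have "x \<in> X" "y \<in> X" "rk x = rk y" using xy by (auto simp: S_def)
          then show ?thesis using xy(3) rank_classes_gap[OF X(1) cnt K, of x y] rank_classes_gap[OF X(1) cnt K, of y x]
            unfolding rk_def by (cases "x < y") force+
        qed
      qed
      then show "A * (\<Sum>x\<in>insert g (S j). (cmod (c x))\<^sup>2) \<le> energy c (insert g (S j)) 0 l" for c
        using X by (intro A(2)) (auto simp: S_def)
    qed (use X s l0 A in \<open>auto simp: S_def\<close>)
    then have "annihilable g (\<Union>j<K. S j) (real K * l) ((l / A) ^ K)" by (intro annihilable_classes)
    from annihilable_Un[OF near this]
    show "annihilable g (X - {g}) (real K * l + real (2 * K) * \<eta>) (B ^ (2 * K) * (l / A) ^ K)"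
      by (rule annihilable_mono) (use K in \<open>auto simp: Y_def S_def rk_def add.commute\<close>)
  qed
qed

text \<open>
  The slack \<open>\<theta> = L - K/s\<close> is spent three ways: a quarter on making the Ingham length exceed
  \<open>1/s\<close>, a quarter on the steps \<open>\<eta>\<close>, and the remaining half is an interval on which only the term
  with frequency \<open>g\<close> survives.
\<close>

lemma coefficient_bound:
  assumes gap: "0 < \<delta>" and s: "s > 0" and K: "real K < L * s"
  obtains C where "C > 0"
    "\<And>X c g p. finite X \<Longrightarrow> gaps_ge \<delta> X \<Longrightarrow> local_count_le s K X \<Longrightarrow> g \<in> X \<Longrightarrow>
       (cmod (c g))\<^sup>2 \<le> C * energy c X p (p + L)"
proof -
  define \<theta> where "\<theta> = L - real K / s"
  have th: "\<theta> > 0" using K s by (simp add: \<theta>_def field_simps)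
  define l where "l = 1 / s + \<theta> / (4 * (real K + 1))"
  define \<eta> where "\<eta> = min (1 / (2 * s)) (\<theta> / (8 * (real K + 1)))"
  have l: "l * s > 1" using s th by (simp add: l_def algebra_simps)
  have eta: "0 < \<eta>" using s th by (simp add: \<eta>_def)
  have "\<eta> * s \<le> 1 / (2 * s) * s" using s by (intro mult_right_mono) (auto simp: \<eta>_def)
  then have eta': "\<eta> * s \<le> 1 / 2" using s by simp
  have Kl: "real K * l \<le> real K / s + \<theta> / 4"
  proof -
    have "real K * (\<theta> / (4 * (real K + 1))) \<le> \<theta> / 4" using th by (simp add: field_simps)
    then show ?thesis by (simp add: l_def distrib_left)
  qed
  have "real K * \<eta> \<le> real K * (\<theta> / (8 * (real K + 1)))" by (intro mult_left_mono) (auto simp: \<eta>_def)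
  also have "\<dots> \<le> \<theta> / 8" using th by (simp add: field_simps)
  finally have Ke: "real (2 * K) * \<eta> \<le> \<theta> / 4" by simp
  have len: "real K * l + real (2 * K) * \<eta> \<le> L - \<theta> / 2"
  proof -
    have "a + b \<le> L - \<theta> / 2" if "a \<le> k + \<theta> / 4" "b \<le> \<theta> / 4" "\<theta> = L - k" for a b k :: real
      using that by linarith
    from this[OF Kl Ke \<theta>_def] show ?thesis .
  qed
  obtain M where M: "M > 0" "\<And>X g. finite X \<Longrightarrow> gaps_ge \<delta> X \<Longrightarrow> local_count_le s K X \<Longrightarrow> g \<in> X \<Longrightarrow>
       annihilable g (X - {g}) (real K * l + real (2 * K) * \<eta>) M"
    using annihilable_all[OF gap s l eta eta'] by blast
  show ?thesis
  proof
    show "M / (\<theta> / 2) > 0" using M th by simp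
    fix X c g p assume X: "finite X" "gaps_ge \<delta> X" "local_count_le s K X" and g: "g \<in> X"
    have "annihilable g (X - {g}) (L - \<theta> / 2) M"
      by (rule annihilable_mono[OF M(2)[OF X g] _ len]) auto
    then obtain \<mu> where \<mu>: "\<mu> g = 1" "\<forall>x\<in>X-{g}. \<mu> x = 0"
      "energy (\<lambda>x. \<mu> x * c x) X p (p + \<theta> / 2) \<le> M * energy c X p (p + \<theta> / 2 + (L - \<theta> / 2))"
      unfolding annihilable_def using X(1) by blast
    have "expsum (\<lambda>x. \<mu> x * c x) X t = c g * ee (g * t)" for t
    proof -
      have "expsum (\<lambda>x. \<mu> x * c x) X t = \<mu> g * c g * ee (g * t) + (\<Sum>x\<in>X-{g}. \<mu> x * c x * ee (x * t))"
        unfolding expsum_def using X(1) g by (rule sum.remove)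
      then show ?thesis using \<mu> by simp
    qed
    then have "energy (\<lambda>x. \<mu> x * c x) X p (p + \<theta> / 2) = \<theta> / 2 * (cmod (c g))\<^sup>2"
      using th by (simp add: energy_def norm_mult)
    moreover have "p + \<theta> / 2 + (L - \<theta> / 2) = p + L" by simp
    ultimately have "\<theta> / 2 * (cmod (c g))\<^sup>2 \<le> M * energy c X p (p + L)"
      using \<mu>(3) by (simp only:)
    then show "(cmod (c g))\<^sup>2 \<le> M / (\<theta> / 2) * energy c X p (p + L)"
      using th by (simp add: field_simps)
  qed
qed

text \<open>
  Bounding each coefficient by the full energy loses a factor \<open>card X\<close>.  The loss is avoided by
  first localising in frequency: replacing \<open>f\<close> by its average over \<open>[t, t + \<epsilon>]\<close> against
  \<open>e(-gs)\<close> leaves the coefficient at \<open>g\<close> unchanged up to the factor \<open>\<epsilon>\<close>, and by Bessel's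
  inequality the energies of these averages, summed over \<open>g\<close>, do not exceed a constant times
  that of \<open>f\<close>.
\<close>

theorem riesz_lower_bound:
  assumes gap: "0 < \<delta>" and s: "s > 0" and K: "real K < L * s"
  obtains C where "C > 0"
    "\<And>X c p. finite X \<Longrightarrow> gaps_ge \<delta> X \<Longrightarrow> local_count_le s K X \<Longrightarrow>
       (\<Sum>x\<in>X. (cmod (c x))\<^sup>2) \<le> C * energy c X p (p + L)"
proof -
  define \<epsilon> where "\<epsilon> = (L - real K / s) / 2"
  have e: "\<epsilon> > 0" using K s by (simp add: \<epsilon>_def field_simps)
  have "real K < (L - \<epsilon>) * s" using K s by (simp add: \<epsilon>_def field_simps)
  then obtain C where C: "C > 0" "\<And>X c g p. finite X \<Longrightarrow> gaps_ge \<delta> X \<Longrightarrow> local_count_le s K X \<Longrightarrow> g \<in> X \<Longrightarrow>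
       (cmod (c g))\<^sup>2 \<le> C * energy c X p (p + (L - \<epsilon>))"
    using coefficient_bound[OF gap s] by blast
  obtain B where B: "B > 0" "\<And>c X p. finite X \<Longrightarrow> gaps_ge \<delta> X \<Longrightarrow> energy c X p (p + \<epsilon>) \<le> B * (\<Sum>x\<in>X. (cmod (c x))\<^sup>2)"
    using energy_upper[OF gap less_imp_le[OF e]] by blast
  show ?thesis
  proof
    show "C * B / \<epsilon> > 0" using C B e by simp
    fix X c p assume X: "finite X" "gaps_ge \<delta> X" "local_count_le s K X"
    let ?e = "\<lambda>t. (cmod (expsum c X t))\<^sup>2"
    \<comment> \<open>Coefficients of the average of the sum over \<open>[t, t + \<epsilon>]\<close> against \<open>e(-gs)\<close>.\<close>
    define c' where "c' g x = integral {0..\<epsilon>} (\<lambda>s. ee (x * s) * ee (- (g * s))) * c x" for g x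
    have c'g: "c' g g = of_real \<epsilon> * c g" for g
      using e unfolding c'_def by (simp add: ee_add[symmetric]) (simp add: scaleR_conv_of_real)
    have c': "expsum (c' g) X t = integral {0..\<epsilon>} (\<lambda>s. expsum c X (t + s) * ee (- (g * s)))" for g t
      unfolding c'_def by (rule expsum_smooth) (auto intro!: X continuous_intros)
    have ce: "continuous_on UNIV ?e" by (intro continuous_intros)
    have "\<epsilon>\<^sup>2 * (\<Sum>x\<in>X. (cmod (c x))\<^sup>2) = (\<Sum>g\<in>X. (cmod (c' g g))\<^sup>2)"
      by (simp add: c'g norm_mult power_mult_distrib sum_distrib_left)
    also have "\<dots> \<le> (\<Sum>g\<in>X. C * energy (c' g) X p (p + (L - \<epsilon>)))"
      by (intro sum_mono C(2) X)
    also have "\<dots> = C * integral {p..p + (L - \<epsilon>)} (\<lambda>t. \<Sum>g\<in>X. (cmod (expsum (c' g) X t))\<^sup>2)"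
      unfolding energy_def by (subst integral_sum) (auto simp: sum_distrib_left X energy_integrable)
    also have "\<dots> \<le> C * integral {p..p + (L - \<epsilon>)} (\<lambda>t. B * integral {0..\<epsilon>} (\<lambda>s. ?e (t + s)))"
    proof (intro mult_left_mono integral_le)
      show "(\<lambda>t. \<Sum>g\<in>X. (cmod (expsum (c' g) X t))\<^sup>2) integrable_on {p..p + (L - \<epsilon>)}"
        by (intro integrable_sum energy_integrable X)
      show "(\<lambda>t. B * integral {0..\<epsilon>} (\<lambda>s. ?e (t + s))) integrable_on {p..p + (L - \<epsilon>)}"
        using e by (intro integrable_continuous_interval continuous_intros window_average(1)[OF ce]) auto
      fix t
      show "(\<Sum>g\<in>X. (cmod (expsum (c' g) X t))\<^sup>2) \<le> B * integral {0..\<epsilon>} (\<lambda>s. ?e (t + s))"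
        unfolding c' using B(2)[OF X(1,2), of _ 0] B(1)
        by (intro bessel_dual X continuous_intros) auto
    qed (use C in auto)
    also have "\<dots> = C * B * integral {p..p + (L - \<epsilon>)} (\<lambda>t. integral {0..\<epsilon>} (\<lambda>s. ?e (t + s)))"
      by simp
    also have "\<dots> \<le> C * B * (\<epsilon> * integral {p..p + (L - \<epsilon>) + \<epsilon>} ?e)"
      using C B e by (intro mult_left_mono window_average(2)[OF ce]) auto
    finally have "\<epsilon>\<^sup>2 * (\<Sum>x\<in>X. (cmod (c x))\<^sup>2) \<le> C * B * \<epsilon> * energy c X p (p + L)"
      by (simp add: energy_def mult_ac)
    then show "(\<Sum>x\<in>X. (cmod (c x))\<^sup>2) \<le> C * B / \<epsilon> * energy c X p (p + L)"
      using e by (simp add: field_simps power2_eq_square)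
  qed
qed

section \<open>Parseval for exponential sums and the dimension count\<close>

lemma Digamma_reflection_complex:
  fixes z :: complex
  assumes z: "z \<notin> \<int>"
  shows "Digamma z - Digamma (1 - z) = - of_real pi * cos (of_real pi * z) / sin (of_real pi * z)"
proof -
  have z1: "1 - z \<notin> \<int>" using z by (metis Ints_1 Ints_diff diff_diff_eq2 add_diff_cancel_left')
  have nz: "z \<notin> \<int>\<^sub>\<le>\<^sub>0" "1 - z \<notin> \<int>\<^sub>\<le>\<^sub>0" using z z1 nonpos_Ints_Int by blast+
  have sin: "sin (of_real pi * z) \<noteq> 0"
    using z by (auto simp: sin_eq_0)
  let ?P = "Gamma z * Gamma (1 - z)"
  have "((\<lambda>z. Gamma z * Gamma (1 - z)) has_field_derivative ?P * (Digamma z - Digamma (1 - z))) (at z)"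
    using nz by (auto intro!: derivative_eq_intros simp: algebra_simps)
  moreover have "((\<lambda>z. of_real pi / sin (of_real pi * z)) has_field_derivative
       - (of_real pi * (of_real pi * cos (of_real pi * z))) / (sin (of_real pi * z))\<^sup>2) (at z)"
    using sin by (auto intro!: derivative_eq_intros simp: power2_eq_square)
  moreover have "(\<lambda>z. Gamma z * Gamma (1 - z)) = (\<lambda>z::complex. of_real pi / sin (of_real pi * z))"
    by (rule ext) (rule Gamma_reflection_complex)
  ultimately have "?P * (Digamma z - Digamma (1 - z)) = - (of_real pi * (of_real pi * cos (of_real pi * z))) / (sin (of_real pi * z))\<^sup>2"
    using DERIV_unique by metis
  then have *: "of_real pi / sin (of_real pi * z) * (Digamma z - Digamma (1 - z)) = - (of_real pi * (of_real pi * cos (of_real pi * z))) / (sin (of_real pi * z))\<^sup>2"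
    by (simp only: Gamma_reflection_complex)
  have "Digamma z - Digamma (1 - z) = sin (of_real pi * z) / of_real pi * (of_real pi / sin (of_real pi * z) * (Digamma z - Digamma (1 - z)))"
    using sin by simp
  also have "\<dots> = - of_real pi * cos (of_real pi * z) / sin (of_real pi * z)"
    unfolding * using sin by (simp add: power2_eq_square)
  finally show ?thesis .
qed

text \<open>
  The second logarithmic derivative of Euler's reflection formula yields the partial fractions
  of \<open>\<pi>\<^sup>2 / sin\<^sup>2 (\<pi> z)\<close>.
\<close>

lemma trigamma_reflection_complex:
  fixes z :: complex
  assumes z: "z \<notin> \<int>"
  shows "Polygamma 1 z + Polygamma 1 (1 - z) = (of_real pi / sin (of_real pi * z))\<^sup>2"
proof -
  have z1: "1 - z \<notin> \<int>" using z by (metis Ints_1 Ints_diff diff_diff_eq2 add_diff_cancel_left')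
  have nz: "z \<notin> \<int>\<^sub>\<le>\<^sub>0" "1 - z \<notin> \<int>\<^sub>\<le>\<^sub>0" using z z1 nonpos_Ints_Int by blast+
  have sin: "sin (of_real pi * z) \<noteq> 0"
    using z by (auto simp: sin_eq_0)
  have D1: "((\<lambda>z. Digamma z - Digamma (1 - z)) has_field_derivative (Polygamma 1 z + Polygamma 1 (1 - z))) (at z)"
    using nz by (auto intro!: derivative_eq_intros)
  have "((\<lambda>z. - of_real pi * cos (of_real pi * z) / sin (of_real pi * z)) has_field_derivative
       of_real pi * of_real pi + (of_real pi / sin (of_real pi * z))\<^sup>2 * (cos (of_real pi * z))\<^sup>2) (at z)"
    using sin by (auto intro!: derivative_eq_intros simp: power2_eq_square field_simps)
  also have "of_real pi * of_real pi + (of_real pi / sin (of_real pi * z))\<^sup>2 * (cos (of_real pi * z))\<^sup>2 = (of_real pi / sin (of_real pi * z))\<^sup>2"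
    unfolding cos_squared_eq using sin by (simp add: field_simps power2_eq_square)
  finally have D2: "((\<lambda>z. - of_real pi * cos (of_real pi * z) / sin (of_real pi * z)) has_field_derivative
       (of_real pi / sin (of_real pi * z))\<^sup>2) (at z)" .
  have op: "open (- \<int> :: complex set)" using closed_Ints by blast
  have "((\<lambda>z. Digamma z - Digamma (1 - z)) has_field_derivative (of_real pi / sin (of_real pi * z))\<^sup>2) (at z)"
    by (rule has_field_derivative_transform_within_open[OF D2 op])
       (use z in \<open>auto simp: Digamma_reflection_complex\<close>)
  from DERIV_unique[OF D1 this] show ?thesis .
qed

lemma inverse_squares_series:
  fixes x :: real
  assumes x: "0 < x" "x < 1"
  obtains u v where "(\<lambda>k. 1 / (x + real k)\<^sup>2) sums u" "(\<lambda>k. 1 / (1 - x + real k)\<^sup>2) sums v"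
    "u + v = (pi / sin (pi * x))\<^sup>2"
proof
  have e: "inverse (y ^ Suc 1) = 1 / y\<^sup>2" for y :: real by (simp add: power2_eq_square divide_inverse)
  show "(\<lambda>k. 1 / (x + real k)\<^sup>2) sums Polygamma 1 x"
    using Polygamma_LIMSEQ[of x 1] x by (simp add: e power2_eq_square divide_inverse)
  show "(\<lambda>k. 1 / (1 - x + real k)\<^sup>2) sums Polygamma 1 (1 - x)"
    using Polygamma_LIMSEQ[of "1 - x" 1] x by (simp add: e power2_eq_square divide_inverse)
  have "complex_of_real x \<notin> \<int>"
    using x by (auto elim!: Ints_cases simp: complex_eq_iff)
  from trigamma_reflection_complex[OF this]
  have "complex_of_real (Polygamma 1 x + Polygamma 1 (1 - x)) = of_real ((pi / sin (pi * x))\<^sup>2)"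
    using x Polygamma_of_real[of x 1, where 'a=complex] Polygamma_of_real[of "1 - x" 1, where 'a=complex]
    by (simp flip: sin_of_real)
  then show "Polygamma 1 x + Polygamma 1 (1 - x) = (pi / sin (pi * x))\<^sup>2"
    by (simp only: of_real_eq_iff)
qed

definition ehat :: "real \<Rightarrow> complex" where
  "ehat w = integral {0..1} (\<lambda>t. ee (w * t))"

lemma ehat_0 [simp]: "ehat 0 = 1"
  by (simp add: ehat_def)

lemma ehat_neq_0: "w \<noteq> 0 \<Longrightarrow> ehat w = (ee w - 1) / (2 * pi * \<i> * w)"
  unfolding ehat_def using has_integral_ee[of w 0 1] by (simp add: integral_unique)

lemma ee_of_int [simp]: "ee (of_int n) = 1"
  using cos_int_2pin[of n] sin_int_2pin[of n] by (simp add: ee_def complex_eq_iff mult_ac)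

lemma ehat_int: "ehat (of_int n) = (if n = 0 then 1 else 0)"
  by (simp add: ehat_neq_0)

lemma cmod_ee_minus_1: "cmod (ee w - 1) = 2 * \<bar>sin (pi * w)\<bar>"
  using cmod_ee_diff[of w 0] by simp

lemma cmod_ehat_sq: "w \<noteq> 0 \<Longrightarrow> (cmod (ehat w))\<^sup>2 = (sin (pi * w) / pi)\<^sup>2 * (1 / w\<^sup>2)"
  by (simp add: ehat_neq_0 norm_divide norm_mult cmod_ee_minus_1 power_mult_distrib power_divide)

lemma sums_nonneg_has_sum:
  fixes f :: "nat \<Rightarrow> real"
  assumes "f sums s" "\<And>k. 0 \<le> f k"
  shows "(f has_sum s) UNIV"
  using assms by (intro norm_summable_imp_has_sum) (auto simp: sums_iff)

text \<open>
  Parseval for a single exponential on the unit interval, which is the partial fraction series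
  of \<open>\<pi>\<^sup>2 / sin\<^sup>2\<close>.  It proves without an approximation theorem that the integer exponentials are
  complete as far as exponential sums are concerned.
\<close>

lemma ehat_has_sum: "((\<lambda>n::int. (cmod (ehat (y - of_int n)))\<^sup>2) has_sum 1) UNIV"
proof (cases "y \<in> \<int>")
  case True
  then obtain m where m: "y = of_int m" by (auto elim: Ints_cases)
  have "((\<lambda>n::int. (cmod (ehat (y - of_int n)))\<^sup>2) has_sum 1) {m}"
    by (rule has_sum_finiteI) (auto simp: m)
  then show ?thesis
    by (rule has_sum_cong_neutral[THEN iffD1, rotated -1])
       (auto simp: m ehat_int simp flip: of_int_diff)
next
  case False
  define m where "m = \<lfloor>y\<rfloor>"
  define x where "x = y - of_int m"
  have "x \<noteq> 0" using False by (auto simp: x_def)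
  then have x: "0 < x" "x < 1" by (auto simp: x_def m_def) linarith+
  obtain u v where uv: "(\<lambda>k. 1 / (x + real k)\<^sup>2) sums u" "(\<lambda>k. 1 / (1 - x + real k)\<^sup>2) sums v"
    "u + v = (pi / sin (pi * x))\<^sup>2"
    using inverse_squares_series[OF x] by blast
  define f where "f n = 1 / (x - of_int n)\<^sup>2" for n :: int
  have "(f has_sum u) (range (\<lambda>k::nat. - int k))"
    using sums_nonneg_has_sum[OF uv(1)] by (subst has_sum_reindex) (auto simp: inj_on_def o_def f_def)
  moreover have "(f has_sum v) (range (\<lambda>k::nat. int k + 1))"
    using sums_nonneg_has_sum[OF uv(2)]
    by (subst has_sum_reindex) (auto simp: inj_on_def o_def f_def power2_commute algebra_simps)
  ultimately have "(f has_sum (u + v)) (range (\<lambda>k::nat. - int k) \<union> range (\<lambda>k::nat. int k + 1))"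
    by (rule has_sum_Un_disjoint) auto
  also have "range (\<lambda>k::nat. - int k) \<union> range (\<lambda>k::nat. int k + 1) = UNIV"
  proof -
    have "n \<in> range (\<lambda>k::nat. - int k) \<union> range (\<lambda>k::nat. int k + 1)" for n :: int
    proof (cases "n \<le> 0")
      case True
      then have "n = - int (nat (- n))" by simp
      then show ?thesis by blast
    next
      case False
      then have "n = int (nat (n - 1)) + 1" by simp
      then show ?thesis by blast
    qed
    then show ?thesis by blast
  qed
  finally have "(f has_sum (pi / sin (pi * x))\<^sup>2) UNIV" by (simp only: uv(3))
  then have "((\<lambda>n. (sin (pi * x) / pi)\<^sup>2 * f n) has_sum (sin (pi * x) / pi)\<^sup>2 * (pi / sin (pi * x))\<^sup>2) UNIV"
    by (rule has_sum_cmult_right)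
  moreover have "sin (pi * x) \<noteq> 0" using x sin_gt_zero[of "pi * x"] by simp
  then have "(sin (pi * x) / pi)\<^sup>2 * (pi / sin (pi * x))\<^sup>2 = 1" by (simp add: power_divide)
  ultimately have 1: "((\<lambda>n. (sin (pi * x) / pi)\<^sup>2 * f n) has_sum 1) UNIV" by simp
  have 2: "(sin (pi * x) / pi)\<^sup>2 * f n = (cmod (ehat (x - of_int n)))\<^sup>2" for n
  proof -
    have "x \<noteq> of_int n" using x by auto
    then have "(cmod (ehat (x - of_int n)))\<^sup>2 = (sin (pi * (x - of_int n)) / pi)\<^sup>2 * f n"
      by (subst cmod_ehat_sq) (auto simp: f_def)
    moreover have "\<bar>sin (pi * (x - of_int n))\<bar> = \<bar>sin (pi * x)\<bar>"
      using cmod_ee_minus_1[of "x - of_int n"] cmod_ee_minus_1[of x] ee_add[of x "of_int (- n)"]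
      by (simp del: of_int_minus) (simp add: ee_of_int)?
    then have "(sin (pi * (x - of_int n)))\<^sup>2 = (sin (pi * x))\<^sup>2" by (metis power2_abs)
    ultimately show ?thesis by (simp add: power_divide)
  qed
  have "((\<lambda>n. (cmod (ehat (x - of_int n)))\<^sup>2) has_sum 1) UNIV" using 1 unfolding 2 .
  also have "?this \<longleftrightarrow> ((\<lambda>n. (cmod (ehat (y - of_int n)))\<^sup>2) has_sum 1) UNIV"
    by (rule has_sum_reindex_bij_witness[of _ "\<lambda>n. n - m" "\<lambda>n. n + m"]) (auto simp: x_def algebra_simps)
  finally show ?thesis .
qed

definition fourier_coeff :: "(real \<Rightarrow> complex) \<Rightarrow> int \<Rightarrow> complex" where
  "fourier_coeff f n = integral {0..1} (\<lambda>t. f t * cnj (ee (of_int n * t)))"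

lemma fourier_coeff_ee: "fourier_coeff (\<lambda>t. ee (y * t)) n = ehat (y - of_int n)"
  unfolding fourier_coeff_def ehat_def ee_mult_cnj by (simp add: left_diff_distrib)

lemma fourier_residual:
  assumes f: "continuous_on {0..1} f" and W: "finite W"
  shows "integral {0..1} (\<lambda>t. (cmod (f t - (\<Sum>n\<in>W. fourier_coeff f n * ee (of_int n * t))))\<^sup>2)
    = integral {0..1} (\<lambda>t. (cmod (f t))\<^sup>2) - (\<Sum>n\<in>W. (cmod (fourier_coeff f n))\<^sup>2)"
  using W
proof (induction W)
  case (insert m W)
  let ?g = "\<lambda>t. f t - (\<Sum>n\<in>W. fourier_coeff f n * ee (of_int n * t))"
  let ?e = "\<lambda>t. ee (of_int m * t)"
  have cg: "continuous_on {0..1} ?g" by (intro continuous_intros f)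
  have "integral {0..1} (\<lambda>t. ?g t * cnj (?e t))
      = integral {0..1} (\<lambda>t. f t * cnj (?e t) - (\<Sum>n\<in>W. fourier_coeff f n * ee ((of_int n - of_int m) * t)))"
    by (intro integral_cong)
      (simp add: left_diff_distrib sum_distrib_right ee_mult_cnj[symmetric] mult.assoc)
  also have "\<dots> = fourier_coeff f m - integral {0..1} (\<lambda>t. (\<Sum>n\<in>W. fourier_coeff f n * ee ((of_int n - of_int m) * t)))"
    unfolding fourier_coeff_def by (intro integral_diff integrable_continuous_interval continuous_intros f)
  also have "integral {0..1} (\<lambda>t. (\<Sum>n\<in>W. fourier_coeff f n * ee ((of_int n - of_int m) * t)))
      = (\<Sum>n\<in>W. integral {0..1} (\<lambda>t. fourier_coeff f n * ee ((of_int n - of_int m) * t)))"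
    by (intro integral_sum insert.hyps integrable_continuous_interval continuous_intros)
  also have "\<dots> = (\<Sum>n\<in>W. fourier_coeff f n * ehat (of_int (n - m)))"
    by (simp add: ehat_def)
  also have "\<dots> = 0"
    using insert.hyps by (intro sum.neutral) (auto simp: ehat_int simp del: of_int_diff)
  finally have gm: "integral {0..1} (\<lambda>t. ?g t * cnj (?e t)) = fourier_coeff f m" by simp
  have i1: "((\<lambda>t. (cmod (?g t))\<^sup>2) has_integral integral {0..1} (\<lambda>t. (cmod (?g t))\<^sup>2)) {0..1}"
    by (intro integrable_integral integrable_continuous_interval continuous_intros cg)
  have "((\<lambda>t. ?g t * cnj (?e t)) has_integral fourier_coeff f m) {0..1}"
    unfolding gm[symmetric] by (intro integrable_integral integrable_continuous_interval continuous_intros cg)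
  from has_integral_Re[OF has_integral_mult_right[OF this, of "cnj (fourier_coeff f m)"]]
  have i2: "((\<lambda>t. Re (cnj (fourier_coeff f m) * (?g t * cnj (?e t)))) has_integral (cmod (fourier_coeff f m))\<^sup>2) {0..1}"
    by (simp add: mult.commute[of "cnj (fourier_coeff f m)" "fourier_coeff f m"] complex_norm_square[symmetric] del: of_real_power)
  have "((\<lambda>t. (cmod (?g t))\<^sup>2 - 2 * Re (cnj (fourier_coeff f m) * (?g t * cnj (?e t))) + (cmod (fourier_coeff f m))\<^sup>2 * 1) has_integral
     integral {0..1} (\<lambda>t. (cmod (?g t))\<^sup>2) - 2 * (cmod (fourier_coeff f m))\<^sup>2 + (cmod (fourier_coeff f m))\<^sup>2 * 1) {0..1}"
    using has_integral_const_real[of "1::real" 0 1] by (intro has_integral_add has_integral_diff has_integral_mult_right i1 i2) simp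
  moreover have "(cmod (?g t))\<^sup>2 - 2 * Re (cnj (fourier_coeff f m) * (?g t * cnj (?e t))) + (cmod (fourier_coeff f m))\<^sup>2 * 1
     = (cmod (f t - (\<Sum>n\<in>insert m W. fourier_coeff f n * ee (of_int n * t))))\<^sup>2" for t
  proof -
    have "f t - (\<Sum>n\<in>insert m W. fourier_coeff f n * ee (of_int n * t)) = ?g t - fourier_coeff f m * ?e t"
      using insert.hyps by (simp add: algebra_simps)
    then show ?thesis by (simp only: cmod_diff_mult_sq norm_ee power_one mult_1_right)
  qed
  ultimately show ?case using insert.IH insert.hyps by (simp add: integral_unique)
qed simp

text \<open>
  The defect in Bessel's inequality is a quadratic form in the function, so it is controlled by
  the defects of the single exponentials, and these tend to \<open>0\<close> by \<open>ehat_has_sum\<close>.  The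
  frequencies are indexed rather than collected in a set because they may coincide.
\<close>

theorem parseval_exponential_sum:
  fixes w :: "'i \<Rightarrow> real" and a :: "'i \<Rightarrow> complex"
  assumes I: "finite I"
  defines "f \<equiv> \<lambda>t. \<Sum>i\<in>I. a i * ee (w i * t)"
  shows "((\<lambda>n. (cmod (\<Sum>i\<in>I. a i * ehat (w i - of_int n)))\<^sup>2) has_sum integral {0..1} (\<lambda>t. (cmod (f t))\<^sup>2)) UNIV"
proof -
  let ?F = "integral {0..1} (\<lambda>t. (cmod (f t))\<^sup>2)"
  have cf: "continuous_on {0..1} f" unfolding f_def by (intro continuous_intros)
  have coef: "fourier_coeff f n = (\<Sum>i\<in>I. a i * ehat (w i - of_int n))" for n
  proof -
    have "fourier_coeff f n = integral {0..1} (\<lambda>t. \<Sum>i\<in>I. a i * (ee (w i * t) * cnj (ee (of_int n * t))))"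
      unfolding fourier_coeff_def f_def by (simp add: sum_distrib_right mult.assoc)
    also have "\<dots> = (\<Sum>i\<in>I. integral {0..1} (\<lambda>t. a i * (ee (w i * t) * cnj (ee (of_int n * t)))))"
      by (intro integral_sum I integrable_continuous_interval continuous_intros)
    also have "\<dots> = (\<Sum>i\<in>I. a i * ehat (w i - of_int n))"
      by (simp add: fourier_coeff_ee[symmetric] fourier_coeff_def)
    finally show ?thesis .
  qed
  define D where "D i W = 1 - (\<Sum>n\<in>W. (cmod (ehat (w i - of_int n)))\<^sup>2)" for i and W :: "int set"
  have D: "integral {0..1} (\<lambda>t. (cmod (ee (w i * t) - (\<Sum>n\<in>W. ehat (w i - of_int n) * ee (of_int n * t))))\<^sup>2) = D i W"
    if "finite W" for i W
    using fourier_residual[of "\<lambda>t. ee (w i * t)" W] that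
    by (simp add: fourier_coeff_ee D_def continuous_intros)
  define S where "S W = (\<Sum>n\<in>W. (cmod (\<Sum>i\<in>I. a i * ehat (w i - of_int n)))\<^sup>2)" for W
  have bound: "0 \<le> ?F - S W \<and> ?F - S W \<le> (\<Sum>i\<in>I. (cmod (a i))\<^sup>2) * (\<Sum>i\<in>I. D i W)" if W: "finite W" for W
  proof -
    let ?r = "\<lambda>i t. ee (w i * t) - (\<Sum>n\<in>W. ehat (w i - of_int n) * ee (of_int n * t))"
    have "f t - (\<Sum>n\<in>W. fourier_coeff f n * ee (of_int n * t)) = (\<Sum>i\<in>I. a i * ?r i t)" for t
      unfolding coef unfolding f_def
      by (simp add: sum_distrib_right sum_distrib_left right_diff_distrib sum_subtractf mult.assoc)
        (rule sum.swap)
    with fourier_residual[OF cf W] have eq: "?F - S W = integral {0..1} (\<lambda>t. (cmod (\<Sum>i\<in>I. a i * ?r i t))\<^sup>2)"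
      by (simp add: S_def coef)
    have nn: "0 \<le> integral {0..1} (\<lambda>t. (cmod (\<Sum>i\<in>I. a i * ?r i t))\<^sup>2)" by (intro integral_nonneg integrable_continuous_interval continuous_intros) auto
    have "integral {0..1} (\<lambda>t. (cmod (\<Sum>i\<in>I. a i * ?r i t))\<^sup>2)
       \<le> integral {0..1} (\<lambda>t. (\<Sum>i\<in>I. (cmod (a i))\<^sup>2) * (\<Sum>i\<in>I. (cmod (?r i t))\<^sup>2))"
    proof (intro integral_le integrable_continuous_interval continuous_intros)
      fix t
      have "cmod (\<Sum>i\<in>I. a i * ?r i t) \<le> (\<Sum>i\<in>I. cmod (a i) * cmod (?r i t))"
        by (intro order_trans[OF norm_sum] sum_mono) (simp add: norm_mult)
      then have "(cmod (\<Sum>i\<in>I. a i * ?r i t))\<^sup>2 \<le> (\<Sum>i\<in>I. cmod (a i) * cmod (?r i t))\<^sup>2"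
        by (intro power_mono) auto
      also have "\<dots> \<le> (\<Sum>i\<in>I. (cmod (a i))\<^sup>2) * (\<Sum>i\<in>I. (cmod (?r i t))\<^sup>2)"
        by (rule Cauchy_Schwarz_ineq_sum)
      finally show "(cmod (\<Sum>i\<in>I. a i * ?r i t))\<^sup>2 \<le> (\<Sum>i\<in>I. (cmod (a i))\<^sup>2) * (\<Sum>i\<in>I. (cmod (?r i t))\<^sup>2)" .
    qed
    also have "\<dots> = (\<Sum>i\<in>I. (cmod (a i))\<^sup>2) * (\<Sum>i\<in>I. integral {0..1} (\<lambda>t. (cmod (?r i t))\<^sup>2))"
      by (subst integral_mult_right, subst integral_sum)
        (auto intro!: I integrable_continuous_interval continuous_intros)
    also have "\<dots> = (\<Sum>i\<in>I. (cmod (a i))\<^sup>2) * (\<Sum>i\<in>I. D i W)" using W by (simp add: D)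
    finally show ?thesis unfolding eq using nn by simp
  qed
  have "((\<lambda>W. 1 - (\<Sum>n\<in>W. (cmod (ehat (w i - of_int n)))\<^sup>2)) \<longlongrightarrow> 1 - 1) (finite_subsets_at_top UNIV)" for i
    using ehat_has_sum[of "w i"] unfolding has_sum_def by (intro tendsto_diff tendsto_const)
  then have "((\<lambda>W. D i W) \<longlongrightarrow> 0) (finite_subsets_at_top UNIV)" for i by (simp add: D_def)
  then have "((\<lambda>W. (\<Sum>i\<in>I. (cmod (a i))\<^sup>2) * (\<Sum>i\<in>I. D i W)) \<longlongrightarrow> (\<Sum>i\<in>I. (cmod (a i))\<^sup>2) * (\<Sum>i\<in>I. 0)) (finite_subsets_at_top UNIV)"
    by (intro tendsto_intros) auto
  then have lim0: "((\<lambda>W. (\<Sum>i\<in>I. (cmod (a i))\<^sup>2) * (\<Sum>i\<in>I. D i W)) \<longlongrightarrow> 0) (finite_subsets_at_top UNIV)"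
    by simp
  have "((\<lambda>W. ?F - S W) \<longlongrightarrow> 0) (finite_subsets_at_top UNIV)"
  proof (rule tendsto_sandwich[OF _ _ tendsto_const lim0])
    show "\<forall>\<^sub>F W in finite_subsets_at_top UNIV. 0 \<le> ?F - S W"
      using bound by (intro eventually_finite_subsets_at_top_weakI) blast
    show "\<forall>\<^sub>F W in finite_subsets_at_top UNIV. ?F - S W \<le> (\<Sum>i\<in>I. (cmod (a i))\<^sup>2) * (\<Sum>i\<in>I. D i W)"
      using bound by (intro eventually_finite_subsets_at_top_weakI) blast
  qed
  from tendsto_diff[OF tendsto_const[of ?F] this] show ?thesis
    unfolding has_sum_def S_def by simp
qed

lemma underdetermined_system:
  fixes M :: "'w \<Rightarrow> 'y \<Rightarrow> complex"
  assumes "finite W" "finite Y" "card W < card Y"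
  shows "\<exists>c. (\<exists>y\<in>Y. c y \<noteq> 0) \<and> (\<forall>w\<in>W. (\<Sum>y\<in>Y. c y * M w y) = 0)"
  using assms
proof (induction W arbitrary: Y M)
  case empty
  then have "Y \<noteq> {}" by auto
  then show ?case by (intro exI[of _ "\<lambda>_. 1"]) auto
next
  case (insert w W)
  show ?case
  proof (cases "\<forall>y\<in>Y. M w y = 0")
    case True
    have "card W < card Y" using insert by simp
    from insert.IH[OF insert.prems(1) this, of M] True show ?thesis by (auto intro!: sum.neutral)
  next
    case False
    then obtain y0 where y0: "y0 \<in> Y" "M w y0 \<noteq> 0" by blast
    define Y' where "Y' = Y - {y0}"
    have Y': "finite Y'" "card W < card Y'" "y0 \<notin> Y'" "Y = insert y0 Y'"
      using insert y0 by (auto simp: Y'_def)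
    define M' where "M' v y = M v y - M v y0 * M w y / M w y0" for v y
    from insert.IH[OF Y'(1,2), of M'] obtain c where c: "\<exists>y\<in>Y'. c y \<noteq> 0" "\<forall>v\<in>W. (\<Sum>y\<in>Y'. c y * M' v y) = 0" by blast
    define c' where "c' y = (if y = y0 then - (\<Sum>y\<in>Y'. c y * M w y) / M w y0 else c y)" for y
    have eq: "(\<Sum>y\<in>Y. c' y * M v y) = (\<Sum>y\<in>Y'. c y * M' v y)" for v
    proof -
      have "(\<Sum>y\<in>Y'. c' y * M v y) = (\<Sum>y\<in>Y'. c y * M v y)"
        using Y' by (intro sum.cong) (auto simp: c'_def)
      then have "(\<Sum>y\<in>Y. c' y * M v y) = - (\<Sum>y\<in>Y'. c y * M w y) / M w y0 * M v y0 + (\<Sum>y\<in>Y'. c y * M v y)"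
        using Y' by (simp add: c'_def)
      also have "\<dots> = (\<Sum>y\<in>Y'. c y * M v y) - (\<Sum>y\<in>Y'. c y * (M v y0 * M w y / M w y0))"
        by (simp add: sum_distrib_left sum_distrib_right sum_divide_distrib mult_ac)
      finally show ?thesis by (simp add: M'_def right_diff_distrib sum_subtractf)
    qed
    have "M' w y = 0" for y using y0 by (simp add: M'_def)
    then have "(\<Sum>y\<in>Y. c' y * M w y) = 0" by (simp add: eq)
    moreover have "\<exists>y\<in>Y. c' y \<noteq> 0" using c(1) Y' by (auto simp: c'_def)
    ultimately show ?thesis using c(2) by (intro exI[of _ c']) (auto simp: eq)
  qed
qed

text \<open>
  Multiplication by \<open>1 - e(t)\<close> turns the Fourier coefficients \<open>E(w - n)\<close> of an exponential into
  \<open>E(w - n) - E(w - n + 1)\<close>, which is \<open>E(w - n)\<close> divided by \<open>w - n + 1\<close>.  Outside the window of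
  integers within distance \<open>R\<close> this gains a factor \<open>1/R\<^sup>2\<close> in the squares, while the squares of
  \<open>E(w - n)\<close> sum to \<open>1\<close>.  If there are more frequencies than integers in that window, a nonzero
  choice of coefficients kills all Fourier coefficients inside it.
\<close>

lemma frequency_count:
  fixes w :: "'i \<Rightarrow> real"
  assumes I: "finite I" and A: "A > 0" and R: "R > 0" and w: "\<And>i. i \<in> I \<Longrightarrow> p \<le> w i \<and> w i \<le> p + \<rho>" and rho: "\<rho> \<ge> 0"
    and low: "\<And>c. A * (\<Sum>i\<in>I. (cmod (c i))\<^sup>2)
       \<le> integral {0..1} (\<lambda>t. (cmod ((1 - ee t) * (\<Sum>i\<in>I. c i * ee (w i * t))))\<^sup>2)"
  shows "real (card I) \<le> \<rho> + 2 * R + 2 \<or> A * R\<^sup>2 \<le> real (card I)"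
proof (rule ccontr)
  assume neg: "\<not> ?thesis"
  \<comment> \<open>The extra \<open>1\<close> on the right is for the shifted coefficient \<open>E(w - n + 1)\<close>.\<close>
  define W where "W = {\<lceil>p - R\<rceil>..\<lfloor>p + \<rho> + R + 1\<rfloor>}"
  have "real (card W) \<le> \<rho> + 2 * R + 2"
    unfolding W_def using R rho by simp linarith
  then have "card W < card I" using neg by linarith
  have "finite W" by (simp add: W_def)
  from underdetermined_system[OF this I \<open>card W < card I\<close>, of "\<lambda>n i. ehat (w i - of_int n) - ehat (w i + 1 - of_int n)"]
  obtain c where c: "\<exists>i\<in>I. c i \<noteq> 0"
    "\<And>n. n \<in> W \<Longrightarrow> (\<Sum>i\<in>I. c i * (ehat (w i - of_int n) - ehat (w i + 1 - of_int n))) = 0"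
    by blast
  define S where "S = (\<Sum>i\<in>I. (cmod (c i))\<^sup>2)"
  have S: "S > 0" unfolding S_def using c(1) I by (auto intro!: sum_pos2)
  define \<kappa> where "\<kappa> i n = ehat (w i - of_int n) - ehat (w i + 1 - of_int n)" for i and n :: int
  let ?F = "integral {0..1} (\<lambda>t. (cmod ((1 - ee t) * (\<Sum>i\<in>I. c i * ee (w i * t))))\<^sup>2)"
  have hs: "((\<lambda>n. (cmod (\<Sum>i\<in>I. c i * \<kappa> i n))\<^sup>2) has_sum ?F) UNIV"
  proof -
    \<comment> \<open>The product with \<open>1 - e(t)\<close> is an exponential sum over two copies of \<open>I\<close>, the second with
      frequencies shifted by \<open>1\<close>.\<close>
    define a where "a = (\<lambda>(i, b). if b then - c i else c i)"
    define w' where "w' = (\<lambda>(i, b). if b then w i + 1 else w i)"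
    have UB: "(\<Sum>j\<in>I \<times> UNIV. g j) = (\<Sum>i\<in>I. g (i, False) + g (i, True))" for g :: "'i \<times> bool \<Rightarrow> complex"
      using sum.cartesian_product[of "\<lambda>i b. g (i, b)" UNIV I] by (simp add: UNIV_bool)
    have 1: "(\<Sum>j\<in>I \<times> UNIV. a j * ee (w' j * t)) = (1 - ee t) * (\<Sum>i\<in>I. c i * ee (w i * t))" for t
      unfolding UB by (simp add: a_def w'_def ee_add distrib_right sum_distrib_left algebra_simps)
    have 2: "(\<Sum>j\<in>I \<times> UNIV. a j * ehat (w' j - of_int n)) = (\<Sum>i\<in>I. c i * \<kappa> i n)" for n
      unfolding UB by (simp add: a_def w'_def \<kappa>_def algebra_simps)
    from parseval_exponential_sum[of "I \<times> UNIV" a w'] I show ?thesis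
      unfolding 1 2 by simp
  qed
  have \<kappa>_le: "(cmod (\<kappa> i n))\<^sup>2 \<le> 1 / R\<^sup>2 * (cmod (ehat (w i - of_int n)))\<^sup>2" if "i \<in> I" "n \<notin> W" for i n
  proof -
    define x where "x = w i - of_int n"
    have "of_int n < p - R \<or> of_int n > p + \<rho> + R + 1"
      using that(2) unfolding W_def atLeastAtMost_iff ceiling_le_iff le_floor_iff by linarith
    then have x: "x > R \<or> - (x + 1) > R" using w[OF that(1)] by (auto simp: x_def)
    then have nz: "x \<noteq> 0" "x + 1 \<noteq> 0" using R by auto
    have "ee (x + 1) = ee x" using ee_add[of x 1] ee_of_int[of 1] by simp
    moreover have "complex_of_real x \<noteq> 0" "complex_of_real (x + 1) \<noteq> 0"
      using nz by (simp_all only: of_real_eq_0_iff not_False_eq_True)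
    moreover have "u / (k * z) - u / (k * (z + 1)) = u / (k * z) / (z + 1)"
      if "k \<noteq> 0" "z \<noteq> 0" "z + 1 \<noteq> 0" for u k z :: complex
      using that by (simp add: divide_simps) (simp add: algebra_simps)
    ultimately have "ehat x - ehat (x + 1) = ehat x / of_real (x + 1)"
      unfolding ehat_neq_0[OF nz(1)] ehat_neq_0[OF nz(2)] by simp
    moreover have "w i + 1 - of_int n = x + 1" by (simp add: x_def)
    ultimately have "\<kappa> i n = ehat x / of_real (x + 1)"
      by (simp only: \<kappa>_def x_def[symmetric])
    then have "(cmod (\<kappa> i n))\<^sup>2 = (cmod (ehat x))\<^sup>2 / (x + 1)\<^sup>2"
      by (simp add: norm_divide power_divide del: of_real_add)
    also have "R\<^sup>2 \<le> (x + 1)\<^sup>2" using x R by (intro abs_le_square_iff[THEN iffD1]) auto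
    then have "(cmod (ehat x))\<^sup>2 / (x + 1)\<^sup>2 \<le> (cmod (ehat x))\<^sup>2 / R\<^sup>2"
      using R by (intro divide_left_mono mult_pos_pos) auto
    finally show ?thesis by (simp add: x_def)
  qed
  have fin_le: "(\<Sum>n\<in>V. (cmod (\<Sum>i\<in>I. c i * \<kappa> i n))\<^sup>2) \<le> S * (card I / R\<^sup>2)" if V: "finite V" for V
  proof -
    have "(\<Sum>n\<in>V. (cmod (\<Sum>i\<in>I. c i * \<kappa> i n))\<^sup>2) \<le> (\<Sum>n\<in>V. S * (\<Sum>i\<in>I. 1 / R\<^sup>2 * (cmod (ehat (w i - of_int n)))\<^sup>2))"
    proof (rule sum_mono)
      fix n
      show "(cmod (\<Sum>i\<in>I. c i * \<kappa> i n))\<^sup>2 \<le> S * (\<Sum>i\<in>I. 1 / R\<^sup>2 * (cmod (ehat (w i - of_int n)))\<^sup>2)"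
      proof (cases "n \<in> W")
        case True
        then show ?thesis using c(2) S by (auto simp: \<kappa>_def intro!: mult_nonneg_nonneg sum_nonneg)
      next
        case False
        have "cmod (\<Sum>i\<in>I. c i * \<kappa> i n) \<le> (\<Sum>i\<in>I. cmod (c i) * cmod (\<kappa> i n))"
          by (intro order_trans[OF norm_sum] sum_mono) (simp add: norm_mult)
        then have "(cmod (\<Sum>i\<in>I. c i * \<kappa> i n))\<^sup>2 \<le> (\<Sum>i\<in>I. cmod (c i) * cmod (\<kappa> i n))\<^sup>2"
          by (intro power_mono) auto
        also have "\<dots> \<le> S * (\<Sum>i\<in>I. (cmod (\<kappa> i n))\<^sup>2)"
          unfolding S_def by (rule Cauchy_Schwarz_ineq_sum)
        also have "\<dots> \<le> S * (\<Sum>i\<in>I. 1 / R\<^sup>2 * (cmod (ehat (w i - of_int n)))\<^sup>2)"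
          using S False by (intro mult_left_mono sum_mono \<kappa>_le) auto
        finally show ?thesis .
      qed
    qed
    also have "\<dots> = S * (\<Sum>i\<in>I. 1 / R\<^sup>2 * (\<Sum>n\<in>V. (cmod (ehat (w i - of_int n)))\<^sup>2))"
      unfolding sum_distrib_left by (rule sum.swap)
    also have "\<dots> \<le> S * (\<Sum>i\<in>I. 1 / R\<^sup>2 * 1)"
      using S V by (intro mult_left_mono sum_mono has_sum_mono_neutral[OF has_sum_finite[OF V] ehat_has_sum]) auto
    finally show ?thesis by simp
  qed
  have "?F \<le> S * (card I / R\<^sup>2)"
    by (rule has_sum_le_finite_sums[OF hs]) (use fin_le in auto)
  moreover have "A * S \<le> ?F" unfolding S_def by (rule low)
  ultimately have "S * A \<le> S * (card I / R\<^sup>2)" by (simp add: mult.commute)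
  then have "A \<le> card I / R\<^sup>2" by (simp only: mult_le_cancel_left_pos[OF S])
  then have "A * R\<^sup>2 \<le> card I" using R by (simp add: field_simps)
  then show False using neg by simp
qed

section \<open>Necessity of the density bound\<close>

lemma weight_split:
  fixes v e \<psi> :: "real \<Rightarrow> real"
  assumes le: "a \<le> a'" "a' \<le> b'" "b' \<le> b"
    and cont: "continuous_on {a..b} v" "continuous_on {a..b} e" "continuous_on {a..b} \<psi>"
    and e: "\<And>t. 0 \<le> e t" and C: "0 \<le> C" and \<psi>: "\<And>t. 0 \<le> \<psi> t"
    and out: "\<And>t. t \<in> {a..a'} \<union> {b'..b} \<Longrightarrow> v t \<le> \<epsilon>"
    and ins: "\<And>t. t \<in> {a'..b'} \<Longrightarrow> v t \<le> \<epsilon> + C * \<psi> t"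
  shows "integral {a..b} (\<lambda>t. v t * e t) \<le> \<epsilon> * integral {a..b} e + C * integral {a'..b'} (\<lambda>t. \<psi> t * e t)"
proof -
  have I: "f integrable_on {p..q}" if "continuous_on {a..b} f" "a \<le> p" "q \<le> b" for f :: "real \<Rightarrow> real" and p q
    by (rule integrable_continuous_interval, rule continuous_on_subset[OF that(1)]) (use that in auto)
  have cve: "continuous_on {a..b} (\<lambda>t. v t * e t)" and cpe: "continuous_on {a..b} (\<lambda>t. \<psi> t * e t)"
    by (intro continuous_intros cont)+
  have split: "integral {a..b} f = integral {a..a'} f + integral {a'..b'} f + integral {b'..b} f"
    if "continuous_on {a..b} f" for f :: "real \<Rightarrow> real"
  proof -
    have "integral {a..b'} f + integral {b'..b} f = integral {a..b} f"
      by (rule Henstock_Kurzweil_Integration.integral_combine) (use le I[OF that] in auto)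
    moreover have "integral {a..a'} f + integral {a'..b'} f = integral {a..b'} f"
      by (rule Henstock_Kurzweil_Integration.integral_combine) (use le I[OF that] in auto)
    ultimately show ?thesis by simp
  qed
  have o: "integral {p..q} (\<lambda>t. v t * e t) \<le> \<epsilon> * integral {p..q} e" if "a \<le> p" "q \<le> b" "{p..q} \<subseteq> {a..a'} \<union> {b'..b}" for p q
  proof -
    have "integral {p..q} (\<lambda>t. v t * e t) \<le> integral {p..q} (\<lambda>t. \<epsilon> * e t)"
      using that e out by (intro integral_le I cve cont continuous_intros mult_right_mono) auto
    then show ?thesis by simp
  qed
  have "integral {a'..b'} (\<lambda>t. v t * e t) \<le> integral {a'..b'} (\<lambda>t. \<epsilon> * e t + C * (\<psi> t * e t))"
  proof (intro integral_le I cve cont continuous_intros)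
    fix t assume "t \<in> {a'..b'}"
    from mult_right_mono[OF ins[OF this] e[of t]]
    show "v t * e t \<le> \<epsilon> * e t + C * (\<psi> t * e t)" by (simp add: algebra_simps)
  qed (use le in auto)
  also have "\<dots> = integral {a'..b'} (\<lambda>t. \<epsilon> * e t) + integral {a'..b'} (\<lambda>t. C * (\<psi> t * e t))"
    using le by (intro integral_add I cont continuous_intros) auto
  finally have "integral {a'..b'} (\<lambda>t. v t * e t) \<le> \<epsilon> * integral {a'..b'} e + C * integral {a'..b'} (\<lambda>t. \<psi> t * e t)"
    by simp
  with o[of a a'] o[of b' b] le show ?thesis
    unfolding split[OF cve] split[OF cont(2)] by (simp add: distrib_left)
qed

lemma separated_interval_count:
  assumes gap: "gaps_ge \<delta> X" and d: "\<delta> > 0" and s: "s \<ge> 0"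
  shows "finite (X \<inter> {y..<y+s}) \<and> real (card (X \<inter> {y..<y+s})) \<le> s / \<delta> + 1"
proof -
  let ?f = "\<lambda>x. nat \<lfloor>(x - y) / \<delta>\<rfloor>" and ?S = "X \<inter> {y..<y+s}"
  have inj: "inj_on ?f ?S"
  proof (rule inj_onI, rule ccontr)
    fix x z assume xz: "x \<in> ?S" "z \<in> ?S" "?f x = ?f z" "x \<noteq> z"
    have "0 \<le> (x - y) / \<delta>" "0 \<le> (z - y) / \<delta>" using xz d by auto
    then have "\<lfloor>(x - y) / \<delta>\<rfloor> = \<lfloor>(z - y) / \<delta>\<rfloor>" using xz(3) by (simp add: eq_nat_nat_iff)
    then have "\<bar>(x - y) / \<delta> - (z - y) / \<delta>\<bar> < 1" by linarith
    then have "\<bar>x - z\<bar> < \<delta>" using d by (simp flip: diff_divide_distrib)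
    moreover have "\<delta> \<le> \<bar>x - z\<bar>" using gap xz unfolding gaps_ge_def by blast
    ultimately show False by linarith
  qed
  have sub: "?f ` ?S \<subseteq> {..nat \<lfloor>s / \<delta>\<rfloor>}"
  proof
    fix n assume "n \<in> ?f ` ?S"
    then obtain x where x: "x \<in> ?S" "n = ?f x" by blast
    have "(x - y) / \<delta> \<le> s / \<delta>" using x d by (intro divide_right_mono) auto
    then show "n \<in> {..nat \<lfloor>s / \<delta>\<rfloor>}" using x by (auto intro!: nat_mono floor_mono)
  qed
  have fin: "finite ?S" using finite_subset[OF sub] inj by (auto dest: finite_imageD)
  have "card ?S = card (?f ` ?S)" using inj by (simp add: card_image)
  also have "\<dots> \<le> nat \<lfloor>s / \<delta>\<rfloor> + 1" using card_mono[OF _ sub] by simp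
  finally have "real (card ?S) \<le> real (nat \<lfloor>s / \<delta>\<rfloor> + 1)" by simp
  also have "\<dots> \<le> s / \<delta> + 1" using s d by simp
  finally show ?thesis using fin by simp
qed

text \<open>
  Near the zeros \<open>a\<close> and \<open>b\<close> the weight is below \<open>\<epsilon> = A/(2B)\<close>, where \<open>B\<close> is the constant of
  \<open>energy_upper\<close>; these parts absorb at most half of the lower bound.  On the middle interval
  \<open>[a', b']\<close> of length \<open>L\<close> the weight is dominated by \<open>\<epsilon>\<close> plus a multiple of \<open>|1 - e((t - a')/L)|\<^sup>2\<close>,
  and rescaling to the unit interval puts the problem into the form of \<open>frequency_count\<close>.
\<close>

lemma weighted_lower_bound_count:
  fixes v :: "real \<Rightarrow> real"
  assumes ab: "a < b" and v: "continuous_on UNIV v" and v0: "\<And>t. 0 \<le> v t" "v a = 0" "v b = 0"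
    and gap: "gaps_ge \<delta> \<Gamma>" "\<delta> > 0" and A: "A > 0"
    and low: "\<And>c X. finite X \<Longrightarrow> X \<subseteq> \<Gamma> \<Longrightarrow>
      A * (\<Sum>x\<in>X. (cmod (c x))\<^sup>2) \<le> integral {a..b} (\<lambda>t. v t * (cmod (expsum c X t))\<^sup>2)"
  obtains \<theta> r0 where "0 \<le> \<theta>" "\<theta> < b - a"
    "\<And>r y. r \<ge> r0 \<Longrightarrow> real (card (\<Gamma> \<inter> {y..<y+r})) \<le> \<theta> * r + 2"
proof -
  obtain B where B: "B > 0" "\<And>c X p. finite X \<Longrightarrow> gaps_ge \<delta> X \<Longrightarrow> energy c X p (p + (b - a)) \<le> B * (\<Sum>x\<in>X. (cmod (c x))\<^sup>2)"
    using energy_upper[OF gap(2), of "b - a"] ab by auto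
  define \<epsilon> where "\<epsilon> = A / (2 * B)"
  have eps: "\<epsilon> > 0" using A B by (simp add: \<epsilon>_def)
  have near: "\<exists>d>0. \<forall>t. \<bar>t - z\<bar> < d \<longrightarrow> v t \<le> \<epsilon>" if "v z = 0" for z
  proof -
    have "continuous (at z) v" using v by (simp add: continuous_on_eq_continuous_at)
    then obtain d where "d > 0" "\<And>t. dist t z < d \<Longrightarrow> dist (v t) (v z) < \<epsilon>"
      using eps unfolding continuous_at_eps_delta by blast
    then show ?thesis using that by (intro exI[of _ d]) (force simp: dist_real_def)
  qed
  obtain d1 where d1: "d1 > 0" "\<And>t. \<bar>t - a\<bar> < d1 \<Longrightarrow> v t \<le> \<epsilon>" using near[OF v0(2)] by blast
  obtain d2 where d2: "d2 > 0" "\<And>t. \<bar>t - b\<bar> < d2 \<Longrightarrow> v t \<le> \<epsilon>" using near[OF v0(3)] by blast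
  \<comment> \<open>Of the margin \<open>2d\<close> at each end, the outer half is discarded and the inner half lets the
    weight \<open>\<psi>\<close> grow from its zero at \<open>a' = a + d\<close> or \<open>b' = b - d\<close>.\<close>
  define d where "d = min (min d1 d2) (b - a) / 5"
  have d: "d > 0" "2 * d < d1" "2 * d < d2" "5 * d \<le> b - a"
    using d1 d2 ab unfolding d_def by (auto simp: min_def)
  define a' where "a' = a + d"
  define b' where "b' = b - d"
  define L where "L = b' - a'"
  have L: "L = b - a - 2 * d" "L > 0" using d by (simp_all add: L_def a'_def b'_def)
  define \<psi> where "\<psi> t = (cmod (1 - ee ((t - a') / L)))\<^sup>2" for t
  have c\<psi>: "continuous_on S \<psi>" for S unfolding \<psi>_def using L by (intro continuous_intros) auto
  obtain t0 where t0: "t0 \<in> {a + 2 * d..b - 2 * d}" "\<And>t. t \<in> {a + 2 * d..b - 2 * d} \<Longrightarrow> \<psi> t0 \<le> \<psi> t"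
    using continuous_attains_inf[of "{a + 2 * d..b - 2 * d}" \<psi>] c\<psi> d by auto
  define m where "m = \<psi> t0"
  have m: "m > 0"
  proof -
    define u where "u = (t0 - a') / L"
    have u: "0 < u" "u < 1" using t0(1) d L by (auto simp: u_def a'_def field_simps)
    then have "sin (pi * u) > 0" by (intro sin_gt_zero) auto
    then have "cmod (ee u - 1) > 0" by (simp add: cmod_ee_minus_1)
    then show ?thesis by (simp add: m_def \<psi>_def u_def[symmetric] norm_minus_commute)
  qed
  have "\<exists>x\<in>{a..b}. \<forall>t\<in>{a..b}. v t \<le> v x"
    by (rule continuous_attains_sup) (use ab continuous_on_subset[OF v] in auto)
  then obtain t1 where t1: "\<And>t. t \<in> {a..b} \<Longrightarrow> v t \<le> v t1" by blast
  define C where "C = v t1 / m + 1"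
  have C: "C > 0" using m v0(1)[of t1] by (simp add: C_def add_nonneg_pos)
  define A' where "A' = A / (2 * C * L)"
  have A': "A' > 0" using A C L by (simp add: A'_def)
  have low': "A' * (\<Sum>x\<in>X. (cmod (c x))\<^sup>2)
       \<le> integral {0..1} (\<lambda>t. (cmod ((1 - ee t) * (\<Sum>x\<in>X. c x * ee (L * x * t))))\<^sup>2)"
    if X: "finite X" "X \<subseteq> \<Gamma>" for c X
  proof -
    let ?S = "\<Sum>x\<in>X. (cmod (c x))\<^sup>2"
    \<comment> \<open>The phases compensate the translation of \<open>[a', b']\<close> to the origin.\<close>
    define c' where "c' x = c x * ee (- (x * a'))" for x
    have S': "(\<Sum>x\<in>X. (cmod (c' x))\<^sup>2) = ?S" by (simp add: c'_def norm_mult)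
    have "A * ?S \<le> integral {a..b} (\<lambda>t. v t * (cmod (expsum c' X t))\<^sup>2)"
      using low[OF X, of c'] by (simp only: S')
    also have "\<dots> \<le> \<epsilon> * integral {a..b} (\<lambda>t. (cmod (expsum c' X t))\<^sup>2)
        + C * integral {a'..b'} (\<lambda>t. \<psi> t * (cmod (expsum c' X t))\<^sup>2)"
    proof (rule weight_split)
      fix t assume "t \<in> {a'..b'}"
      show "v t \<le> \<epsilon> + C * \<psi> t"
      proof (cases "t \<in> {a + 2 * d..b - 2 * d}")
        case True
        then have "v t \<le> v t1" using d by (intro t1) auto
        also have "v t1 = v t1 / m * m" using m by simp
        also have "\<dots> \<le> C * \<psi> t"
          using m t0(2)[OF True] v0(1)[of t1] unfolding C_def m_def by (intro mult_mono) auto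
        finally show ?thesis using eps by simp
      next
        case False
        then have "\<bar>t - a\<bar> < d1 \<or> \<bar>t - b\<bar> < d2" using d \<open>t \<in> {a'..b'}\<close> by (auto simp: a'_def b'_def)
        then have "v t \<le> \<epsilon>" using d1(2) d2(2) by blast
        moreover have "0 \<le> C * \<psi> t" using C by (simp add: \<psi>_def)
        ultimately show ?thesis by simp
      qed
    next
      fix t assume "t \<in> {a..a'} \<union> {b'..b}"
      then have "\<bar>t - a\<bar> < d1 \<or> \<bar>t - b\<bar> < d2" using d by (auto simp: a'_def b'_def)
      then show "v t \<le> \<epsilon>" using d1(2) d2(2) by blast
    qed (use d L C in \<open>auto simp: a'_def b'_def \<psi>_def[abs_def] intro!: continuous_intros continuous_on_subset[OF v]\<close>)
    also have "\<epsilon> * integral {a..b} (\<lambda>t. (cmod (expsum c' X t))\<^sup>2) \<le> \<epsilon> * (B * ?S)"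
      using B(2)[OF X(1) gaps_ge_subset[OF gap(1) X(2)], of c' a] eps
      unfolding S' energy_def by (intro mult_left_mono) auto
    also have "\<epsilon> * (B * ?S) = A / 2 * ?S" using B by (simp add: \<epsilon>_def)
    finally have half: "A / 2 * ?S \<le> C * integral {a'..b'} (\<lambda>t. \<psi> t * (cmod (expsum c' X t))\<^sup>2)"
      by (simp add: field_simps)
    let ?g = "\<lambda>t. \<psi> t * (cmod (expsum c' X t))\<^sup>2"
    have "(?g has_integral integral {a'..b'} ?g) (cbox a' b')"
      by (simp, intro integrable_integral integrable_continuous_interval continuous_intros c\<psi>)
    from has_integral_affinity'[OF this L(2), of a']
    have "((\<lambda>u. ?g (L * u + a')) has_integral integral {a'..b'} ?g / L) {0..1}"
      using L by (simp add: L_def divide_inverse mult.commute)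
    moreover have "?g (L * u + a') = (cmod ((1 - ee u) * (\<Sum>x\<in>X. c x * ee (L * x * u))))\<^sup>2" for u
    proof -
      have "expsum c' X (L * u + a') = (\<Sum>x\<in>X. c x * ee (L * x * u))"
        unfolding expsum_def c'_def
      proof (intro sum.cong refl)
        fix x
        have "ee (- (x * a')) * ee (x * (L * u + a')) = ee (L * x * u)"
          unfolding ee_add[symmetric] by (simp add: algebra_simps)
        then show "c x * ee (- (x * a')) * ee (x * (L * u + a')) = c x * ee (L * x * u)"
          by (simp add: mult.assoc)
      qed
      then show ?thesis using L by (simp add: \<psi>_def norm_mult power_mult_distrib)
    qed
    ultimately have "integral {0..1} (\<lambda>t. (cmod ((1 - ee t) * (\<Sum>x\<in>X. c x * ee (L * x * t))))\<^sup>2) = integral {a'..b'} ?g / L"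
      by (simp add: integral_unique)
    moreover have "A' * ?S \<le> integral {a'..b'} ?g / L"
    proof -
      have "A' * ?S = (A / 2 * ?S) / (C * L)" by (simp add: A'_def)
      also have "\<dots> \<le> (C * integral {a'..b'} ?g) / (C * L)"
        using half C L by (intro divide_right_mono) auto
      finally show ?thesis using C by simp
    qed
    ultimately show ?thesis by simp
  qed
  \<comment> \<open>\<open>L + 2 (d/2) = b - a - d\<close>, while \<open>A' (R r)\<^sup>2\<close> is quadratic in \<open>r\<close> and outgrows the at
    most linear number of frequencies in a window of length \<open>r\<close>.\<close>
  define R where "R r = d / 2 * r" for r
  define k where "k = A' * (d / 2)\<^sup>2"
  have k: "k > 0" using A' d by (simp add: k_def)
  define r0 where "r0 = max 1 ((1 / \<delta> + 2) / k)"
  show ?thesis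
  proof
    show "0 \<le> b - a - d" "b - a - d < b - a" using d by auto
    fix r y assume r: "r \<ge> r0"
    have r1: "r \<ge> 1" and rk: "(1 / \<delta> + 2) / k \<le> r" using r by (auto simp: r0_def)
    let ?X = "\<Gamma> \<inter> {y..<y+r}"
    have X: "finite ?X" "real (card ?X) \<le> r / \<delta> + 1"
      using separated_interval_count[OF gap, of r y] r1 by auto
    have "real (card ?X) \<le> L * r + 2 * R r + 2 \<or> A' * (R r)\<^sup>2 \<le> real (card ?X)"
    proof (rule frequency_count[where w="\<lambda>x. L * x" and p="L * y"])
      show "A' * (\<Sum>i\<in>?X. (cmod (c i))\<^sup>2) \<le> integral {0..1} (\<lambda>t. (cmod ((1 - ee t) * (\<Sum>i\<in>?X. c i * ee (L * i * t))))\<^sup>2)" for c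
        by (rule low'[OF X(1)]) auto
    qed (use X A' d r1 L in \<open>auto simp: R_def distrib_left[symmetric]\<close>)
    moreover have "\<not> A' * (R r)\<^sup>2 \<le> real (card ?X)"
    proof -
      have "1 / \<delta> + 2 \<le> k * r" using rk k by (simp add: field_simps)
      then have "(1 / \<delta> + 2) * r \<le> k * r * r" using r1 by (intro mult_right_mono) auto
      then have "r / \<delta> + 2 * r \<le> A' * (R r)\<^sup>2"
        by (simp add: k_def R_def power_mult_distrib algebra_simps power2_eq_square)
      then show ?thesis using X(2) r1 by linarith
    qed
    ultimately have "real (card ?X) \<le> L * r + 2 * R r + 2" by simp
    also have "\<dots> = (b - a - d) * r + 2" by (simp add: L R_def algebra_simps)
    finally show "real (card ?X) \<le> (b - a - d) * r + 2" .
  qed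
qed

section \<open>The upper uniform density\<close>

text \<open>
  The hypothesis is subadditivity up to boundary terms: \<open>d r\<close> is \<open>n r / r\<close> for a counting
  function \<open>n\<close>, a window of length \<open>r\<close> is covered by at most \<open>r/s + 1\<close> windows of length \<open>s\<close>, and
  \<open>1/s\<close> accounts for one extra point in each.
\<close>

lemma fekete_limit:
  fixes d :: "real \<Rightarrow> real"
  assumes nn: "\<And>r. r > 0 \<Longrightarrow> 0 \<le> d r"
    and le: "\<And>r s. r > 0 \<Longrightarrow> s > 0 \<Longrightarrow> d r \<le> (1 + s / r) * (d s + 1 / s)"
  obtains l where "0 \<le> l" "(d \<longlongrightarrow> l) at_top" "\<And>s. s > 0 \<Longrightarrow> l \<le> d s + 1 / s"
proof
  let ?S = "(\<lambda>s. d s + 1 / s) ` {0<..}"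
  define l where "l = Inf ?S"
  have bdd: "bdd_below ?S" by (rule bdd_belowI[of _ 0]) (auto simp: nn add_nonneg_nonneg)
  show "0 \<le> l" unfolding l_def by (rule cInf_greatest) (auto simp: nn add_nonneg_nonneg)
  show lower: "l \<le> d s + 1 / s" if "s > 0" for s
    unfolding l_def using that bdd by (intro cInf_lower) auto
  show "(d \<longlongrightarrow> l) at_top"
  proof (rule order_tendstoI)
    fix u assume u: "u < l"
    have "((\<lambda>r::real. l - 1 / r) \<longlongrightarrow> l - 0) at_top"
      by (intro tendsto_diff tendsto_const tendsto_divide_0[OF tendsto_const] filterlim_at_top_imp_at_infinity filterlim_ident)
    then have "\<forall>\<^sub>F r in at_top. u < l - 1 / r" using u by (simp add: order_tendstoD)
    then show "\<forall>\<^sub>F r in at_top. u < d r"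
      using eventually_gt_at_top[of 0] by eventually_elim (use lower in force)
  next
    fix u assume u: "l < u"
    then obtain s where s: "s > 0" "d s + 1 / s < u"
      using cInf_lessD[of ?S u] unfolding l_def by auto
    have "((\<lambda>r::real. (1 + s / r) * (d s + 1 / s)) \<longlongrightarrow> (1 + 0) * (d s + 1 / s)) at_top"
      by (intro tendsto_mult tendsto_add tendsto_const tendsto_divide_0[OF tendsto_const] filterlim_at_top_imp_at_infinity filterlim_ident)
    then have "\<forall>\<^sub>F r in at_top. (1 + s / r) * (d s + 1 / s) < u" using s by (simp add: order_tendstoD)
    then show "\<forall>\<^sub>F r in at_top. d r < u"
      using eventually_gt_at_top[of 0] by eventually_elim (use le s in force)
  qed
qed

lemma separated_setE:
  assumes "separated_set \<Gamma>"
  obtains \<delta> where "\<delta> > 0" "gaps_ge \<delta> \<Gamma>"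
proof -
  define I where "I = (INF (\<gamma>, \<gamma>') \<in> {(\<gamma>, \<gamma>'). \<gamma> \<in> \<Gamma> \<and> \<gamma>' \<in> \<Gamma> \<and> \<gamma> \<noteq> \<gamma>'}. ereal \<bar>\<gamma> - \<gamma>'\<bar>)"
  have "0 < I" using assms by (simp add: separated_set_def I_def)
  then obtain \<delta> where d: "0 < ereal \<delta>" "ereal \<delta> < I" by (metis ereal_dense2 zero_ereal_def)
  have "\<delta> \<le> \<bar>x - y\<bar>" if "x \<in> \<Gamma>" "y \<in> \<Gamma>" "x \<noteq> y" for x y
  proof -
    have "I \<le> ereal \<bar>x - y\<bar>" unfolding I_def using that by (intro INF_lower2[of "(x, y)"]) auto
    then show ?thesis using d(2) by (metis ereal_less_eq(3) less_imp_le order_trans)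
  qed
  then show ?thesis using that[of \<delta>] d by (auto simp: gaps_ge_def)
qed

text \<open>
  All that is needed about the density: it is a finite limit, numbers above it bound the local
  counts at some scale, and linear bounds for the counts at large scales bound it.
\<close>

lemma upper_density_limit:
  assumes gap: "gaps_ge \<delta> \<Gamma>" and d: "\<delta> > 0"
  obtains l where "0 \<le> l" "upper_uniform_density \<Gamma> = ennreal l"
    "\<And>u. l < u \<Longrightarrow> \<exists>s>0. \<exists>K. local_count_le s K \<Gamma> \<and> real K < u * s"
    "\<And>\<theta> r0. 0 \<le> \<theta> \<Longrightarrow> (\<And>r y. r \<ge> r0 \<Longrightarrow> real (card (\<Gamma> \<inter> {y..<y+r})) \<le> \<theta> * r + 2) \<Longrightarrow> l \<le> \<theta>"
proof -
  define cnt where "cnt y r = real (card (\<Gamma> \<inter> {y<..<y+r}))" for y r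
  define n where "n r = (SUP y. cnt y r)" for r
  define D where "D r = n r / r" for r
  have half: "finite (\<Gamma> \<inter> {y..<y+r})" "real (card (\<Gamma> \<inter> {y..<y+r})) \<le> r / \<delta> + 1" if "r \<ge> 0" for y r
    using separated_interval_count[OF gap d that] by auto
  have sub: "\<Gamma> \<inter> {y<..<y+r} \<subseteq> \<Gamma> \<inter> {y..<y+r}" for y r by auto
  have fin: "finite (\<Gamma> \<inter> {y<..<y+r})" if "r \<ge> 0" for y r
    using finite_subset[OF sub half(1)[OF that]] .
  have cnt_half: "cnt y r \<le> real (card (\<Gamma> \<inter> {y..<y+r}))" if "r \<ge> 0" for y r
    unfolding cnt_def using card_mono[OF half(1)[OF that] sub] by simp
  have bdd: "bdd_above (range (\<lambda>y. cnt y r))" if "r \<ge> 0" for r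
    by (rule bdd_aboveI[of _ "r / \<delta> + 1"]) (use cnt_half[OF that] half(2)[OF that] order_trans in blast)
  have cnt_n: "cnt y r \<le> n r" if "r \<ge> 0" for y r
    unfolding n_def by (rule cSUP_upper[OF _ bdd[OF that]]) simp
  have n0: "0 \<le> n r" if "r \<ge> 0" for r using cnt_n[OF that, of 0] by (simp add: cnt_def)
  have half_n: "real (card (\<Gamma> \<inter> {y..<y+r})) \<le> n r + 1" if "r \<ge> 0" for y r
  proof -
    have "\<Gamma> \<inter> {y..<y+r} \<subseteq> insert y (\<Gamma> \<inter> {y<..<y+r})" by auto
    then have "card (\<Gamma> \<inter> {y..<y+r}) \<le> card (insert y (\<Gamma> \<inter> {y<..<y+r}))"
      using fin[OF that] by (intro card_mono) auto
    also have "\<dots> \<le> Suc (card (\<Gamma> \<inter> {y<..<y+r}))" using fin[OF that] by (simp add: card_insert_if)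
    finally show ?thesis using cnt_n[OF that, of y] by (simp add: cnt_def)
  qed
  have cover: "n r \<le> (r / s + 1) * (n s + 1)" if rs: "r > 0" "s > 0" for r s
    unfolding n_def[of r]
  proof (rule cSUP_least)
    fix y
    define m where "m = nat \<lceil>r / s\<rceil>"
    have m: "real m \<le> r / s + 1" "r / s \<le> real m" using rs by (auto simp: m_def intro: order_trans[OF _ less_imp_le])
    have "\<Gamma> \<inter> {y<..<y+r} \<subseteq> (\<Union>k<m. \<Gamma> \<inter> {y + real k * s..<y + real k * s + s})"
    proof
      fix x assume x: "x \<in> \<Gamma> \<inter> {y<..<y+r}"
      define k where "k = nat \<lfloor>(x - y) / s\<rfloor>"
      have "0 \<le> (x - y) / s" using x rs by auto
      then have k: "real k \<le> (x - y) / s" "(x - y) / s < real k + 1" unfolding k_def by linarith+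
      have "(x - y) / s < r / s" using x rs by (intro divide_strict_right_mono) auto
      then have "k < m" using k m by linarith
      moreover have "real k * s \<le> x - y" "x - y < real k * s + s"
        using k rs by (simp_all add: field_simps)
      ultimately show "x \<in> (\<Union>k<m. \<Gamma> \<inter> {y + real k * s..<y + real k * s + s})"
        using x by (intro UN_I[of k]) auto
    qed
    moreover have "finite (\<Union>k<m. \<Gamma> \<inter> {y + real k * s..<y + real k * s + s})"
      using half(1)[of s] rs by (intro finite_UN_I) auto
    ultimately have "card (\<Gamma> \<inter> {y<..<y+r}) \<le> card (\<Union>k<m. \<Gamma> \<inter> {y + real k * s..<y + real k * s + s})"
      by (intro card_mono)
    also have "\<dots> \<le> (\<Sum>k<m. card (\<Gamma> \<inter> {y + real k * s..<y + real k * s + s}))" by (rule card_UN_le) simp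
    finally have "cnt y r \<le> real (\<Sum>k<m. card (\<Gamma> \<inter> {y + real k * s..<y + real k * s + s}))"
      unfolding cnt_def of_nat_le_iff .
    also have "\<dots> \<le> (\<Sum>k<m. n s + 1)" unfolding of_nat_sum using rs by (intro sum_mono half_n) auto
    also have "\<dots> = real m * (n s + 1)" by simp
    also have "\<dots> \<le> (r / s + 1) * (n s + 1)" using m n0[of s] rs by (intro mult_right_mono) auto
    finally show "cnt y r \<le> (r / s + 1) * (n s + 1)" .
  qed simp
  have D0: "0 \<le> D r" if "r > 0" for r using n0[of r] that by (simp add: D_def)
  have Dle: "D r \<le> (1 + s / r) * (D s + 1 / s)" if "r > 0" "s > 0" for r s
  proof -
    have "D r \<le> (r / s + 1) * (n s + 1) / r" unfolding D_def using cover[OF that] that by (intro divide_right_mono) auto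
    also have "\<dots> = (1 + s / r) * (D s + 1 / s)" using that by (simp add: D_def field_simps)
    finally show ?thesis .
  qed
  obtain l where l: "0 \<le> l" "(D \<longlongrightarrow> l) at_top" "\<And>s. s > 0 \<Longrightarrow> l \<le> D s + 1 / s"
    using fekete_limit[OF D0 Dle] by blast
  have eq: "(SUP x. emeasure (count_space UNIV) (\<Gamma> \<inter> {x<..<x + r}) / ennreal r) = ennreal (D r)" if r: "r > 0" for r
  proof -
    have e: "emeasure (count_space UNIV) (\<Gamma> \<inter> {x<..<x + r}) / ennreal r = ennreal (cnt x r / r)" for x
    proof -
      have "emeasure (count_space UNIV) (\<Gamma> \<inter> {x<..<x + r}) = ennreal (cnt x r)"
        using fin[of r x] r by (simp add: emeasure_count_space_finite cnt_def ennreal_of_nat_eq_real_of_nat)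
      then show ?thesis using r by (simp add: divide_ennreal cnt_def)
    qed
    have "(SUP x. ennreal (cnt x r / r)) = ennreal (D r)"
    proof (rule antisym)
      show "(SUP x. ennreal (cnt x r / r)) \<le> ennreal (D r)"
        using cnt_n[of r] r unfolding D_def by (intro SUP_least ennreal_leI divide_right_mono) auto
      show "ennreal (D r) \<le> (SUP x. ennreal (cnt x r / r))"
      proof (rule dense_ge)
        fix z assume z: "(SUP x. ennreal (cnt x r / r)) < z"
        show "ennreal (D r) \<le> z"
        proof (cases z)
          case (real w)
          have "cnt x r / r \<le> w" for x
          proof -
            have "ennreal (cnt x r / r) \<le> (SUP x. ennreal (cnt x r / r))" by (rule SUP_upper) simp
            also have "\<dots> \<le> ennreal w" using z real by simp
            finally show ?thesis using real by (simp add: ennreal_le_iff)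
          qed
          then have "n r \<le> w * r" unfolding n_def using r by (intro cSUP_least) (auto simp: field_simps)
          then show ?thesis using r real by (simp add: D_def field_simps ennreal_leI)
        qed simp
      qed
    qed
    then show ?thesis by (simp only: e)
  qed
  have tend: "((\<lambda>r. SUP x. emeasure (count_space UNIV) (\<Gamma> \<inter> {x<..<x + r}) / ennreal r) \<longlongrightarrow> ennreal l) at_top"
  proof (rule Lim_transform_eventually)
    show "((\<lambda>r. ennreal (D r)) \<longlongrightarrow> ennreal l) at_top" by (intro tendsto_ennrealI l)
    show "\<forall>\<^sub>F r in at_top. ennreal (D r) = (SUP x. emeasure (count_space UNIV) (\<Gamma> \<inter> {x<..<x + r}) / ennreal r)"
      using eventually_gt_at_top[of 0] by eventually_elim (simp add: eq)
  qed
  show ?thesis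
  proof
    show "0 \<le> l" by fact
    show "upper_uniform_density \<Gamma> = ennreal l"
      unfolding upper_uniform_density_def by (rule tendsto_Lim[OF _ tend]) simp
    fix u assume "l < u"
    have "((\<lambda>s. D s + 1 / s) \<longlongrightarrow> l + 0) at_top"
      by (intro tendsto_add l tendsto_divide_0[OF tendsto_const] filterlim_at_top_imp_at_infinity filterlim_ident)
    then have "\<forall>\<^sub>F s in at_top. D s + 1 / s < u" using \<open>l < u\<close> by (simp add: order_tendstoD)
    then have "\<forall>\<^sub>F s in at_top. D s + 1 / s < u \<and> s > 0" using eventually_gt_at_top[of 0] by eventually_elim simp
    then obtain s where s: "D s + 1 / s < u" "s > 0" using eventually_happens by fastforce
    define K where "K = nat \<lfloor>n s + 1\<rfloor>"
    have "real K \<le> n s + 1" using n0[of s] s by (simp add: K_def)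
    also have "\<dots> = (D s + 1 / s) * s" using s by (simp add: D_def field_simps)
    also have "\<dots> < u * s" using s by (intro mult_strict_right_mono) auto
    finally have "real K < u * s" .
    moreover have "local_count_le s K \<Gamma>"
      unfolding local_count_le_def
    proof (intro allI conjI)
      fix y
      show "finite (\<Gamma> \<inter> {y..<y+s})" using half(1) s by simp
      have "real (card (\<Gamma> \<inter> {y..<y+s})) \<le> n s + 1" using half_n s by simp
      then show "card (\<Gamma> \<inter> {y..<y+s}) \<le> K" unfolding K_def by linarith
    qed
    ultimately show "\<exists>s>0. \<exists>K. local_count_le s K \<Gamma> \<and> real K < u * s" using s by blast
  next
    fix \<theta> r0 assume th: "0 \<le> \<theta>" "\<And>r y. r \<ge> r0 \<Longrightarrow> real (card (\<Gamma> \<inter> {y..<y+r})) \<le> \<theta> * r + 2"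
    have "((\<lambda>r. \<theta> + 2 / r) \<longlongrightarrow> \<theta> + 0) at_top"
      by (intro tendsto_add tendsto_const tendsto_divide_0[OF tendsto_const] filterlim_at_top_imp_at_infinity filterlim_ident)
    moreover have "\<forall>\<^sub>F r in at_top. D r \<le> \<theta> + 2 / r"
      using eventually_gt_at_top[of 0] eventually_ge_at_top[of r0]
    proof eventually_elim
      case (elim r)
      have "n r \<le> \<theta> * r + 2"
        unfolding n_def by (intro cSUP_least order_trans[OF cnt_half th(2)]) (use elim in auto)
      then show ?case using elim by (simp add: D_def field_simps)
    qed
    ultimately show "l \<le> \<theta>" using tendsto_le[OF _ _ l(2)] by fastforce
  qed
qed

section \<open>Square-integrable functions\<close>

lemma L2_measurable: "f \<in> L2 \<Longrightarrow> f \<in> borel_measurable lborel"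
  and L2_integrable: "f \<in> L2 \<Longrightarrow> integrable lborel (\<lambda>x. (cmod (f x))\<^sup>2)"
  by (auto simp: L2_def)

lemma L2_dominated:
  assumes "g \<in> borel_measurable lborel" "integrable lborel h" "\<And>x. (cmod (g x))\<^sup>2 \<le> h x"
  shows "g \<in> L2"
proof -
  note [measurable] = assms(1)
  have "integrable lborel (\<lambda>x. (cmod (g x))\<^sup>2)"
    by (rule Bochner_Integration.integrable_bound[OF assms(2)])
      (auto intro!: AE_I2 order_trans[OF assms(3) abs_ge_self])
  then show ?thesis using assms(1) by (simp add: L2_def)
qed

lemma cmod_add_sq_le: "(cmod (u + v))\<^sup>2 \<le> 2 * (cmod u)\<^sup>2 + 2 * (cmod v)\<^sup>2"
proof -
  have "(cmod (u + v))\<^sup>2 \<le> (cmod u + cmod v)\<^sup>2" by (intro power_mono norm_triangle_ineq) auto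
  then show ?thesis using sum_squares_bound[of "cmod u" "cmod v"] by (simp add: power2_sum)
qed

lemma L2_bounded_mult:
  assumes "f \<in> L2" "m \<in> borel_measurable lborel" "\<And>x. cmod (m x) \<le> B"
  shows "(\<lambda>x. m x * f x) \<in> L2" "L2_norm (\<lambda>x. m x * f x) \<le> B * L2_norm f"
proof -
  have B: "B \<ge> 0" using assms(3)[of 0] norm_ge_zero order_trans by blast
  have le: "(cmod (m x * f x))\<^sup>2 \<le> B\<^sup>2 * (cmod (f x))\<^sup>2" for x
    unfolding norm_mult power_mult_distrib using assms(3) by (intro mult_right_mono power_mono) auto
  note [measurable] = assms(2) L2_measurable[OF assms(1)]
  have I: "integrable lborel (\<lambda>x. B\<^sup>2 * (cmod (f x))\<^sup>2)" using L2_integrable[OF assms(1)] by simp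
  show m: "(\<lambda>x. m x * f x) \<in> L2"
    by (rule L2_dominated[OF _ I le]) measurable
  have "(LINT x|lborel. (cmod (m x * f x))\<^sup>2) \<le> (LINT x|lborel. B\<^sup>2 * (cmod (f x))\<^sup>2)"
    by (rule integral_mono[OF L2_integrable[OF m] I le])
  then have "L2_norm (\<lambda>x. m x * f x) \<le> sqrt (B\<^sup>2 * (LINT x|lborel. (cmod (f x))\<^sup>2))"
    unfolding L2_norm_def by (intro real_sqrt_le_mono) simp
  then show "L2_norm (\<lambda>x. m x * f x) \<le> B * L2_norm f"
    using B by (simp add: real_sqrt_mult L2_norm_def)
qed

lemma L2_scale: "f \<in> L2 \<Longrightarrow> (\<lambda>x. c * f x) \<in> L2"
  using L2_bounded_mult(1)[of f "\<lambda>_. c" "cmod c"] by simp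

lemma L2_add:
  assumes "f \<in> L2" "g \<in> L2"
  shows "(\<lambda>x. f x + g x) \<in> L2"
proof (rule L2_dominated[OF _ _ cmod_add_sq_le])
  note [measurable] = L2_measurable[OF assms(1)] L2_measurable[OF assms(2)]
  show "(\<lambda>x. f x + g x) \<in> borel_measurable lborel" by measurable
  show "integrable lborel (\<lambda>x. 2 * (cmod (f x))\<^sup>2 + 2 * (cmod (g x))\<^sup>2)"
    using assms by (auto intro!: L2_integrable)
qed

lemma L2_zero: "(\<lambda>x. 0) \<in> L2"
  by (simp add: L2_def)

lemma L2_diff: "f \<in> L2 \<Longrightarrow> g \<in> L2 \<Longrightarrow> (\<lambda>x. f x - g x) \<in> L2"
  using L2_add[of f "\<lambda>x. (-1) * g x"] L2_scale[of g "-1"] by simp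

lemma L2_sum: "(\<And>i. i \<in> I \<Longrightarrow> f i \<in> L2) \<Longrightarrow> (\<lambda>x. \<Sum>i\<in>I. f i x) \<in> L2"
  by (induction I rule: infinite_finite_induct) (auto intro: L2_add L2_zero)

lemma cnj_measurable: "h \<in> borel_measurable M \<Longrightarrow> (\<lambda>x. cnj (h x)) \<in> borel_measurable M"
  using borel_measurable_continuous_on[of cnj h M] continuous_on_cnj[OF continuous_on_id, of UNIV] by simp

lemma L2_cnj: "f \<in> L2 \<Longrightarrow> (\<lambda>x. cnj (f x)) \<in> L2"
  using cnj_measurable[of f lborel] by (simp add: L2_def)

lemma L2_norm_nonneg [simp]: "0 \<le> L2_norm f"
  by (simp add: L2_norm_def)

lemma L2_norm_sq: "(L2_norm f)\<^sup>2 = (LINT x|lborel. (cmod (f x))\<^sup>2)"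
  by (simp add: L2_norm_def)

lemma L2_norm_cong: "(\<And>x. cmod (f x) = cmod (g x)) \<Longrightarrow> L2_norm f = L2_norm g"
  by (simp add: L2_norm_def)

lemma L2_mult_integrable:
  assumes "f \<in> L2" "g \<in> L2"
  shows "integrable lborel (\<lambda>x. f x * g x)"
proof (rule Bochner_Integration.integrable_bound)
  note [measurable] = L2_measurable[OF assms(1)] L2_measurable[OF assms(2)]
  show "integrable lborel (\<lambda>x. (cmod (f x))\<^sup>2 + (cmod (g x))\<^sup>2)"
    using assms by (auto intro!: L2_integrable)
  show "(\<lambda>x. f x * g x) \<in> borel_measurable lborel" by measurable
  show "AE x in lborel. cmod (f x * g x) \<le> norm ((cmod (f x))\<^sup>2 + (cmod (g x))\<^sup>2)"
  proof (intro AE_I2)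
    fix x
    have "2 * (cmod (f x) * cmod (g x)) \<le> (cmod (f x))\<^sup>2 + (cmod (g x))\<^sup>2"
      using sum_squares_bound[of "cmod (f x)" "cmod (g x)"] by simp
    moreover have "0 \<le> cmod (f x) * cmod (g x)" by simp
    ultimately show "cmod (f x * g x) \<le> norm ((cmod (f x))\<^sup>2 + (cmod (g x))\<^sup>2)"
      by (simp only: norm_mult real_norm_def)
  qed
qed

lemma L2_cauchy_schwarz:
  assumes f: "f \<in> L2" and g: "g \<in> L2"
  shows "cmod (LINT x|lborel. f x * cnj (g x)) \<le> L2_norm f * L2_norm g"
proof -
  let ?I = "LINT x|lborel. f x * cnj (g x)"
  have i3: "integrable lborel (\<lambda>x. f x * cnj (g x))" by (rule L2_mult_integrable[OF f L2_cnj[OF g]])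
  have "(cmod ?I)\<^sup>2 \<le> (LINT x|lborel. (cmod (f x))\<^sup>2) * (LINT x|lborel. (cmod (g x))\<^sup>2)"
  proof (rule cauchy_schwarz_from_quadratic)
    fix z
    have "0 \<le> (LINT x|lborel. (cmod (f x - z * g x))\<^sup>2)" by (intro integral_nonneg_AE) auto
    also have "\<dots> = (LINT x|lborel. (cmod (f x))\<^sup>2 - 2 * Re (cnj z * (f x * cnj (g x))) + (cmod z)\<^sup>2 * (cmod (g x))\<^sup>2)"
      by (simp only: cmod_diff_mult_sq)
    also have "\<dots> = (LINT x|lborel. (cmod (f x))\<^sup>2) - 2 * (LINT x|lborel. Re (cnj z * (f x * cnj (g x)))) + (cmod z)\<^sup>2 * (LINT x|lborel. (cmod (g x))\<^sup>2)"
      using L2_integrable[OF f] L2_integrable[OF g] integrable_Re[OF integrable_mult_right[OF i3, of "cnj z"]]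
      by (simp del: complex_cnj_mult times_complex.sel)
    also have "(LINT x|lborel. Re (cnj z * (f x * cnj (g x)))) = Re (cnj z * ?I)"
      using i3 by (simp only: integral_Re[OF integrable_mult_right] integral_mult_right_zero)
    finally show "0 \<le> (LINT x|lborel. (cmod (f x))\<^sup>2) - 2 * Re (cnj z * ?I) + (cmod z)\<^sup>2 * (LINT x|lborel. (cmod (g x))\<^sup>2)" .
  qed (auto intro!: integral_nonneg_AE)
  then have "(cmod ?I)\<^sup>2 \<le> (L2_norm f * L2_norm g)\<^sup>2" by (simp add: power_mult_distrib L2_norm_sq)
  then show ?thesis by (rule power2_le_imp_le) simp
qed

lemma L2_norm_triangle:
  assumes f: "f \<in> L2" and g: "g \<in> L2"
  shows "L2_norm (\<lambda>x. f x + g x) \<le> L2_norm f + L2_norm g"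
proof (rule power2_le_imp_le)
  have i3: "integrable lborel (\<lambda>x. f x * cnj (g x))" by (rule L2_mult_integrable[OF f L2_cnj[OF g]])
  have "(L2_norm (\<lambda>x. f x + g x))\<^sup>2 = (LINT x|lborel. (cmod (f x))\<^sup>2 + 2 * Re (f x * cnj (g x)) + (cmod (g x))\<^sup>2)"
    unfolding L2_norm_sq
    by (intro Bochner_Integration.integral_cong refl) (simp only: cmod_power2, simp add: power2_eq_square algebra_simps)
  also have "\<dots> = (L2_norm f)\<^sup>2 + 2 * Re (LINT x|lborel. f x * cnj (g x)) + (L2_norm g)\<^sup>2"
    unfolding L2_norm_sq integral_Re[OF i3, symmetric]
    using L2_integrable[OF f] L2_integrable[OF g] integrable_Re[OF i3] by (simp del: times_complex.sel)
  also have "\<dots> \<le> (L2_norm f)\<^sup>2 + 2 * (L2_norm f * L2_norm g) + (L2_norm g)\<^sup>2"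
    using order_trans[OF complex_Re_le_cmod L2_cauchy_schwarz[OF f g]] by simp
  finally show "(L2_norm (\<lambda>x. f x + g x))\<^sup>2 \<le> (L2_norm f + L2_norm g)\<^sup>2"
    by (simp add: power2_sum)
qed simp

lemma L2_norm_diff_triangle:
  assumes "f \<in> L2" "g \<in> L2" "h \<in> L2"
  shows "L2_norm (\<lambda>x. f x - h x) \<le> L2_norm (\<lambda>x. f x - g x) + L2_norm (\<lambda>x. g x - h x)"
  using L2_norm_triangle[OF L2_diff[OF assms(1,2)] L2_diff[OF assms(2,3)]] by simp

lemma L2_norm_minus_commute: "L2_norm (\<lambda>x. f x - g x) = L2_norm (\<lambda>x. g x - f x)"
  by (intro L2_norm_cong norm_minus_commute)

lemma L2_norm_scale: "L2_norm (\<lambda>x. c * f x) = cmod c * L2_norm f"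
  by (simp add: L2_norm_def norm_mult power_mult_distrib real_sqrt_mult)

lemma L2_norm_diff_abs:
  assumes f: "f \<in> L2" and g: "g \<in> L2"
  shows "\<bar>L2_norm f - L2_norm g\<bar> \<le> L2_norm (\<lambda>x. f x - g x)"
  using L2_norm_triangle[OF L2_diff[OF f g] g] L2_norm_triangle[OF L2_diff[OF g f] f]
    L2_norm_minus_commute[of f g] by simp

lemma L2_norm_sum_le:
  assumes "finite I" "\<And>i. i \<in> I \<Longrightarrow> f i \<in> L2"
  shows "L2_norm (\<lambda>x. \<Sum>i\<in>I. f i x) \<le> (\<Sum>i\<in>I. L2_norm (f i))"
  using assms
proof (induction I)
  case (insert i I)
  have "L2_norm (\<lambda>x. f i x + (\<Sum>i\<in>I. f i x)) \<le> L2_norm (f i) + L2_norm (\<lambda>x. \<Sum>i\<in>I. f i x)"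
    using insert by (intro L2_norm_triangle L2_sum) auto
  then show ?case using insert by simp
qed (simp add: L2_norm_def)

lemma L2_tendsto_norm:
  assumes "L2_tendsto f F net"
  shows "((\<lambda>i. L2_norm (f i)) \<longlongrightarrow> L2_norm F) net"
proof -
  have F: "F \<in> L2" and f: "\<forall>\<^sub>F i in net. f i \<in> L2" and lim: "((\<lambda>i. L2_norm (\<lambda>x. f i x - F x)) \<longlongrightarrow> 0) net"
    using assms by (auto simp: L2_tendsto_def)
  have "((\<lambda>i. L2_norm (f i) - L2_norm F) \<longlongrightarrow> 0) net"
    by (rule Lim_null_comparison[OF _ lim]) (use f in eventually_elim, simp add: L2_norm_diff_abs F)
  then show ?thesis by (rule LIM_zero_cancel)
qed

lemma L2_shift:
  assumes f: "f \<in> L2"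
  shows "(\<lambda>x. f (x - g)) \<in> L2" "L2_norm (\<lambda>x. f (x - g)) = L2_norm f"
proof -
  note [measurable] = L2_measurable[OF f]
  have m: "(\<lambda>x. f (x - g)) \<in> borel_measurable lborel" by measurable
  show "(\<lambda>x. f (x - g)) \<in> L2"
    unfolding L2_def using m lborel_integrable_real_affine[OF L2_integrable[OF f], of 1 "-g"] by simp
  show "L2_norm (\<lambda>x. f (x - g)) = L2_norm f"
    using lborel_integral_real_affine[of 1 "\<lambda>x. (cmod (f x))\<^sup>2" "-g"] by (simp add: L2_norm_def)
qed

lemma std_normal_density_L2: "(\<lambda>x. complex_of_real (std_normal_density x)) \<in> L2"
proof (rule L2_dominated)
  show "integrable lborel std_normal_density"
    using integrable_std_normal_moment[of 0] by simp
  fix x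
  have "sqrt (2 * pi) \<ge> 1" using pi_ge_two by (intro real_le_rsqrt) auto
  then have "std_normal_density x \<le> 1"
    unfolding std_normal_density_def by (intro mult_le_one) auto
  then show "(cmod (complex_of_real (std_normal_density x)))\<^sup>2 \<le> std_normal_density x"
    using power_decreasing[of 1 2 "std_normal_density x"] by (simp del: power2_eq_square)
qed auto

text \<open>
  Multiplication by the Gaussian density turns an \<open>L\<^sup>2\<close> Cauchy sequence into an \<open>L\<^sup>1\<close> Cauchy
  sequence without losing information about pointwise convergence, so a subsequence converges
  almost everywhere.  Fatou's lemma upgrades this to convergence in \<open>L\<^sup>2\<close>.
\<close>

lemma L2_complete:
  assumes f: "\<And>n. f n \<in> L2"
    and cauchy: "\<And>e. e > 0 \<Longrightarrow> \<exists>N. \<forall>i\<ge>N. \<forall>j\<ge>N. L2_norm (\<lambda>x. f i x - f j x) < e"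
  obtains F :: "real \<Rightarrow> complex" where "F \<in> L2" "(\<lambda>n. L2_norm (\<lambda>x. f n x - F x)) \<longlonglongrightarrow> 0"
proof -
  note [measurable] = L2_measurable[OF f]
  let ?N = "\<lambda>x. complex_of_real (std_normal_density x)"
  define s where "s n x = ?N x * f n x" for n x
  have sI: "integrable lborel (s n)" for n
    unfolding s_def by (rule L2_mult_integrable[OF std_normal_density_L2 f])
  have "\<exists>N. \<forall>i\<ge>N. \<forall>j\<ge>N. (LINT x|lborel. norm (s i x - s j x)) < e" if e: "e > 0" for e
  proof -
    \<comment> \<open>The summand \<open>1\<close> only makes \<open>K\<close> positive.\<close>
    define K where "K = L2_norm ?N + 1"
    have K: "K > 0" by (simp add: K_def add_nonneg_pos)
    obtain N where N: "\<And>i j. i \<ge> N \<Longrightarrow> j \<ge> N \<Longrightarrow> L2_norm (\<lambda>x. f i x - f j x) < e / K"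
      using cauchy[of "e / K"] e K by auto
    have "(LINT x|lborel. norm (s i x - s j x)) < e" if ij: "i \<ge> N" "j \<ge> N" for i j
    proof -
      let ?g = "\<lambda>x. complex_of_real (cmod (f i x - f j x))"
      have g: "?g \<in> L2" using L2_diff[OF f[of i] f[of j]] by (auto simp: L2_def)
      have "complex_of_real (LINT x|lborel. norm (s i x - s j x)) = (LINT x|lborel. ?N x * cnj (?g x))"
        unfolding integral_complex_of_real[symmetric]
        by (intro Bochner_Integration.integral_cong refl)
          (simp add: s_def norm_mult flip: right_diff_distrib)
      then have "\<bar>LINT x|lborel. norm (s i x - s j x)\<bar> = cmod (LINT x|lborel. ?N x * cnj (?g x))"
        by (metis norm_of_real)
      also have "\<dots> \<le> L2_norm ?N * L2_norm ?g" by (rule L2_cauchy_schwarz[OF std_normal_density_L2 g])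
      also have "L2_norm ?g = L2_norm (\<lambda>x. f i x - f j x)" by (rule L2_norm_cong) simp
      also have "L2_norm ?N * L2_norm (\<lambda>x. f i x - f j x) \<le> K * L2_norm (\<lambda>x. f i x - f j x)"
        unfolding K_def by (intro mult_right_mono) auto
      also have "\<dots> < K * (e / K)" using N[OF ij] K by (intro mult_strict_left_mono) auto
      finally show ?thesis using K by simp
    qed
    then show ?thesis by blast
  qed
  from cauchy_L1_AE_cauchy_subseq[OF sI this] obtain r where r: "strict_mono r"
    "AE x in lborel. Cauchy (\<lambda>i. s (r i) x)" by blast
  define F where "F x = lim (\<lambda>i. f (r i) x)" for x
  have Fm [measurable]: "F \<in> borel_measurable lborel"
    unfolding F_def by (rule borel_measurable_lim_metric) simp
  have ae: "AE x in lborel. (\<lambda>i. f (r i) x) \<longlonglongrightarrow> F x"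
    using r(2)
  proof eventually_elim
    case (elim x)
    have nz: "?N x \<noteq> 0" using normal_density_pos[of 1 0 x] by simp
    obtain l where "(\<lambda>i. s (r i) x) \<longlonglongrightarrow> l" using elim Cauchy_convergent convergent_def by blast
    then have "(\<lambda>i. s (r i) x / ?N x) \<longlonglongrightarrow> l / ?N x" by (intro tendsto_divide tendsto_const nz)
    then have "(\<lambda>i. f (r i) x) \<longlonglongrightarrow> l / ?N x" using nz by (simp add: s_def)
    then show ?case unfolding F_def by (metis limI)
  qed
  have key: "(\<lambda>x. f n x - F x) \<in> L2 \<and> L2_norm (\<lambda>x. f n x - F x) \<le> e"
    if e: "e > 0" and n: "\<And>j. j \<ge> N \<Longrightarrow> L2_norm (\<lambda>x. f n x - f j x) \<le> e" for e n N
  proof -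
    have "(\<integral>\<^sup>+x. ennreal ((cmod (f n x - F x))\<^sup>2) \<partial>lborel) = (\<integral>\<^sup>+x. liminf (\<lambda>i. ennreal ((cmod (f n x - f (r i) x))\<^sup>2)) \<partial>lborel)"
    proof (rule nn_integral_cong_AE)
      show "AE x in lborel. ennreal ((cmod (f n x - F x))\<^sup>2) = liminf (\<lambda>i. ennreal ((cmod (f n x - f (r i) x))\<^sup>2))"
        using ae
      proof eventually_elim
        case (elim x)
        have "(\<lambda>i. ennreal ((cmod (f n x - f (r i) x))\<^sup>2)) \<longlonglongrightarrow> ennreal ((cmod (f n x - F x))\<^sup>2)"
          by (intro tendsto_ennrealI tendsto_intros elim)
        then show ?case by (metis lim_imp_Liminf trivial_limit_sequentially)
      qed
    qed
    also have "\<dots> \<le> liminf (\<lambda>i. \<integral>\<^sup>+x. ennreal ((cmod (f n x - f (r i) x))\<^sup>2) \<partial>lborel)"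
      by (rule nn_integral_liminf) measurable
    also have "\<dots> \<le> ennreal (e\<^sup>2)"
    proof (rule Liminf_le)
      show "\<forall>\<^sub>F i in sequentially. (\<integral>\<^sup>+x. ennreal ((cmod (f n x - f (r i) x))\<^sup>2) \<partial>lborel) \<le> ennreal (e\<^sup>2)"
        using eventually_ge_at_top[of N]
      proof eventually_elim
        case (elim i)
        have "(\<integral>\<^sup>+x. ennreal ((cmod (f n x - f (r i) x))\<^sup>2) \<partial>lborel) = ennreal ((L2_norm (\<lambda>x. f n x - f (r i) x))\<^sup>2)"
          unfolding L2_norm_sq by (intro nn_integral_eq_integral L2_integrable L2_diff f) auto
        also have "\<dots> \<le> ennreal (e\<^sup>2)"
          using n[of "r i"] seq_suble[OF r(1), of i] elim by (intro ennreal_leI power_mono) auto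
        finally show ?case .
      qed
    qed simp
    finally have le: "(\<integral>\<^sup>+x. ennreal ((cmod (f n x - F x))\<^sup>2) \<partial>lborel) \<le> ennreal (e\<^sup>2)" .
    have I: "integrable lborel (\<lambda>x. (cmod (f n x - F x))\<^sup>2)"
      by (rule integrableI_bounded) (use le in \<open>auto intro: le_less_trans\<close>)
    have "(L2_norm (\<lambda>x. f n x - F x))\<^sup>2 \<le> e\<^sup>2"
      unfolding L2_norm_sq using le nn_integral_eq_integral[OF I] by (simp add: ennreal_le_iff)
    then have "L2_norm (\<lambda>x. f n x - F x) \<le> e" by (rule power2_le_imp_le) (use e in simp)
    then show ?thesis using I by (auto simp: L2_def)
  qed
  have ev: "\<exists>N. \<forall>n\<ge>N. (\<lambda>x. f n x - F x) \<in> L2 \<and> L2_norm (\<lambda>x. f n x - F x) \<le> e" if e: "e > 0" for e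
  proof -
    obtain N where "\<forall>i\<ge>N. \<forall>j\<ge>N. L2_norm (\<lambda>x. f i x - f j x) < e" using cauchy[OF e] by blast
    then show ?thesis using key[OF e, of N] by (meson less_imp_le)
  qed
  obtain n where "(\<lambda>x. f n x - F x) \<in> L2" using ev[of 1] by auto
  from L2_diff[OF f[of n] this] have "F \<in> L2" by simp
  moreover have "(\<lambda>n. L2_norm (\<lambda>x. f n x - F x)) \<longlonglongrightarrow> 0"
  proof (rule LIMSEQ_I)
    fix e :: real assume "e > 0"
    then obtain N where "\<forall>n\<ge>N. L2_norm (\<lambda>x. f n x - F x) \<le> e / 2" using ev[of "e/2"] by auto
    then show "\<exists>N. \<forall>n\<ge>N. norm (L2_norm (\<lambda>x. f n x - F x) - 0) < e"
      using \<open>e > 0\<close> by (intro exI[of _ N]) (auto intro: le_less_trans)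
  qed
  ultimately show ?thesis using that by blast
qed

section \<open>The Plancherel theorem\<close>

lemma ee_conv_exp: "ee (- (x * t)) = exp (- (2 * of_real pi * \<i> * of_real x * of_real t))"
  by (simp add: ee_def cis_conv_exp mult_ac)

lemma fourier_ee: "fourier f x = (LINT t|lborel. ee (- (x * t)) * f t)"
  unfolding fourier_def ee_conv_exp ..

lemma ee_measurable [measurable]: "ee \<in> borel_measurable borel"
  by (intro borel_measurable_continuous_onI continuous_intros)

lemma integrable_ee_mult:
  assumes "integrable lborel f" and [measurable]: "g \<in> borel_measurable lborel"
  shows "integrable lborel (\<lambda>t. ee (g t) * f t)"
proof (rule Bochner_Integration.integrable_bound[OF assms(1)])
  note [measurable] = borel_measurable_integrable[OF assms(1)]
  show "(\<lambda>t. ee (g t) * f t) \<in> borel_measurable lborel" by measurable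
qed (auto simp: norm_mult)

lemma fourier_measurable:
  assumes "integrable lborel f"
  shows "fourier f \<in> borel_measurable lborel"
proof -
  note [measurable] = borel_measurable_integrable[OF assms]
  show ?thesis unfolding fourier_ee[abs_def] by measurable
qed

lemma fourier_bound:
  assumes "integrable lborel f"
  shows "cmod (fourier f x) \<le> (LINT t|lborel. cmod (f t))"
proof -
  have "cmod (fourier f x) \<le> (LINT t|lborel. cmod (ee (- (x * t)) * f t))"
    unfolding fourier_ee by (rule integral_norm_bound)
  then show ?thesis by (simp add: norm_mult)
qed

lemma integrable_product:
  fixes f h :: "real \<Rightarrow> complex"
  assumes f: "integrable lborel f" and h: "integrable lborel h"
  shows "integrable (lborel \<Otimes>\<^sub>M lborel) (\<lambda>(x, y). f x * h y)"
proof -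
  note [measurable] = borel_measurable_integrable[OF f] borel_measurable_integrable[OF h]
  show ?thesis
  proof (rule lborel_pair.Fubini_integrable)
    show "integrable lborel (\<lambda>x. LINT y|lborel. norm (case (x, y) of (x, y) \<Rightarrow> f x * h y))"
      using f by (simp add: norm_mult)
    show "AE x in lborel. integrable lborel (\<lambda>y. case (x, y) of (x, y) \<Rightarrow> f x * h y)"
      using h by simp
  qed measurable
qed

text \<open>
  Fubini for the kernel \<open>e(-xt)\<close>, which is symmetric in \<open>x\<close> and \<open>t\<close>.
\<close>

lemma fourier_multiplication:
  assumes f: "integrable lborel f" and h: "integrable lborel h"
  shows "(LINT x|lborel. fourier f x * h x) = (LINT x|lborel. f x * fourier h x)"
proof -
  note [measurable] = borel_measurable_integrable[OF f] borel_measurable_integrable[OF h]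
  let ?k = "\<lambda>x t. ee (- (x * t)) * (f t * h x)"
  have I: "integrable (lborel \<Otimes>\<^sub>M lborel) (case_prod ?k)"
  proof (rule Bochner_Integration.integrable_bound[OF integrable_product[OF h f]])
    show "case_prod ?k \<in> borel_measurable (lborel \<Otimes>\<^sub>M lborel)" by measurable
  qed (auto simp: norm_mult)
  have "(LINT x|lborel. fourier f x * h x) = (LINT x|lborel. LINT t|lborel. ?k x t)"
    unfolding fourier_ee
    by (intro Bochner_Integration.integral_cong refl, subst integral_mult_left_zero[symmetric]) (simp only: mult.assoc)
  also have "\<dots> = (LINT t|lborel. LINT x|lborel. ?k x t)"
    using lborel_pair.Fubini_integral[OF I] by simp
  also have "\<dots> = (LINT t|lborel. f t * fourier h t)"
    unfolding fourier_ee
    by (intro Bochner_Integration.integral_cong refl, subst integral_mult_right_zero[symmetric]) (simp add: mult_ac)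
  finally show ?thesis .
qed

text \<open>
  The parameter is scaled so that the transform of the weight is the standard normal density
  dilated by \<open>c\<close>, a probability density concentrating at \<open>0\<close> as \<open>c\<close> grows.
\<close>

definition gweight :: "real \<Rightarrow> real \<Rightarrow> real" where
  "gweight c x = exp (- (2 * pi * x / c)\<^sup>2 / 2)"

definition gkernel :: "real \<Rightarrow> real \<Rightarrow> real" where
  "gkernel c u = c * std_normal_density (c * u)"

lemma std_normal_integrable: "integrable lborel std_normal_density"
  and std_normal_integral: "(LINT x|lborel. std_normal_density x) = 1"
  using integrable_std_normal_moment[of 0] integral_std_normal_moment_even[of 0] by simp_all

lemma gkernel_nonneg: "c > 0 \<Longrightarrow> 0 \<le> gkernel c u"
  by (simp add: gkernel_def)

lemma gkernel_even: "gkernel c (- u) = gkernel c u"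
  by (simp add: gkernel_def std_normal_density_def)

lemma gkernel_measurable [measurable]: "gkernel c \<in> borel_measurable borel"
  unfolding gkernel_def[abs_def] by measurable

lemma gweight_measurable [measurable]: "gweight c \<in> borel_measurable borel"
  unfolding gweight_def[abs_def] by measurable

lemma gweight_bounds: "0 \<le> gweight c x" "gweight c x \<le> 1"
  by (simp_all add: gweight_def)

lemma gweight_conv_density:
  "gweight c x = sqrt (2 * pi) * std_normal_density (0 + (2 * pi / c) * x)"
  by (simp add: gweight_def std_normal_density_def)

lemma gweight_integrable_real: "c > 0 \<Longrightarrow> integrable lborel (gweight c)"
  unfolding gweight_conv_density[abs_def]
  by (intro integrable_mult_right lborel_integrable_real_affine std_normal_integrable) simp

lemma gweight_integrable: "c > 0 \<Longrightarrow> integrable lborel (\<lambda>x. complex_of_real (gweight c x))"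
  by (intro integrable_of_real gweight_integrable_real)

lemma fourier_gweight:
  assumes c: "c > 0"
  shows "(LINT x|lborel. complex_of_real (gweight c x) * ee (u * x)) = of_real (gkernel c u)"
proof -
  define k where "k = 2 * pi / c"
  have k: "k > 0" using c by (simp add: k_def)
  define t where "t = c * u"
  have "(LINT x|std_normal_distribution. iexp (t * x)) = complex_of_real (exp (- (t^2) / 2))"
    using char_std_normal_distribution unfolding char_def by metis
  then have "(LINT x|lborel. std_normal_density x *\<^sub>R iexp (t * x)) = complex_of_real (exp (- (t^2) / 2))"
    by (subst (asm) integral_density) (auto simp: normal_density_nonneg)
  also have "(LINT x|lborel. std_normal_density x *\<^sub>R iexp (t * x))
     = \<bar>k\<bar> *\<^sub>R (LINT x|lborel. std_normal_density (0 + k * x) *\<^sub>R iexp (t * (0 + k * x)))"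
    using k by (intro lborel_integral_real_affine) simp
  also have "(\<lambda>x. iexp (t * (0 + k * x))) = (\<lambda>x. ee (u * x))"
    using c by (auto simp: ee_def cis_conv_exp t_def k_def fun_eq_iff mult_ac)
  finally have e: "\<bar>k\<bar> *\<^sub>R (LINT x|lborel. std_normal_density (0 + k * x) *\<^sub>R ee (u * x)) = complex_of_real (exp (- (t^2) / 2))"
    by (metis (no_types, lifting) Bochner_Integration.integral_cong)
  have "(LINT x|lborel. complex_of_real (gweight c x) * ee (u * x))
      = of_real (sqrt (2 * pi)) * (LINT x|lborel. std_normal_density (0 + k * x) *\<^sub>R ee (u * x))"
    unfolding gweight_conv_density k_def[symmetric]
    by (subst integral_mult_right_zero[symmetric]) (simp add: scaleR_conv_of_real mult.assoc)
  also have "\<dots> = of_real (sqrt (2 * pi) / k) * (\<bar>k\<bar> *\<^sub>R (LINT x|lborel. std_normal_density (0 + k * x) *\<^sub>R ee (u * x)))"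
    using k by (simp add: scaleR_conv_of_real)
  also have "\<dots> = of_real (sqrt (2 * pi) / k * exp (- (t^2) / 2))"
    unfolding e by simp
  also have "sqrt (2 * pi) / k * exp (- (t^2) / 2) = gkernel c u"
    using c by (simp add: gkernel_def k_def t_def std_normal_density_def field_simps real_div_sqrt)
  finally show ?thesis .
qed

lemma gkernel_nn_integral:
  assumes c: "c > 0"
  shows "(\<integral>\<^sup>+y. ennreal (gkernel c (y - x)) \<partial>lborel) = 1"
proof -
  have "1 = (\<integral>\<^sup>+y. ennreal (std_normal_density y) \<partial>lborel)"
    using nn_integral_eq_integral[OF std_normal_integrable] std_normal_integral by simp
  also have "\<dots> = ennreal \<bar>c\<bar> * (\<integral>\<^sup>+y. ennreal (std_normal_density (- (c * x) + c * y)) \<partial>lborel)"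
    using c by (intro nn_integral_real_affine) auto
  also have "\<dots> = (\<integral>\<^sup>+y. ennreal (gkernel c (y - x)) \<partial>lborel)"
    using c by (subst nn_integral_cmult[symmetric]) (auto simp: gkernel_def ennreal_mult algebra_simps)
  finally show ?thesis ..
qed

definition gsmooth :: "real \<Rightarrow> (real \<Rightarrow> complex) \<Rightarrow> real \<Rightarrow> complex" where
  "gsmooth c g x = (LINT y|lborel. g y * of_real (gkernel c (y - x)))"

text \<open>
  Parseval's identity regularised by a Gaussian; the multiplication formula is used twice.
\<close>

lemma fourier_pairing:
  assumes f: "integrable lborel f" and g: "integrable lborel g" and c: "c > 0"
  shows "(LINT x|lborel. fourier f x * cnj (fourier g x) * of_real (gweight c x)) = (LINT x|lborel. f x * cnj (gsmooth c g x))"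
proof -
  note [measurable] = fourier_measurable[OF g]
  have cm [measurable]: "(\<lambda>x. cnj (fourier g x)) \<in> borel_measurable lborel"
    by (rule cnj_measurable) (rule fourier_measurable[OF g])
  define B where "B = (LINT t|lborel. cmod (g t))"
  define h where "h x = cnj (fourier g x) * of_real (gweight c x)" for x
  have h: "integrable lborel h"
  proof (rule Bochner_Integration.integrable_bound)
    show "integrable lborel (\<lambda>x. complex_of_real B * of_real (gweight c x))"
      using gweight_integrable[OF c] by simp
    show "AE x in lborel. cmod (h x) \<le> cmod (complex_of_real B * of_real (gweight c x))"
      using fourier_bound[OF g] unfolding h_def norm_mult complex_mod_cnj B_def
      by (intro AE_I2 mult_right_mono) (auto intro: order_trans[OF _ abs_ge_self])
    show "h \<in> borel_measurable lborel" unfolding h_def[abs_def] by measurable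
  qed
  have "fourier h x = cnj (gsmooth c g x)" for x
  proof -
    define h2 where "h2 t = complex_of_real (gweight c t) * ee (x * t)" for t
    have h2: "integrable lborel h2"
      using integrable_ee_mult[OF gweight_integrable[OF c], of "\<lambda>t. x * t"] by (simp add: h2_def[abs_def] mult.commute)
    have "cnj (fourier h x) = (LINT t|lborel. cnj (ee (- (x * t)) * h t))"
      unfolding fourier_ee by (rule Bochner_Integration.integral_cnj[symmetric])
    also have "\<dots> = (LINT t|lborel. fourier g t * h2 t)"
      by (simp add: h_def h2_def cnj_ee mult_ac)
    also have "\<dots> = (LINT y|lborel. g y * fourier h2 y)" by (rule fourier_multiplication[OF g h2])
    also have "\<dots> = gsmooth c g x"
    proof -
      have "fourier h2 y = of_real (gkernel c (y - x))" for y
      proof -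
        have e: "ee (- (y * t)) * ee (x * t) = ee ((x - y) * t)" for t
          using ee_add[of "- (y * t)" "x * t"] by (simp add: algebra_simps)
        have "fourier h2 y = (LINT t|lborel. complex_of_real (gweight c t) * ee ((x - y) * t))"
          unfolding fourier_ee h2_def
          by (intro Bochner_Integration.integral_cong refl, subst e[symmetric]) (simp only: mult_ac)
        also have "\<dots> = of_real (gkernel c (y - x))"
          using fourier_gweight[OF c, of "x - y"] gkernel_even[of c "y - x"] by simp
        finally show ?thesis .
      qed
      then show ?thesis by (simp add: gsmooth_def)
    qed
    finally show ?thesis by (metis complex_cnj_cnj)
  qed
  with fourier_multiplication[OF f h] show ?thesis by (simp add: h_def mult.assoc)
qed

lemma norm_integral_le_nn:
  fixes f :: "real \<Rightarrow> complex"
  shows "ennreal (cmod (LINT x|lborel. f x)) \<le> (\<integral>\<^sup>+x. cmod (f x) \<partial>lborel)"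
  by (cases "integrable lborel f") (auto simp: integral_norm_bound_ennreal not_integrable_integral_eq)

text \<open>
  Bounding \<open>|f(x) f(y)|\<close> by the mean of the squares reduces the double integral to the mass \<open>1\<close> of
  the kernel.
\<close>

lemma gsmooth_pairing_le:
  assumes f: "integrable lborel f" "f \<in> L2" and c: "c > 0"
  shows "cmod (LINT x|lborel. f x * cnj (gsmooth c f x)) \<le> (L2_norm f)\<^sup>2"
proof -
  note [measurable] = borel_measurable_integrable[OF f(1)]
  let ?q = "\<lambda>x. ennreal ((cmod (f x))\<^sup>2 / 2)"
  let ?k = "\<lambda>x y. ennreal (gkernel c (y - x))"
  have S: "(\<integral>\<^sup>+x. ennreal ((cmod (f x))\<^sup>2) \<partial>lborel) = ennreal ((L2_norm f)\<^sup>2)"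
    unfolding L2_norm_sq by (intro nn_integral_eq_integral L2_integrable f) auto
  have "ennreal (cmod (LINT x|lborel. f x * cnj (gsmooth c f x))) \<le> (\<integral>\<^sup>+x. cmod (f x * cnj (gsmooth c f x)) \<partial>lborel)"
    by (rule norm_integral_le_nn)
  also have "\<dots> \<le> (\<integral>\<^sup>+x. ennreal (cmod (f x)) * (\<integral>\<^sup>+y. cmod (f y * of_real (gkernel c (y - x))) \<partial>lborel) \<partial>lborel)"
  proof (intro nn_integral_mono)
    fix x
    have "ennreal (cmod (f x * cnj (gsmooth c f x))) = ennreal (cmod (f x)) * ennreal (cmod (gsmooth c f x))"
      by (simp add: norm_mult ennreal_mult)
    also have "\<dots> \<le> ennreal (cmod (f x)) * (\<integral>\<^sup>+y. cmod (f y * of_real (gkernel c (y - x))) \<partial>lborel)"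
      unfolding gsmooth_def by (intro mult_left_mono norm_integral_le_nn) simp
    finally show "ennreal (cmod (f x * cnj (gsmooth c f x))) \<le> ennreal (cmod (f x)) * (\<integral>\<^sup>+y. cmod (f y * of_real (gkernel c (y - x))) \<partial>lborel)" .
  qed
  also have "\<dots> \<le> (\<integral>\<^sup>+x. (\<integral>\<^sup>+y. (?q x * ?k x y + ?q y * ?k x y) \<partial>lborel) \<partial>lborel)"
  proof (intro nn_integral_mono)
    fix x
    have "ennreal (cmod (f x)) * (\<integral>\<^sup>+y. cmod (f y * of_real (gkernel c (y - x))) \<partial>lborel)
        = (\<integral>\<^sup>+y. ennreal (cmod (f x) * (cmod (f y) * gkernel c (y - x))) \<partial>lborel)"
      by (subst nn_integral_cmult[symmetric]) (auto simp: ennreal_mult norm_mult gkernel_nonneg[OF c])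
    also have "\<dots> \<le> (\<integral>\<^sup>+y. (?q x * ?k x y + ?q y * ?k x y) \<partial>lborel)"
    proof (intro nn_integral_mono)
      fix y
      have "cmod (f x) * cmod (f y) \<le> (cmod (f x))\<^sup>2 / 2 + (cmod (f y))\<^sup>2 / 2"
        using sum_squares_bound[of "cmod (f x)" "cmod (f y)"] by simp
      from mult_right_mono[OF this gkernel_nonneg[OF c, of "y - x"]]
      have "ennreal (cmod (f x) * (cmod (f y) * gkernel c (y - x)))
         \<le> ennreal ((cmod (f x))\<^sup>2 / 2 * gkernel c (y - x) + (cmod (f y))\<^sup>2 / 2 * gkernel c (y - x))"
        by (intro ennreal_leI) (simp add: algebra_simps)
      also have "\<dots> = ?q x * ?k x y + ?q y * ?k x y"
      proof -
        have "ennreal ((cmod (f z))\<^sup>2 / 2 * gkernel c (y - x)) = ?q z * ?k x y" for z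
          using gkernel_nonneg[OF c, of "y - x"] by (intro ennreal_mult) auto
        moreover have "0 \<le> (cmod (f z))\<^sup>2 / 2 * gkernel c (y - x)" for z
          using gkernel_nonneg[OF c, of "y - x"] by (intro mult_nonneg_nonneg) auto
        ultimately show ?thesis by (simp only: ennreal_plus)
      qed
      finally show "ennreal (cmod (f x) * (cmod (f y) * gkernel c (y - x))) \<le> ?q x * ?k x y + ?q y * ?k x y" .
    qed
    finally show "ennreal (cmod (f x)) * (\<integral>\<^sup>+y. cmod (f y * of_real (gkernel c (y - x))) \<partial>lborel)
        \<le> (\<integral>\<^sup>+y. (?q x * ?k x y + ?q y * ?k x y) \<partial>lborel)" .
  qed
  also have "\<dots> = (\<integral>\<^sup>+x. (\<integral>\<^sup>+y. ?q x * ?k x y \<partial>lborel) \<partial>lborel) + (\<integral>\<^sup>+x. (\<integral>\<^sup>+y. ?q y * ?k x y \<partial>lborel) \<partial>lborel)"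
    by (simp add: nn_integral_add)
  also have "(\<integral>\<^sup>+x. (\<integral>\<^sup>+y. ?q x * ?k x y \<partial>lborel) \<partial>lborel) = (\<integral>\<^sup>+x. ?q x \<partial>lborel)"
    by (simp add: nn_integral_cmult gkernel_nn_integral[OF c])
  also have "(\<integral>\<^sup>+x. (\<integral>\<^sup>+y. ?q y * ?k x y \<partial>lborel) \<partial>lborel) = (\<integral>\<^sup>+y. (\<integral>\<^sup>+x. ?q y * ?k x y \<partial>lborel) \<partial>lborel)"
    by (rule lborel_pair.Fubini'[symmetric]) measurable
  also have "\<dots> = (\<integral>\<^sup>+y. ?q y \<partial>lborel)"
  proof -
    have "(\<integral>\<^sup>+x. ?k x y \<partial>lborel) = 1" for y
      using gkernel_nn_integral[OF c, of y] gkernel_even[of c] by (metis (no_types, lifting) minus_diff_eq nn_integral_cong)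
    then show ?thesis by (simp add: nn_integral_cmult)
  qed
  also have "(\<integral>\<^sup>+x. ?q x \<partial>lborel) + (\<integral>\<^sup>+y. ?q y \<partial>lborel) = (\<integral>\<^sup>+x. ennreal ((cmod (f x))\<^sup>2) \<partial>lborel)"
    by (subst nn_integral_add[symmetric]) (auto simp: ennreal_plus[symmetric] simp del: ennreal_plus)
  finally show ?thesis unfolding S by (simp add: ennreal_le_iff)
qed

text \<open>
  Letting the Gaussian weight tend to \<open>1\<close> in \<open>fourier_pairing\<close>, with Fatou's lemma.
\<close>

lemma fourier_L2:
  assumes f: "integrable lborel f" "f \<in> L2"
  shows "fourier f \<in> L2" "L2_norm (fourier f) \<le> L2_norm f"
proof -
  note [measurable] = fourier_measurable[OF f(1)]
  have lim: "(\<lambda>n. ennreal ((cmod (fourier f x))\<^sup>2 * gweight (real (Suc n)) x)) \<longlonglongrightarrow> ennreal ((cmod (fourier f x))\<^sup>2)" for x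
  proof -
    have "(\<lambda>n. 2 * pi * x / real (Suc n)) \<longlonglongrightarrow> 0"
      by (intro tendsto_divide_0[OF tendsto_const] filterlim_at_top_imp_at_infinity filterlim_compose[OF filterlim_real_sequentially filterlim_Suc])
    then have "(\<lambda>n. exp (- (2 * pi * x / real (Suc n))\<^sup>2 / 2)) \<longlonglongrightarrow> exp (- 0\<^sup>2 / 2)"
      by (intro tendsto_intros) auto
    then have "(\<lambda>n. (cmod (fourier f x))\<^sup>2 * gweight (real (Suc n)) x) \<longlonglongrightarrow> (cmod (fourier f x))\<^sup>2 * 1"
      unfolding gweight_def by (intro tendsto_mult tendsto_const) simp
    then show ?thesis by (intro tendsto_ennrealI) simp
  qed
  have "(\<integral>\<^sup>+x. ennreal ((cmod (fourier f x))\<^sup>2) \<partial>lborel)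
      = (\<integral>\<^sup>+x. liminf (\<lambda>n. ennreal ((cmod (fourier f x))\<^sup>2 * gweight (real (Suc n)) x)) \<partial>lborel)"
    by (intro nn_integral_cong lim_imp_Liminf[OF trivial_limit_sequentially lim, symmetric])
  also have "\<dots> \<le> liminf (\<lambda>n. \<integral>\<^sup>+x. ennreal ((cmod (fourier f x))\<^sup>2 * gweight (real (Suc n)) x) \<partial>lborel)"
    by (rule nn_integral_liminf) measurable
  also have "\<dots> \<le> ennreal ((L2_norm f)\<^sup>2)"
  proof (rule Liminf_le)
    show "\<forall>\<^sub>F n in sequentially. (\<integral>\<^sup>+x. ennreal ((cmod (fourier f x))\<^sup>2 * gweight (real (Suc n)) x) \<partial>lborel) \<le> ennreal ((L2_norm f)\<^sup>2)"
    proof (intro always_eventually allI)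
      fix n
      let ?c = "real (Suc n)"
      let ?p = "\<lambda>x. (cmod (fourier f x))\<^sup>2 * gweight ?c x"
      define B where "B = (LINT t|lborel. cmod (f t))"
      have g: "integrable lborel (gweight ?c)"
        by (rule gweight_integrable_real) simp
      have I: "integrable lborel ?p"
      proof (rule Bochner_Integration.integrable_bound)
        show "integrable lborel (\<lambda>x. B\<^sup>2 * gweight ?c x)" using g by simp
        show "AE x in lborel. norm (?p x) \<le> norm (B\<^sup>2 * gweight ?c x)"
          using fourier_bound[OF f(1)] gweight_bounds[of ?c]
          by (auto intro!: AE_I2 mult_right_mono power_mono simp: B_def abs_mult)
      qed measurable
      have "complex_of_real (LINT x|lborel. ?p x) = (LINT x|lborel. fourier f x * cnj (fourier f x) * of_real (gweight ?c x))"
        unfolding integral_complex_of_real[symmetric] of_real_mult complex_norm_square ..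
      also have "\<dots> = (LINT x|lborel. f x * cnj (gsmooth ?c f x))" by (rule fourier_pairing[OF f(1) f(1)]) simp
      finally have "\<bar>LINT x|lborel. ?p x\<bar> = cmod (LINT x|lborel. f x * cnj (gsmooth ?c f x))"
        by (metis norm_of_real)
      then have "(LINT x|lborel. ?p x) \<le> (L2_norm f)\<^sup>2"
        using gsmooth_pairing_le[OF f, of ?c] by simp
      then show "(\<integral>\<^sup>+x. ennreal (?p x) \<partial>lborel) \<le> ennreal ((L2_norm f)\<^sup>2)"
        using nn_integral_eq_integral[OF I] gweight_bounds[of ?c] by (simp add: ennreal_leI)
    qed
  qed simp
  finally have le: "(\<integral>\<^sup>+x. ennreal ((cmod (fourier f x))\<^sup>2) \<partial>lborel) \<le> ennreal ((L2_norm f)\<^sup>2)" .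
  have I: "integrable lborel (\<lambda>x. (cmod (fourier f x))\<^sup>2)"
    by (rule integrableI_bounded) (use le in \<open>auto intro: le_less_trans\<close>)
  then show "fourier f \<in> L2" by (simp add: L2_def fourier_measurable[OF f(1), simplified])
  have "(L2_norm (fourier f))\<^sup>2 \<le> (L2_norm f)\<^sup>2"
    unfolding L2_norm_sq[of "fourier f"] using le nn_integral_eq_integral[OF I] by (simp add: ennreal_le_iff)
  then show "L2_norm (fourier f) \<le> L2_norm f" by (rule power2_le_imp_le) simp
qed

lemma gsmooth_substitution:
  assumes c: "c > 0"
  shows "gsmooth c \<psi> x = (LINT z|lborel. \<psi> (x + (1 / c) * z) * of_real (std_normal_density z))"
proof -
  have "gsmooth c \<psi> x = \<bar>1 / c\<bar> *\<^sub>R (LINT z|lborel. \<psi> (x + (1 / c) * z) * of_real (gkernel c (x + (1 / c) * z - x)))"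
    unfolding gsmooth_def using c by (intro lborel_integral_real_affine) simp
  also have "\<dots> = (LINT z|lborel. \<bar>1 / c\<bar> *\<^sub>R (\<psi> (x + (1 / c) * z) * of_real (gkernel c (x + (1 / c) * z - x))))"
    by (rule integral_scaleR_right[symmetric])
  also have "\<dots> = (LINT z|lborel. \<psi> (x + (1 / c) * z) * of_real (std_normal_density z))"
    using c by (intro Bochner_Integration.integral_cong refl) (simp add: gkernel_def scaleR_conv_of_real)
  finally show ?thesis .
qed

lemma gsmooth_limit:
  assumes cont: "continuous_on UNIV \<psi>" and bound: "\<And>x. cmod (\<psi> x) \<le> B"
  shows "(\<lambda>n. gsmooth (real (Suc n)) \<psi> x) \<longlonglongrightarrow> \<psi> x"
    and "c > 0 \<Longrightarrow> cmod (gsmooth c \<psi> x) \<le> B"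
proof -
  have [measurable]: "\<psi> \<in> borel_measurable borel" using cont by (rule borel_measurable_continuous_onI)
  have N: "integrable lborel (\<lambda>z. B * std_normal_density z)" using std_normal_integrable by simp
  have le: "cmod (\<psi> y * of_real (std_normal_density z)) \<le> B * std_normal_density z" for y z
    unfolding norm_mult using bound[of y] by (simp add: mult_right_mono)
  have "(\<lambda>n. LINT z|lborel. \<psi> (x + (1 / real (Suc n)) * z) * of_real (std_normal_density z))
      \<longlonglongrightarrow> (LINT z|lborel. \<psi> x * of_real (std_normal_density z))"
  proof (rule integral_dominated_convergence[OF _ _ N])
    show "AE z in lborel. (\<lambda>n. \<psi> (x + (1 / real (Suc n)) * z) * of_real (std_normal_density z)) \<longlonglongrightarrow> \<psi> x * of_real (std_normal_density z)"
    proof (intro AE_I2 tendsto_mult tendsto_const)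
      fix z
      have "(\<lambda>n. x + (1 / real (Suc n)) * z) \<longlonglongrightarrow> x + 0 * z"
        by (intro tendsto_intros LIMSEQ_Suc[OF lim_1_over_n])
      then have "(\<lambda>n. x + (1 / real (Suc n)) * z) \<longlonglongrightarrow> x" by simp
      moreover have "isCont \<psi> x" using cont by (simp add: continuous_on_eq_continuous_at)
      ultimately show "(\<lambda>n. \<psi> (x + (1 / real (Suc n)) * z)) \<longlonglongrightarrow> \<psi> x" by (rule isCont_tendsto_compose[rotated])
    qed
    show "AE z in lborel. cmod (\<psi> (x + (1 / real (Suc n)) * z) * of_real (std_normal_density z)) \<le> B * std_normal_density z" for n
      by (intro AE_I2 le)
  qed measurable
  moreover have "(LINT z|lborel. \<psi> x * of_real (std_normal_density z)) = \<psi> x"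
    by (simp add: std_normal_integral)
  ultimately show "(\<lambda>n. gsmooth (real (Suc n)) \<psi> x) \<longlonglongrightarrow> \<psi> x"
    by (simp only: gsmooth_substitution[OF of_nat_0_less_iff[THEN iffD2, OF zero_less_Suc]])
  assume c: "c > 0"
  have "cmod (gsmooth c \<psi> x) \<le> (LINT z|lborel. cmod (\<psi> (x + (1 / c) * z) * of_real (std_normal_density z)))"
    unfolding gsmooth_substitution[OF c] by (rule integral_norm_bound)
  also have "\<dots> \<le> (LINT z|lborel. B * std_normal_density z)"
  proof (rule integral_mono[OF _ N le])
    show "integrable lborel (\<lambda>z. cmod (\<psi> (x + (1 / c) * z) * of_real (std_normal_density z)))"
      by (rule Bochner_Integration.integrable_bound[OF N])
        (auto intro!: AE_I2 order_trans[OF _ abs_ge_self] simp: norm_mult mult_right_mono bound)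
  qed
  finally show "cmod (gsmooth c \<psi> x) \<le> B" by (simp add: std_normal_integral)
qed

text \<open>
  Against a continuous bounded function the smoothing converges pointwise, so the regularised
  Parseval identity passes to the limit on the right-hand side, while on the left the weight is
  at most \<open>1\<close>.
\<close>

lemma plancherel_test_function:
  assumes f: "integrable lborel f" "f \<in> L2"
    and \<psi>: "integrable lborel \<psi>" "\<psi> \<in> L2" "continuous_on UNIV \<psi>" "\<And>x. cmod (\<psi> x) \<le> B"
  shows "cmod (LINT x|lborel. f x * cnj (\<psi> x)) \<le> L2_norm (fourier f) * L2_norm \<psi>"
proof -
  have B: "B \<ge> 0" using \<psi>(4)[of 0] norm_ge_zero order_trans by blast
  have \<psi>m [measurable]: "\<psi> \<in> borel_measurable borel" using \<psi>(3) by (rule borel_measurable_continuous_onI)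
  note [measurable] = borel_measurable_integrable[OF f(1)]
  have gm [measurable]: "gsmooth c \<psi> \<in> borel_measurable lborel" for c
    unfolding gsmooth_def[abs_def] by measurable
  have "(\<lambda>n. LINT x|lborel. f x * cnj (gsmooth (real (Suc n)) \<psi> x)) \<longlonglongrightarrow> (LINT x|lborel. f x * cnj (\<psi> x))"
  proof (rule integral_dominated_convergence)
    show "integrable lborel (\<lambda>x. B * cmod (f x))" using f by simp
    show "AE x in lborel. (\<lambda>n. f x * cnj (gsmooth (real (Suc n)) \<psi> x)) \<longlonglongrightarrow> f x * cnj (\<psi> x)"
      by (intro AE_I2 tendsto_intros gsmooth_limit(1)[OF \<psi>(3,4)])
    show "AE x in lborel. cmod (f x * cnj (gsmooth (real (Suc n)) \<psi> x)) \<le> B * cmod (f x)" for n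
    proof (intro AE_I2)
      fix x
      have "cmod (gsmooth (real (Suc n)) \<psi> x) \<le> B" by (rule gsmooth_limit(2)[OF \<psi>(3,4)]) simp_all
      then have "cmod (f x) * cmod (gsmooth (real (Suc n)) \<psi> x) \<le> cmod (f x) * B" by (intro mult_left_mono) auto
      then show "cmod (f x * cnj (gsmooth (real (Suc n)) \<psi> x)) \<le> B * cmod (f x)"
        by (simp only: norm_mult complex_mod_cnj mult.commute)
    qed
    show "(\<lambda>x. f x * cnj (\<psi> x)) \<in> borel_measurable lborel"
      by (intro borel_measurable_times cnj_measurable) measurable
    show "(\<lambda>x. f x * cnj (gsmooth (real (Suc n)) \<psi> x)) \<in> borel_measurable lborel" for n
      by (intro borel_measurable_times cnj_measurable) measurable
  qed
  then have "(\<lambda>n. cmod (LINT x|lborel. f x * cnj (gsmooth (real (Suc n)) \<psi> x))) \<longlonglongrightarrow> cmod (LINT x|lborel. f x * cnj (\<psi> x))"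
    by (rule tendsto_norm)
  moreover have "cmod (LINT x|lborel. f x * cnj (gsmooth (real (Suc n)) \<psi> x)) \<le> L2_norm (fourier f) * L2_norm \<psi>" for n
  proof -
    let ?c = "real (Suc n)"
    let ?w = "\<lambda>x. complex_of_real (gweight ?c x)"
    have w: "?w \<in> borel_measurable lborel" by measurable
    have w1: "cmod (?w x) \<le> 1" for x using gweight_bounds[of ?c x] by simp
    note wf = L2_bounded_mult[OF fourier_L2(1)[OF f] w w1]
    have "(LINT x|lborel. f x * cnj (gsmooth ?c \<psi> x)) = (LINT x|lborel. (?w x * fourier f x) * cnj (fourier \<psi> x))"
      using fourier_pairing[OF f(1) \<psi>(1), of ?c] by (simp add: mult_ac)
    then have "cmod (LINT x|lborel. f x * cnj (gsmooth ?c \<psi> x)) \<le> L2_norm (\<lambda>x. ?w x * fourier f x) * L2_norm (fourier \<psi>)"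
      using L2_cauchy_schwarz[OF wf(1) fourier_L2(1)[OF \<psi>(1,2)]] by simp
    also have "\<dots> \<le> L2_norm (fourier f) * L2_norm \<psi>"
      using wf(2) fourier_L2(2)[OF \<psi>(1,2)] by (intro mult_mono) auto
    finally show ?thesis .
  qed
  ultimately show ?thesis by (intro LIMSEQ_le_const2) auto
qed

definition clamp_disc :: "real \<Rightarrow> complex \<Rightarrow> complex" where
  "clamp_disc k z = z / of_real (max 1 (cmod z / k))"

definition cutoff :: "real \<Rightarrow> real \<Rightarrow> real" where
  "cutoff k x = max 0 (min 1 (k + 1 - \<bar>x\<bar>))"

lemma continuous_clamp_disc: "k > 0 \<Longrightarrow> continuous_on UNIV (clamp_disc k)"
  unfolding clamp_disc_def[abs_def]
  by (intro continuous_intros) (auto simp: max_def)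

lemma cmod_clamp_disc: "cmod (clamp_disc k z) = cmod z / max 1 (cmod z / k)"
  by (simp add: clamp_disc_def norm_divide)

lemma clamp_disc_le:
  assumes "k > 0" shows "cmod (clamp_disc k z) \<le> k" "cmod (clamp_disc k z) \<le> cmod z"
proof -
  have "cmod z \<le> k * max 1 (cmod z / k)"
    using mult_left_mono[of "cmod z / k" "max 1 (cmod z / k)" k] assms by simp
  then show "cmod (clamp_disc k z) \<le> k"
    unfolding cmod_clamp_disc by (simp add: pos_divide_le_eq)
  have "cmod z * 1 \<le> cmod z * max 1 (cmod z / k)" by (intro mult_left_mono) auto
  then show "cmod (clamp_disc k z) \<le> cmod z"
    unfolding cmod_clamp_disc by (simp add: pos_divide_le_eq)
qed

lemma clamp_disc_id: "k > 0 \<Longrightarrow> cmod z \<le> k \<Longrightarrow> clamp_disc k z = z"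
  by (simp add: clamp_disc_def max_def divide_le_eq_1)

lemma cutoff_simps:
  "0 \<le> cutoff k x" "cutoff k x \<le> 1" "\<bar>x\<bar> \<le> k \<Longrightarrow> cutoff k x = 1" "k + 1 \<le> \<bar>x\<bar> \<Longrightarrow> cutoff k x = 0"
  by (auto simp: cutoff_def)

lemma clamp_pairing:
  assumes "k > 0" "0 \<le> t" "t \<le> 1"
  shows "(cmod (clamp_disc k z * of_real t))\<^sup>2 \<le> Re (z * cnj (clamp_disc k z * of_real t))"
proof -
  let ?m = "max 1 (cmod z / k)"
  have m: "?m \<ge> 1" by simp
  have "z * cnj (clamp_disc k z * of_real t) = of_real ((cmod z)\<^sup>2 / ?m * t)"
    by (simp add: clamp_disc_def complex_norm_square del: of_real_power)
  then have "Re (z * cnj (clamp_disc k z * of_real t)) = (cmod z)\<^sup>2 / ?m * t" by (simp only: Re_complex_of_real)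
  moreover have "(cmod (clamp_disc k z * of_real t))\<^sup>2 = (cmod z)\<^sup>2 / ?m * t * (t / ?m)"
    by (simp add: norm_mult cmod_clamp_disc power2_eq_square)
  moreover have "(cmod z)\<^sup>2 / ?m * t * (t / ?m) \<le> (cmod z)\<^sup>2 / ?m * t * 1"
  proof (intro mult_left_mono mult_nonneg_nonneg)
    have "t / ?m \<le> t / 1" using assms by (intro divide_left_mono) auto
    then show "t / ?m \<le> 1" using assms by simp
  qed (use assms in auto)
  ultimately show ?thesis by simp
qed

lemma ae_continuous_approximation:
  fixes f :: "real \<Rightarrow> complex"
  assumes "f \<in> borel_measurable lborel"
  obtains g where "\<And>n::nat. continuous_on UNIV (g n)" "AE x in lborel. (\<lambda>n. g n x) \<longlonglongrightarrow> f x"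
proof -
  have "f \<in> borel_measurable lebesgue" using assms by (rule measurable_completion)
  then have "f measurable_on UNIV" using measurable_on_iff_borel_measurable[of UNIV f] by simp
  then obtain N g where N: "negligible N" "\<And>n. continuous_on UNIV (g n)" "\<And>x. x \<notin> N \<Longrightarrow> (\<lambda>n. g n x) \<longlonglongrightarrow> f x"
    unfolding measurable_on_def by auto
  have "AE x in lebesgue. (\<lambda>n. g n x) \<longlonglongrightarrow> f x"
    by (rule AE_I'[of N]) (use N in \<open>auto simp: negligible_iff_null_sets\<close>)
  then have "AE x in lborel. (\<lambda>n. g n x) \<longlonglongrightarrow> f x" by (simp add: AE_completion_iff)
  with N(2) that show ?thesis by blast
qed

text \<open>
  It remains to bound \<open>\<parallel>f\<parallel>\<close> by the norm of the transform.  Testing against \<open>f\<close> itself is not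
  possible, since \<open>f\<close> need not be continuous; but \<open>f\<close> is an almost everywhere limit of continuous
  functions, and clamping their values to a disc and cutting off their supports makes the
  convergence dominated.  The resulting test function \<open>F k\<close> is \<open>f\<close> multiplied by a factor in
  \<open>[0,1]\<close>, so that pairing it with \<open>f\<close> dominates \<open>\<parallel>F k\<parallel>\<^sup>2\<close>.
\<close>

theorem plancherel:
  assumes f: "integrable lborel f" "f \<in> L2"
  shows "L2_norm (fourier f) = L2_norm f"
proof (rule antisym[OF fourier_L2(2)[OF f]])
  have fm [measurable]: "f \<in> borel_measurable borel" using L2_measurable[OF f(2)] by simp
  obtain g where g: "\<And>n::nat. continuous_on UNIV (g n)" "AE x in lborel. (\<lambda>n. g n x) \<longlonglongrightarrow> f x"
    using ae_continuous_approximation[OF L2_measurable[OF f(2)]] by blast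
  define F where "F k x = clamp_disc k (f x) * of_real (cutoff k x)" for k x
  have [measurable]: "clamp_disc k \<in> borel_measurable borel" if "k > 0" for k
    using that by (intro borel_measurable_continuous_onI continuous_clamp_disc)
  have cutm [measurable]: "cutoff k \<in> borel_measurable borel" for k unfolding cutoff_def[abs_def] by measurable
  have Fm: "F k \<in> borel_measurable lborel" if "k > 0" for k
    unfolding F_def[abs_def] using that by measurable
  have Fle: "cmod (F k x) \<le> cmod (f x)" if "k > 0" for k x
  proof -
    have "cmod (F k x) \<le> cmod (f x) * 1"
      unfolding F_def norm_mult using clamp_disc_le(2)[OF that] cutoff_simps[of k x] by (intro mult_mono) auto
    then show ?thesis by simp
  qed
  have main: "L2_norm (F k) \<le> L2_norm (fourier f)" if k: "k > 0" for k
  proof -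
    have FL2: "F k \<in> L2"
      using Fle[OF k] by (intro L2_dominated[OF Fm[OF k] L2_integrable[OF f(2)]] power_mono) auto
    define \<psi> where "\<psi> n x = clamp_disc k (g n x) * of_real (cutoff k x)" for n x
    define D where "D x = k * indicator {-k-1..k+1} x" for x :: real
    have D2: "integrable lborel (\<lambda>x. (D x)\<^sup>2)" "integrable lborel D"
      by (rule integrableI_bounded_set[where A="{-k-1..k+1}" and B="k\<^sup>2"]; use k in \<open>auto simp: D_def[abs_def] power_mult_distrib indicator_def\<close>)
         (rule integrableI_bounded_set[where A="{-k-1..k+1}" and B="k"]; use k in \<open>auto simp: D_def[abs_def] indicator_def\<close>)
    have D: "cmod (clamp_disc k z * of_real (cutoff k x)) \<le> D x" for z x
    proof (cases "\<bar>x\<bar> \<le> k + 1")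
      case True
      have "cmod (clamp_disc k z * of_real (cutoff k x)) \<le> k * 1"
        unfolding norm_mult using clamp_disc_le(1)[OF k] cutoff_simps[of k x] k by (intro mult_mono) auto
      then show ?thesis using True by (auto simp: D_def indicator_def)
    qed (use k in \<open>simp add: cutoff_simps D_def\<close>)
    have \<psi>c: "continuous_on UNIV (\<psi> n)" for n
      unfolding \<psi>_def cutoff_def
      by (intro continuous_intros continuous_on_compose2[OF continuous_clamp_disc[OF k] g(1)]) auto
    have \<psi>m: "\<psi> n \<in> borel_measurable lborel" for n
      using borel_measurable_continuous_onI[OF \<psi>c] by simp
    have \<psi>L2: "\<psi> n \<in> L2" for n
      using D by (intro L2_dominated[OF \<psi>m D2(1)] power_mono) (auto simp: \<psi>_def)
    have \<psi>L1: "integrable lborel (\<psi> n)" for n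
      by (rule Bochner_Integration.integrable_bound[OF D2(2) \<psi>m]) (use D in \<open>auto simp: \<psi>_def intro: order_trans[OF _ abs_ge_self]\<close>)
    have \<psi>k: "cmod (\<psi> n x) \<le> k" for n x
    proof -
      have "cmod (\<psi> n x) \<le> D x" unfolding \<psi>_def by (rule D)
      also have "D x \<le> k" using k by (simp add: D_def indicator_def)
      finally show ?thesis .
    qed
    have ae: "AE x in lborel. (\<lambda>n. \<psi> n x) \<longlonglongrightarrow> F k x"
      using g(2)
    proof eventually_elim
      case (elim x)
      have "isCont (clamp_disc k) (f x)" using continuous_clamp_disc[OF k] by (simp add: continuous_on_eq_continuous_at)
      from isCont_tendsto_compose[OF this elim] show ?case
        unfolding \<psi>_def F_def by (intro tendsto_mult tendsto_const)
    qed
    have l1: "(\<lambda>n. LINT x|lborel. f x * cnj (\<psi> n x)) \<longlonglongrightarrow> (LINT x|lborel. f x * cnj (F k x))"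
    proof (rule integral_dominated_convergence)
      show "integrable lborel (\<lambda>x. k * cmod (f x))" using f by simp
      show "AE x in lborel. (\<lambda>n. f x * cnj (\<psi> n x)) \<longlonglongrightarrow> f x * cnj (F k x)"
        using ae by eventually_elim (intro tendsto_intros)
      show "AE x in lborel. cmod (f x * cnj (\<psi> n x)) \<le> k * cmod (f x)" for n
      proof (intro AE_I2)
        fix x
        have "cmod (f x) * cmod (\<psi> n x) \<le> cmod (f x) * k" by (intro mult_left_mono \<psi>k) simp
        then show "cmod (f x * cnj (\<psi> n x)) \<le> k * cmod (f x)"
          by (simp only: norm_mult complex_mod_cnj mult.commute)
      qed
    qed (intro borel_measurable_times cnj_measurable Fm k \<psi>m; simp)+
    have "(\<lambda>n. (L2_norm (\<psi> n))\<^sup>2) \<longlonglongrightarrow> (L2_norm (F k))\<^sup>2"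
      unfolding L2_norm_sq
    proof (rule integral_dominated_convergence[OF _ _ D2(1)])
      show "AE x in lborel. (\<lambda>n. (cmod (\<psi> n x))\<^sup>2) \<longlonglongrightarrow> (cmod (F k x))\<^sup>2"
        using ae by eventually_elim (intro tendsto_intros)
      show "AE x in lborel. norm ((cmod (\<psi> n x))\<^sup>2) \<le> (D x)\<^sup>2" for n
        using D by (intro AE_I2) (auto simp: \<psi>_def intro!: power_mono)
    qed (use Fm[OF k] \<psi>m in measurable)
    from tendsto_real_sqrt[OF this] have l2: "(\<lambda>n. L2_norm (\<psi> n)) \<longlonglongrightarrow> L2_norm (F k)" by simp
    have "cmod (LINT x|lborel. f x * cnj (F k x)) \<le> L2_norm (fourier f) * L2_norm (F k)"
      by (rule LIMSEQ_le[OF tendsto_norm[OF l1] tendsto_mult[OF tendsto_const l2]])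
        (use plancherel_test_function[OF f \<psi>L1 \<psi>L2 \<psi>c \<psi>k] in blast)
    moreover have "(L2_norm (F k))\<^sup>2 \<le> cmod (LINT x|lborel. f x * cnj (F k x))"
    proof -
      have I: "integrable lborel (\<lambda>x. f x * cnj (F k x))" by (rule L2_mult_integrable[OF f(2) L2_cnj[OF FL2]])
      have "(L2_norm (F k))\<^sup>2 \<le> (LINT x|lborel. Re (f x * cnj (F k x)))"
        unfolding L2_norm_sq
        using clamp_pairing[OF k cutoff_simps(1,2)]
        by (intro integral_mono L2_integrable FL2 integrable_Re I) (simp only: F_def)
      also have "\<dots> = Re (LINT x|lborel. f x * cnj (F k x))" by (rule integral_Re[OF I])
      also have "\<dots> \<le> cmod (LINT x|lborel. f x * cnj (F k x))" by (rule complex_Re_le_cmod)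
      finally show ?thesis .
    qed
    ultimately have "L2_norm (F k) * L2_norm (F k) \<le> L2_norm (fourier f) * L2_norm (F k)"
      by (simp add: power2_eq_square)
    then show ?thesis using L2_norm_nonneg[of "F k"] L2_norm_nonneg[of "fourier f"]
      by (cases "L2_norm (F k) = 0") (auto simp: mult_le_cancel_right)
  qed
  have "(\<lambda>n. (L2_norm (F (real (Suc n))))\<^sup>2) \<longlonglongrightarrow> (L2_norm f)\<^sup>2"
    unfolding L2_norm_sq
  proof (rule integral_dominated_convergence[OF _ _ L2_integrable[OF f(2)]])
    show "AE x in lborel. (\<lambda>n. (cmod (F (real (Suc n)) x))\<^sup>2) \<longlonglongrightarrow> (cmod (f x))\<^sup>2"
    proof (intro AE_I2 tendsto_eventually)
      fix x
      show "\<forall>\<^sub>F n in sequentially. (cmod (F (real (Suc n)) x))\<^sup>2 = (cmod (f x))\<^sup>2"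
        using eventually_ge_at_top[of "nat \<lceil>max \<bar>x\<bar> (cmod (f x))\<rceil>"]
      proof eventually_elim
        case (elim n)
        then have "\<bar>x\<bar> \<le> real (Suc n)" "cmod (f x) \<le> real (Suc n)" by linarith+
        then show ?case by (simp add: F_def cutoff_simps clamp_disc_id del: of_nat_Suc)
      qed
    qed
    show "AE x in lborel. norm ((cmod (F (real (Suc n)) x))\<^sup>2) \<le> (cmod (f x))\<^sup>2" for n
      using Fle[of "real (Suc n)"] by (intro AE_I2) (auto intro!: power_mono)
    show "(\<lambda>x. (cmod (F (real (Suc n)) x))\<^sup>2) \<in> borel_measurable lborel" for n
      using Fm[of "real (Suc n)"] by measurable
  qed simp
  moreover have "(L2_norm (F (real (Suc n))))\<^sup>2 \<le> (L2_norm (fourier f))\<^sup>2" for n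
    using main[of "real (Suc n)"] by (intro power_mono) auto
  ultimately have "(L2_norm f)\<^sup>2 \<le> (L2_norm (fourier f))\<^sup>2" by (intro LIMSEQ_le_const2) auto
  then show "L2_norm f \<le> L2_norm (fourier f)" by (rule power2_le_imp_le) simp
qed

section \<open>The transform of a finite sum of shifts\<close>

definition shift_sum :: "(real \<Rightarrow> complex) \<Rightarrow> (real \<Rightarrow> complex) \<Rightarrow> real set \<Rightarrow> real \<Rightarrow> complex" where
  "shift_sum G c X x = (\<Sum>\<gamma>\<in>X. c \<gamma> * G (x - \<gamma>))"

lemma shift_sum_L2: "G \<in> L2 \<Longrightarrow> shift_sum G c X \<in> L2"
  unfolding shift_sum_def[abs_def] by (intro L2_sum L2_scale L2_shift)

lemma shift_sum_norm_le:
  assumes "finite X" "G \<in> L2"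
  shows "L2_norm (shift_sum G c X) \<le> (\<Sum>\<gamma>\<in>X. cmod (c \<gamma>)) * L2_norm G"
proof -
  have "L2_norm (shift_sum G c X) \<le> (\<Sum>\<gamma>\<in>X. L2_norm (\<lambda>x. c \<gamma> * G (x - \<gamma>)))"
    unfolding shift_sum_def[abs_def] using assms by (intro L2_norm_sum_le L2_scale L2_shift)
  then show ?thesis using assms(2) by (simp add: L2_norm_scale L2_shift sum_distrib_right)
qed

lemma fourier_shift_sum:
  assumes X: "finite X" and f: "integrable lborel f"
  shows "fourier (shift_sum f c X) x = cnj (expsum (\<lambda>\<gamma>. cnj (c \<gamma>)) X x) * fourier f x"
    and "integrable lborel (shift_sum f c X)"
proof -
  have sI: "integrable lborel (\<lambda>t. f (t - \<gamma>))" for \<gamma>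
    using lborel_integrable_real_affine[OF f, of 1 "- \<gamma>"] by simp
  show "integrable lborel (shift_sum f c X)"
    unfolding shift_sum_def[abs_def] using sI by simp
  have s: "(LINT t|lborel. ee (- (x * t)) * f (t - \<gamma>)) = ee (- (x * \<gamma>)) * fourier f x" for \<gamma>
  proof -
    have "(LINT t|lborel. ee (- (x * t)) * f (t - \<gamma>)) = (LINT t|lborel. ee (- (x * (\<gamma> + 1 * t))) * f (\<gamma> + 1 * t - \<gamma>))"
      using lborel_integral_real_affine[of 1 "\<lambda>t. ee (- (x * t)) * f (t - \<gamma>)" \<gamma>] by simp
    also have "\<dots> = (LINT t|lborel. ee (- (x * \<gamma>)) * (ee (- (x * t)) * f t))"
    proof (intro Bochner_Integration.integral_cong refl)
      fix t
      have "ee (- (x * (\<gamma> + 1 * t))) = ee (- (x * \<gamma>)) * ee (- (x * t))"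
        by (simp add: ee_add[symmetric] algebra_simps)
      then show "ee (- (x * (\<gamma> + 1 * t))) * f (\<gamma> + 1 * t - \<gamma>) = ee (- (x * \<gamma>)) * (ee (- (x * t)) * f t)" by simp
    qed
    finally show ?thesis by (simp add: fourier_ee)
  qed
  have "fourier (shift_sum f c X) x = (LINT t|lborel. (\<Sum>\<gamma>\<in>X. c \<gamma> * (ee (- (x * t)) * f (t - \<gamma>))))"
    unfolding fourier_ee shift_sum_def by (simp add: sum_distrib_left mult_ac)
  also have "\<dots> = (\<Sum>\<gamma>\<in>X. c \<gamma> * (LINT t|lborel. ee (- (x * t)) * f (t - \<gamma>)))"
    by (subst Bochner_Integration.integral_sum) (auto intro!: integrable_mult_right integrable_ee_mult sI)
  also have "\<dots> = (\<Sum>\<gamma>\<in>X. c \<gamma> * ee (- (x * \<gamma>))) * fourier f x"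
    unfolding s by (simp add: sum_distrib_right mult.assoc)
  also have "(\<Sum>\<gamma>\<in>X. c \<gamma> * ee (- (x * \<gamma>))) = cnj (expsum (\<lambda>\<gamma>. cnj (c \<gamma>)) X x)"
    by (simp add: expsum_def cnj_ee mult.commute)
  finally show "fourier (shift_sum f c X) x = cnj (expsum (\<lambda>\<gamma>. cnj (c \<gamma>)) X x) * fourier f x" .
qed

text \<open>
  Plancherel for integrable square-integrable functions passes to the limit along the sequence
  that defines the \<open>L\<^sup>2\<close> transform, because multiplication by an exponential sum is bounded.  The
  conjugations appear because a shift by \<open>\<gamma>\<close> corresponds to the frequency \<open>-\<gamma>\<close>.
\<close>

lemma shift_sum_norm_fourier:
  assumes G: "G \<in> L2" and GH: "has_fourier_L2 G H" and X: "finite X"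
  shows "L2_norm (shift_sum G c X) = L2_norm (\<lambda>x. cnj (expsum (\<lambda>\<gamma>. cnj (c \<gamma>)) X x) * H x)"
proof -
  from GH obtain f where f: "\<And>n. f n \<in> L2" "\<And>n. integrable lborel (f n)"
    and fG: "L2_tendsto f G sequentially" and fH: "L2_tendsto (\<lambda>n. fourier (f n)) H sequentially"
    unfolding has_fourier_L2_def by blast
  let ?E = "\<lambda>x. cnj (expsum (\<lambda>\<gamma>. cnj (c \<gamma>)) X x)"
  define K where "K = (\<Sum>\<gamma>\<in>X. cmod (c \<gamma>))"
  have Em: "?E \<in> borel_measurable lborel"
    using borel_measurable_continuous_onI[of ?E] by (simp add: continuous_intros)
  have EK: "cmod (?E x) \<le> K" for x
    unfolding expsum_def K_def complex_mod_cnj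
    by (intro order_trans[OF norm_sum] sum_mono) (simp add: norm_mult)
  have 1: "L2_tendsto (\<lambda>n. shift_sum (f n) c X) (shift_sum G c X) sequentially"
    unfolding L2_tendsto_def
  proof (intro conjI)
    have "(\<lambda>n. K * L2_norm (\<lambda>x. f n x - G x)) \<longlonglongrightarrow> K * 0"
      using fG unfolding L2_tendsto_def by (intro tendsto_mult tendsto_const) auto
    then have lim: "(\<lambda>n. K * L2_norm (\<lambda>x. f n x - G x)) \<longlonglongrightarrow> 0" by simp
    show "(\<lambda>n. L2_norm (\<lambda>x. shift_sum (f n) c X x - shift_sum G c X x)) \<longlonglongrightarrow> 0"
    proof (rule Lim_null_comparison[OF always_eventually lim], intro allI)
      fix n
      have "(\<lambda>x. shift_sum (f n) c X x - shift_sum G c X x) = shift_sum (\<lambda>x. f n x - G x) c X"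
        by (auto simp: shift_sum_def sum_subtractf right_diff_distrib)
      then show "norm (L2_norm (\<lambda>x. shift_sum (f n) c X x - shift_sum G c X x)) \<le> K * L2_norm (\<lambda>x. f n x - G x)"
        using shift_sum_norm_le[OF X L2_diff[OF f(1) G]] by (simp add: K_def)
    qed
  qed (use f G in \<open>auto intro!: shift_sum_L2 always_eventually\<close>)
  have HL2: "H \<in> L2" using fH by (simp add: L2_tendsto_def)
  have fL2: "fourier (f n) \<in> L2" for n by (rule fourier_L2(1)[OF f(2,1)])
  have 2: "L2_tendsto (\<lambda>n x. ?E x * fourier (f n) x) (\<lambda>x. ?E x * H x) sequentially"
    unfolding L2_tendsto_def
  proof (intro conjI)
    have "(\<lambda>n. K * L2_norm (\<lambda>x. fourier (f n) x - H x)) \<longlonglongrightarrow> K * 0"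
      using fH unfolding L2_tendsto_def by (intro tendsto_mult tendsto_const) auto
    then have lim: "(\<lambda>n. K * L2_norm (\<lambda>x. fourier (f n) x - H x)) \<longlonglongrightarrow> 0" by simp
    show "(\<lambda>n. L2_norm (\<lambda>x. ?E x * fourier (f n) x - ?E x * H x)) \<longlonglongrightarrow> 0"
    proof (rule Lim_null_comparison[OF always_eventually lim], intro allI)
      fix n
      show "norm (L2_norm (\<lambda>x. ?E x * fourier (f n) x - ?E x * H x)) \<le> K * L2_norm (\<lambda>x. fourier (f n) x - H x)"
        using L2_bounded_mult(2)[OF L2_diff[OF fL2 HL2] Em EK] by (simp add: right_diff_distrib)
    qed
  qed (auto intro!: L2_bounded_mult(1)[OF _ Em EK] HL2 fL2 always_eventually)
  have "L2_norm (shift_sum (f n) c X) = L2_norm (\<lambda>x. ?E x * fourier (f n) x)" for n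
    using plancherel[OF fourier_shift_sum(2)[OF X f(2)] shift_sum_L2[OF f(1)]]
    by (simp add: fourier_shift_sum(1)[OF X f(2), abs_def])
  then show ?thesis
    using L2_tendsto_norm[OF 1] L2_tendsto_norm[OF 2] LIMSEQ_unique by simp
qed

section \<open>Stability of shifts\<close>

lemma shift_sum_Diff:
  assumes "finite X" "finite Y"
  shows "shift_sum G c X x - shift_sum G c Y x = shift_sum G c (X - Y) x - shift_sum G c (Y - X) x"
proof -
  have "shift_sum G c X x = shift_sum G c (X - Y) x + shift_sum G c (X \<inter> Y) x"
    unfolding shift_sum_def by (subst sum.Int_Diff[OF assms(1), of _ Y]) (rule add.commute)
  moreover have "shift_sum G c Y x = shift_sum G c (Y - X) x + shift_sum G c (X \<inter> Y) x"
    unfolding shift_sum_def by (subst sum.Int_Diff[OF assms(2), of _ X]) (simp add: Int_commute)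
  ultimately show ?thesis by simp
qed

text \<open>
  For finitely supported coefficients the net of partial sums is eventually constant.
\<close>

lemma stable_imp_finite_bounds:
  assumes G: "G \<in> L2" and stable: "l2_stable_shifts \<Gamma> G"
  obtains A where "A > 0"
    "\<And>X c. finite X \<Longrightarrow> X \<subseteq> \<Gamma> \<Longrightarrow> A * (\<Sum>\<gamma>\<in>X. (cmod (c \<gamma>))\<^sup>2) \<le> (L2_norm (shift_sum G c X))\<^sup>2"
proof -
  from stable obtain C1 where C1: "C1 > 0"
    "\<And>c. c \<in> ell2 \<Gamma> \<Longrightarrow> \<exists>F. has_shift_sum \<Gamma> G c F \<and> C1 * ell2_norm \<Gamma> c \<le> L2_norm F"
    unfolding l2_stable_shifts_def by blast
  show ?thesis
  proof
    show "C1\<^sup>2 > 0" using C1 by simp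
    fix X and c :: "real \<Rightarrow> complex" assume X: "finite X" "X \<subseteq> \<Gamma>"
    define c0 where "c0 \<gamma> = (if \<gamma> \<in> X then c \<gamma> else 0)" for \<gamma>
    let ?S = "\<Sum>\<gamma>\<in>X. (cmod (c \<gamma>))\<^sup>2"
    have "((\<lambda>\<gamma>. (cmod (c \<gamma>))\<^sup>2) has_sum ?S) X" using X by (intro has_sum_finite)
    then have hs: "((\<lambda>\<gamma>. (cmod (c0 \<gamma>))\<^sup>2) has_sum ?S) \<Gamma>"
      by (rule has_sum_cong_neutral[THEN iffD1, rotated -1]) (use X in \<open>auto simp: c0_def\<close>)
    then have c0: "c0 \<in> ell2 \<Gamma>" by (auto simp: ell2_def summable_on_def)
    have n0: "ell2_norm \<Gamma> c0 = sqrt ?S" unfolding ell2_norm_def using infsumI[OF hs] by simp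
    from C1(2)[OF c0] obtain F where F: "L2_tendsto (\<lambda>X. shift_sum G c0 X) F (finite_subsets_at_top \<Gamma>)"
      "C1 * sqrt ?S \<le> L2_norm F"
      unfolding n0 has_shift_sum_def shift_sum_def[abs_def] by blast
    have "\<forall>\<^sub>F Y in finite_subsets_at_top \<Gamma>. L2_norm (shift_sum G c0 Y) = L2_norm (shift_sum G c X)"
      unfolding eventually_finite_subsets_at_top
    proof (intro exI conjI allI impI)
      fix Y assume Y: "finite Y \<and> X \<subseteq> Y \<and> Y \<subseteq> \<Gamma>"
      have "shift_sum G c0 Y = shift_sum G c X"
        unfolding shift_sum_def[abs_def] using Y
        by (intro ext sum.mono_neutral_cong_right) (auto simp: c0_def)
      then show "L2_norm (shift_sum G c0 Y) = L2_norm (shift_sum G c X)" by simp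
    qed (use X in auto)
    then have "((\<lambda>Y. L2_norm (shift_sum G c0 Y)) \<longlongrightarrow> L2_norm (shift_sum G c X)) (finite_subsets_at_top \<Gamma>)"
      by (rule tendsto_eventually)
    with L2_tendsto_norm[OF F(1)] have "L2_norm F = L2_norm (shift_sum G c X)"
      by (rule tendsto_unique[rotated]) simp
    with F(2) have "(C1 * sqrt ?S)\<^sup>2 \<le> (L2_norm (shift_sum G c X))\<^sup>2"
      using C1 by (intro power_mono) (auto simp: sum_nonneg)
    then show "C1\<^sup>2 * ?S \<le> (L2_norm (shift_sum G c X))\<^sup>2"
      by (simp add: power_mult_distrib sum_nonneg)
  qed
qed

text \<open>
  Two partial sums differ by sums over disjoint finite sets, whose norms are controlled by the
  tails of \<open>\<Sum>|c\<^sub>\<gamma>|\<^sup>2\<close>.  A sequence of finite sets with tails tending to \<open>0\<close> yields the limit, and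
  the same estimate shows that the whole net converges to it.
\<close>

lemma finite_bounds_imp_stable:
  assumes G: "G \<in> L2" and A: "A1 > 0" "A2 > 0"
    and low: "\<And>X c. finite X \<Longrightarrow> X \<subseteq> \<Gamma> \<Longrightarrow> A1 * (\<Sum>\<gamma>\<in>X. (cmod (c \<gamma>))\<^sup>2) \<le> (L2_norm (shift_sum G c X))\<^sup>2"
    and up: "\<And>X c. finite X \<Longrightarrow> X \<subseteq> \<Gamma> \<Longrightarrow> (L2_norm (shift_sum G c X))\<^sup>2 \<le> A2 * (\<Sum>\<gamma>\<in>X. (cmod (c \<gamma>))\<^sup>2)"
  shows "l2_stable_shifts \<Gamma> G"
proof -
  have "\<exists>F. has_shift_sum \<Gamma> G c F \<and> sqrt A1 * ell2_norm \<Gamma> c \<le> L2_norm F \<and> L2_norm F \<le> sqrt A2 * ell2_norm \<Gamma> c"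
    if c: "c \<in> ell2 \<Gamma>" for c
  proof -
    let ?w = "\<lambda>\<gamma>. (cmod (c \<gamma>))\<^sup>2"
    define S where "S = (\<Sum>\<^sub>\<infinity>\<gamma>\<in>\<Gamma>. ?w \<gamma>)"
    have hs: "(?w has_sum S) \<Gamma>" using c unfolding S_def ell2_def by (simp add: has_sum_infsum)
    define tail where "tail X = S - sum ?w X" for X
    have le_tail: "sum ?w (Y - X) \<le> tail X" if "finite X" "X \<subseteq> \<Gamma>" "finite Y" "Y \<subseteq> \<Gamma>" for X Y
    proof -
      have "sum ?w (X \<union> Y) \<le> S"
        using that by (intro has_sum_mono_neutral[OF has_sum_finite hs]) auto
      moreover have "sum ?w (X \<union> (Y - X)) = sum ?w X + sum ?w (Y - X)"
        using that by (intro sum.union_disjoint) auto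
      ultimately show ?thesis by (simp add: tail_def)
    qed
    have tail0: "0 \<le> tail X" if "finite X" "X \<subseteq> \<Gamma>" for X
      using le_tail[OF that that] by simp
    have tail_lim: "(tail \<longlongrightarrow> 0) (finite_subsets_at_top \<Gamma>)"
      using tendsto_diff[OF tendsto_const[of S] hs[unfolded has_sum_def]] by (simp add: tail_def[abs_def])
    let ?s = "\<lambda>X. shift_sum G c X"
    have sL2: "?s X \<in> L2" for X by (rule shift_sum_L2[OF G])
    have part: "L2_norm (?s (Y - X)) \<le> sqrt (A2 * tail X)" if "finite X" "X \<subseteq> \<Gamma>" "finite Y" "Y \<subseteq> \<Gamma>" for X Y
    proof -
      have "(L2_norm (?s (Y - X)))\<^sup>2 \<le> A2 * sum ?w (Y - X)" using that by (intro up) auto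
      also have "\<dots> \<le> A2 * tail X" using le_tail[OF that] A by (intro mult_left_mono) auto
      finally show ?thesis by (rule real_le_rsqrt)
    qed
    have diff: "L2_norm (\<lambda>x. ?s X x - ?s Y x) \<le> sqrt (A2 * tail X) + sqrt (A2 * tail Y)"
      if "finite X" "X \<subseteq> \<Gamma>" "finite Y" "Y \<subseteq> \<Gamma>" for X Y
    proof -
      have "L2_norm (\<lambda>x. ?s X x - ?s Y x) = L2_norm (\<lambda>x. ?s (X - Y) x - ?s (Y - X) x)"
        by (simp only: shift_sum_Diff[OF that(1,3)])
      also have "\<dots> \<le> L2_norm (?s (X - Y)) + L2_norm (?s (Y - X))"
        using L2_norm_diff_triangle[OF sL2[of "X - Y"] L2_zero sL2[of "Y - X"]] L2_norm_minus_commute[of "\<lambda>x. 0" "?s (Y - X)"]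
        by simp
      finally show ?thesis using part[OF that] part[OF that(3,4,1,2)] by simp
    qed
    have "\<exists>X. finite X \<and> X \<subseteq> \<Gamma> \<and> tail X < 1 / real (Suc n)" for n
    proof -
      have "\<forall>\<^sub>F X in finite_subsets_at_top \<Gamma>. tail X < 1 / real (Suc n)"
        by (rule order_tendstoD(2)[OF tail_lim]) simp
      then show ?thesis unfolding eventually_finite_subsets_at_top by blast
    qed
    then obtain X where X: "\<And>n. finite (X n)" "\<And>n. X n \<subseteq> \<Gamma>" "\<And>n. tail (X n) < 1 / real (Suc n)" by metis
    have "(\<lambda>n. tail (X n)) \<longlonglongrightarrow> 0"
    proof (rule tendsto_sandwich[OF _ _ tendsto_const LIMSEQ_Suc[OF lim_1_over_n]])
      show "\<forall>\<^sub>F n in sequentially. 0 \<le> tail (X n)"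
        by (rule always_eventually, rule allI, rule tail0[OF X(1,2)])
      show "\<forall>\<^sub>F n in sequentially. tail (X n) \<le> 1 / real (Suc n)"
        by (rule always_eventually, rule allI, rule less_imp_le[OF X(3)])
    qed
    then have "(\<lambda>n. sqrt (A2 * tail (X n))) \<longlonglongrightarrow> sqrt (A2 * 0)" by (intro tendsto_intros)
    then have q: "(\<lambda>n. sqrt (A2 * tail (X n))) \<longlonglongrightarrow> 0" by simp
    obtain F where F: "F \<in> L2" "(\<lambda>n. L2_norm (\<lambda>x. ?s (X n) x - F x)) \<longlonglongrightarrow> 0"
    proof (rule L2_complete[of "\<lambda>n. ?s (X n)"])
      fix e :: real assume e: "e > 0"
      have "\<forall>\<^sub>F n in sequentially. sqrt (A2 * tail (X n)) < e / 2"
        by (rule order_tendstoD(2)[OF q]) (use e in simp)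
      then obtain N where N: "\<And>n. n \<ge> N \<Longrightarrow> sqrt (A2 * tail (X n)) < e / 2" by (auto simp: eventually_sequentially)
      show "\<exists>N. \<forall>i\<ge>N. \<forall>j\<ge>N. L2_norm (\<lambda>x. ?s (X i) x - ?s (X j) x) < e"
      proof (intro exI[of _ N] allI impI)
        fix i j assume "N \<le> i" "N \<le> j"
        then show "L2_norm (\<lambda>x. ?s (X i) x - ?s (X j) x) < e"
          using diff[OF X(1,2) X(1,2), of i j] N[of i] N[of j] by simp
      qed
    qed (use sL2 in auto)
    have FX: "L2_norm (\<lambda>x. ?s Y x - F x) \<le> sqrt (A2 * tail Y)" if Y: "finite Y" "Y \<subseteq> \<Gamma>" for Y
    proof (rule LIMSEQ_le_const)
      show "(\<lambda>n. (sqrt (A2 * tail Y) + sqrt (A2 * tail (X n))) + L2_norm (\<lambda>x. ?s (X n) x - F x)) \<longlonglongrightarrow> sqrt (A2 * tail Y)"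
        using tendsto_add[OF tendsto_add[OF tendsto_const q] F(2), of "sqrt (A2 * tail Y)"] by simp
      show "\<exists>N. \<forall>n\<ge>N. L2_norm (\<lambda>x. ?s Y x - F x) \<le> (sqrt (A2 * tail Y) + sqrt (A2 * tail (X n))) + L2_norm (\<lambda>x. ?s (X n) x - F x)"
        using order_trans[OF L2_norm_diff_triangle[OF sL2 sL2 F(1)] add_right_mono[OF diff[OF Y X(1,2)]]] by blast
    qed
    have "((\<lambda>Y. sqrt (A2 * tail Y)) \<longlongrightarrow> sqrt (A2 * 0)) (finite_subsets_at_top \<Gamma>)" by (intro tendsto_intros tail_lim)
    then have q2: "((\<lambda>Y. sqrt (A2 * tail Y)) \<longlongrightarrow> 0) (finite_subsets_at_top \<Gamma>)" by simp
    have T: "L2_tendsto ?s F (finite_subsets_at_top \<Gamma>)"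
      unfolding L2_tendsto_def
    proof (intro conjI F(1))
      show "\<forall>\<^sub>F Y in finite_subsets_at_top \<Gamma>. ?s Y \<in> L2" using sL2 by simp
      show "((\<lambda>Y. L2_norm (\<lambda>x. ?s Y x - F x)) \<longlongrightarrow> 0) (finite_subsets_at_top \<Gamma>)"
        by (rule Lim_null_comparison[OF eventually_finite_subsets_at_top_weakI q2]) (simp add: FX)
    qed
    note lim = L2_tendsto_norm[OF T]
    have "((\<lambda>Y. sqrt (sum ?w Y)) \<longlongrightarrow> ell2_norm \<Gamma> c) (finite_subsets_at_top \<Gamma>)"
      using tendsto_real_sqrt[OF hs[unfolded has_sum_def]] by (simp add: ell2_norm_def S_def)
    note lim2 = tendsto_mult[OF tendsto_const this]
    have "sqrt A1 * ell2_norm \<Gamma> c \<le> L2_norm F"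
    proof (rule tendsto_le[OF _ lim lim2])
      show "\<forall>\<^sub>F Y in finite_subsets_at_top \<Gamma>. sqrt A1 * sqrt (sum ?w Y) \<le> L2_norm (?s Y)"
      proof (rule eventually_finite_subsets_at_top_weakI)
        fix Y assume "finite Y" "Y \<subseteq> \<Gamma>"
        from real_sqrt_le_mono[OF low[OF this, of c]]
        show "sqrt A1 * sqrt (sum ?w Y) \<le> L2_norm (?s Y)" by (simp add: real_sqrt_mult)
      qed
    qed simp
    moreover have "L2_norm F \<le> sqrt A2 * ell2_norm \<Gamma> c"
    proof (rule tendsto_le[OF _ lim2 lim])
      show "\<forall>\<^sub>F Y in finite_subsets_at_top \<Gamma>. L2_norm (?s Y) \<le> sqrt A2 * sqrt (sum ?w Y)"
      proof (rule eventually_finite_subsets_at_top_weakI)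
        fix Y assume "finite Y" "Y \<subseteq> \<Gamma>"
        from real_sqrt_le_mono[OF up[OF this, of c]]
        show "L2_norm (?s Y) \<le> sqrt A2 * sqrt (sum ?w Y)" by (simp add: real_sqrt_mult)
      qed
    qed simp
    ultimately show ?thesis
      using T unfolding has_shift_sum_def shift_sum_def[abs_def] by blast
  qed
  moreover have "sqrt A1 > 0" "sqrt A2 > 0" using A by simp_all
  ultimately show ?thesis unfolding l2_stable_shifts_def by blast
qed

lemma shift_sum_norm_interval:
  assumes G: "G \<in> L2" and GH: "has_fourier_L2 G H" and H: "continuous_on UNIV H"
    and out: "\<And>t. t \<notin> {a..b} \<Longrightarrow> H t = 0" and X: "finite X"
  shows "(L2_norm (shift_sum G c X))\<^sup>2 = integral {a..b} (\<lambda>t. (cmod (H t))\<^sup>2 * (cmod (expsum (\<lambda>\<gamma>. cnj (c \<gamma>)) X t))\<^sup>2)"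
proof -
  let ?e = "\<lambda>t. (cmod (H t))\<^sup>2 * (cmod (expsum (\<lambda>\<gamma>. cnj (c \<gamma>)) X t))\<^sup>2"
  have "(L2_norm (shift_sum G c X))\<^sup>2 = (LINT t|lborel. ?e t)"
    unfolding shift_sum_norm_fourier[OF G GH X] L2_norm_sq by (simp add: norm_mult power_mult_distrib mult.commute)
  also have "\<dots> = (LINT t:{a..b}|lborel. ?e t)"
    unfolding set_lebesgue_integral_def   proof (intro Bochner_Integration.integral_cong refl)
    fix t show "?e t = indicator {a..b} t *\<^sub>R ?e t" by (cases "t \<in> {a..b}") (simp_all add: out)
  qed
  also have "\<dots> = integral {a..b} ?e"
    by (rule set_borel_integral_eq_integral(2), rule borel_integrable_atLeastAtMost')
      (intro continuous_intros continuous_on_subset[OF H] subset_UNIV)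
  finally show ?thesis .
qed

theorem mainTheorem6:
  fixes \<Gamma> :: "real set" and a b :: real and G H :: "real \<Rightarrow> complex"
  assumes "separated_set \<Gamma>"
    and "a < b"
    and "G \<in> L2"
    and "has_fourier_L2 G H"
    and "continuous_on UNIV H"
    and "zero_set H = UNIV - {a<..<b}"
  shows "l2_stable_shifts \<Gamma> G \<longleftrightarrow> upper_uniform_density \<Gamma> < ennreal (b - a)"
proof -
  note ab = assms(2) and G = assms(3) and GH = assms(4) and H = assms(5)
  obtain \<delta> where \<delta>: "\<delta> > 0" "gaps_ge \<delta> \<Gamma>" using separated_setE[OF assms(1)] .
  have Hz: "H t = 0 \<longleftrightarrow> t \<notin> {a<..<b}" for t
  proof -
    have "t \<in> zero_set H \<longleftrightarrow> t \<notin> {a<..<b}" unfolding assms(6) by blast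
    then show ?thesis by (simp add: zero_set_def)
  qed
  have cH: "continuous_on S (\<lambda>t. (cmod (H t))\<^sup>2)" for S
    by (intro continuous_on_power continuous_on_norm continuous_on_subset[OF H] subset_UNIV)
  obtain l where l: "0 \<le> l" "upper_uniform_density \<Gamma> = ennreal l"
    "\<And>u. l < u \<Longrightarrow> \<exists>s>0. \<exists>K. local_count_le s K \<Gamma> \<and> real K < u * s"
    "\<And>\<theta> r0. 0 \<le> \<theta> \<Longrightarrow> (\<And>r y. r \<ge> r0 \<Longrightarrow> real (card (\<Gamma> \<inter> {y..<y+r})) \<le> \<theta> * r + 2) \<Longrightarrow> l \<le> \<theta>"
    using upper_density_limit[OF \<delta>(2,1)] by blast
  have norm_eq: "(L2_norm (shift_sum G c X))\<^sup>2 = integral {a..b} (\<lambda>t. (cmod (H t))\<^sup>2 * (cmod (expsum (\<lambda>\<gamma>. cnj (c \<gamma>)) X t))\<^sup>2)"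
    if "finite X" for c X
    by (rule shift_sum_norm_interval[OF G GH H _ that]) (auto simp: Hz)
  have "l2_stable_shifts \<Gamma> G \<longleftrightarrow> l < b - a"
  proof
    assume "l2_stable_shifts \<Gamma> G"
    then obtain A where A: "A > 0"
      "\<And>X c. finite X \<Longrightarrow> X \<subseteq> \<Gamma> \<Longrightarrow> A * (\<Sum>\<gamma>\<in>X. (cmod (c \<gamma>))\<^sup>2) \<le> (L2_norm (shift_sum G c X))\<^sup>2"
      using stable_imp_finite_bounds[OF G] by blast
    have low: "A * (\<Sum>\<gamma>\<in>X. (cmod (c \<gamma>))\<^sup>2) \<le> integral {a..b} (\<lambda>t. (cmod (H t))\<^sup>2 * (cmod (expsum c X t))\<^sup>2)"
      if "finite X" "X \<subseteq> \<Gamma>" for c X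
      using A(2)[OF that, of "\<lambda>\<gamma>. cnj (c \<gamma>)"] norm_eq[OF that(1), of "\<lambda>\<gamma>. cnj (c \<gamma>)"] by simp
    obtain \<theta> r0 where "0 \<le> \<theta>" "\<theta> < b - a" "\<And>r y. r \<ge> r0 \<Longrightarrow> real (card (\<Gamma> \<inter> {y..<y+r})) \<le> \<theta> * r + 2"
      by (rule weighted_lower_bound_count[OF ab cH _ _ _ \<delta>(2,1) A(1) low]) (auto simp: Hz)
    with l(4) show "l < b - a" by (meson le_less_trans)
  next
    assume "l < b - a"
    define L where "L = (l + (b - a)) / 2"
    have L: "l < L" "L < b - a" "0 < L" using \<open>l < b - a\<close> l(1) by (auto simp: L_def)
    from l(3)[OF L(1)] obtain s K where sK: "s > 0" "local_count_le s K \<Gamma>" "real K < L * s" by blast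
    obtain C where C: "C > 0"
      "\<And>X c p. finite X \<Longrightarrow> gaps_ge \<delta> X \<Longrightarrow> local_count_le s K X \<Longrightarrow> (\<Sum>x\<in>X. (cmod (c x))\<^sup>2) \<le> C * energy c X p (p + L)"
      using riesz_lower_bound[OF \<delta>(1) sK(1,3)] by blast
    obtain B where B: "B > 0" "\<And>c X p. finite X \<Longrightarrow> gaps_ge \<delta> X \<Longrightarrow> energy c X p (p + (b - a)) \<le> B * (\<Sum>x\<in>X. (cmod (c x))\<^sup>2)"
      using energy_upper[OF \<delta>(1), of "b - a"] ab by auto
    define p where "p = a + (b - a - L) / 2"
    have p: "a < p" "p + L < b" using L by (auto simp: p_def field_simps)
    have "\<exists>t\<in>{p..p+L}. \<forall>u\<in>{p..p+L}. (cmod (H t))\<^sup>2 \<le> (cmod (H u))\<^sup>2"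
      by (rule continuous_attains_inf) (use L cH in auto)
    then obtain t0 where t0: "t0 \<in> {p..p+L}" "\<And>u. u \<in> {p..p+L} \<Longrightarrow> (cmod (H t0))\<^sup>2 \<le> (cmod (H u))\<^sup>2" by blast
    have "\<exists>t\<in>{a..b}. \<forall>u\<in>{a..b}. (cmod (H u))\<^sup>2 \<le> (cmod (H t))\<^sup>2"
      by (rule continuous_attains_sup) (use ab cH in auto)
    then obtain t1 where t1: "\<And>u. u \<in> {a..b} \<Longrightarrow> (cmod (H u))\<^sup>2 \<le> (cmod (H t1))\<^sup>2" by blast
    define m where "m = (cmod (H t0))\<^sup>2"
    define M where "M = (cmod (H t1))\<^sup>2 + 1"
    have m: "m > 0" using t0(1) p Hz[of t0] by (simp add: m_def)
    have M: "M > 0" unfolding M_def by (intro add_nonneg_pos) auto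
    have I: "(\<lambda>t. (cmod (H t))\<^sup>2 * (cmod (expsum c X t))\<^sup>2) integrable_on {u..v}" for c X u v
      by (intro integrable_continuous_interval continuous_on_mult cH continuous_intros)
    show "l2_stable_shifts \<Gamma> G"
    proof (rule finite_bounds_imp_stable[OF G, of "m / C" "M * B"])
      fix X and c :: "real \<Rightarrow> complex" assume X: "finite X" "X \<subseteq> \<Gamma>"
      let ?c = "\<lambda>\<gamma>. cnj (c \<gamma>)"
      let ?S = "\<Sum>\<gamma>\<in>X. (cmod (c \<gamma>))\<^sup>2"
      have X': "gaps_ge \<delta> X" "local_count_le s K X"
        using gaps_ge_subset[OF \<delta>(2) X(2)] local_count_le_subset[OF sK(2) X(2)] by auto
      have "m * energy ?c X p (p + L) \<le> (L2_norm (shift_sum G c X))\<^sup>2"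
      proof -
        have "m * energy ?c X p (p + L) = integral {p..p+L} (\<lambda>t. m * (cmod (expsum ?c X t))\<^sup>2)"
          by (simp add: energy_def)
        also have "\<dots> \<le> integral {p..p+L} (\<lambda>t. (cmod (H t))\<^sup>2 * (cmod (expsum ?c X t))\<^sup>2)"
          using t0(2) by (intro integral_le I mult_right_mono) (auto simp: m_def intro!: integrable_continuous_interval continuous_intros)
        also have "\<dots> \<le> integral {a..b} (\<lambda>t. (cmod (H t))\<^sup>2 * (cmod (expsum ?c X t))\<^sup>2)"
          using p by (intro integral_subset_le I) auto
        finally show ?thesis by (simp add: norm_eq[OF X(1)])
      qed
      moreover have "?S \<le> C * energy ?c X p (p + L)" using C(2)[OF X(1) X', of ?c p] by simp
      then have "m * ?S \<le> C * (m * energy ?c X p (p + L))" using m by (simp add: mult.left_commute)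
      ultimately have "m * ?S \<le> C * (L2_norm (shift_sum G c X))\<^sup>2"
        using C(1) by (meson mult_left_mono order_trans less_imp_le)
      then show "m / C * ?S \<le> (L2_norm (shift_sum G c X))\<^sup>2" using C(1) by (simp add: field_simps)
      have "(L2_norm (shift_sum G c X))\<^sup>2 \<le> integral {a..b} (\<lambda>t. M * (cmod (expsum ?c X t))\<^sup>2)"
        unfolding norm_eq[OF X(1)]
        using t1 by (intro integral_le I mult_right_mono)
          (auto simp: M_def intro!: integrable_continuous_interval continuous_intros add_increasing2)
      also have "\<dots> = M * energy ?c X a (a + (b - a))" by (simp add: energy_def)
      also have "\<dots> \<le> M * (B * ?S)" using B(2)[OF X(1) X'(1), of ?c a] M by (intro mult_left_mono) auto
      finally show "(L2_norm (shift_sum G c X))\<^sup>2 \<le> M * B * ?S" by (simp add: mult.assoc)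
    qed (use m C M B in auto)
  qed
  then show ?thesis using l(1,2) ab by (simp add: ennreal_less_iff)
qed

end
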